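(* Let $k\ge 1$ be a real number. Then $$\limsup_{N\to\infty}\frac{\Psi_k(N)}{(\log N)^{k^2}} \leq \frac{1}{\Gamma(k+1)^{k}}\,\prod_{p}\left(1-\frac{1}{p}\right)^{k^2}\left(1-\frac{k}{\lfloor k\rfloor}\frac{1}{p}\right)^{-k\lfloor k\rfloor}$$ and $$\liminf_{N\to\infty}\frac{\Psi_k(N)}{(\log N)^{k^2}} \geq \frac{1}{\Gamma\left(\lfloor 2k\rfloor k+1\right)^{\frac{k}{\lfloor 2k\rfloor}}}\,\prod_{p} \left(1-\frac{1}{p}\right)^{k^2} \left(1 + \frac{\lfloor 2k \rfloor k}{p}\right)^{\frac{k}{\lfloor 2k \rfloor}},$$ where the products run over all primes $p$. In particular, as $k\to\infty$, $$\liminf_{N\to\infty}\frac{\Psi_k(N)}{(\log N)^{k^2}}\ \ge\ \exp\left((-2+o(1))k^2\log k\right),\qquad \limsup_{N\to\infty}\frac{\Psi_k(N)}{(\log N)^{k^2}}\ \le\ \exp\left((-1+o(1))k^2\log k\right),$$ where each $o(1)$ denotes a function of $k$ alone that tends to $0$ as $k\to\infty$.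
   Context: For a positive integer $N$, let $Z_N(s):=\sum_{n\le N} n^{-1/2-s}$. For real $k>0$, the $2k$th pseudomoment of the Riemann zeta function is $$\Psi_k(N):=\lim_{T\to\infty}\frac1T\int_0^T |Z_N(it)|^{2k}\,dt .$$ (The limit exists for every $N$ and $k>0$.) $\Gamma$ is the Gamma function and $\lfloor\cdot\rfloor$ the integer part. *)

theory Defs
  imports "HOL-Analysis.Analysis" "HOL-Computational_Algebra.Primes"
begin

definition zeta_partial :: "nat \<Rightarrow> complex \<Rightarrow> complex" where
  "zeta_partial N s = (\<Sum>n=1..N. of_nat n powr (- (1/2) - s))"

definition pseudomoment :: "real \<Rightarrow> nat \<Rightarrow> real" where
  "pseudomoment k N =
     Lim at_top (\<lambda>T::real. 1 / T *
       integral {0..T} (\<lambda>t. cmod (zeta_partial N (\<i> * of_real t)) powr (2 * k)))"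

definition normalized_pseudomoment :: "real \<Rightarrow> nat \<Rightarrow> real" where
  "normalized_pseudomoment k N = pseudomoment k N / ln (real N) powr (k\<^sup>2)"

definition prime_prod :: "(real \<Rightarrow> real) \<Rightarrow> real" where
  "prime_prod f = (\<Prod>n. if prime n then f (real n) else 1)"

text \<open>For real \<open>k \<ge> 1\<close> and a prime \<open>p\<close> all bases of real powers below are positive
  (for the upper constant because \<open>k / \<lfloor>k\<rfloor> < 2\<close>), so \<open>powr\<close> is the usual real power.\<close>

definition upper_const :: "real \<Rightarrow> real" where
  "upper_const k =
     1 / Gamma (k + 1) powr k *
     prime_prod (\<lambda>p. (1 - 1 / p) powr (k\<^sup>2) *
       (1 - k / of_int \<lfloor>k\<rfloor> * (1 / p)) powr (- (k * of_int \<lfloor>k\<rfloor>)))"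

definition lower_const :: "real \<Rightarrow> real" where
  "lower_const k =
     1 / Gamma (of_int \<lfloor>2 * k\<rfloor> * k + 1) powr (k / of_int \<lfloor>2 * k\<rfloor>) *
     prime_prod (\<lambda>p. (1 - 1 / p) powr (k\<^sup>2) *
       (1 + of_int \<lfloor>2 * k\<rfloor> * k / p) powr (k / of_int \<lfloor>2 * k\<rfloor>))"

end

theory Submission
  imports Defs "HOL-Probability.Probability" "HOL-Real_Asymp.Real_Asymp"
begin

text \<open>
  By unique factorization and Bohr's correspondence, \<open>pseudomoment k N\<close> is the \<open>2k\<close>-th power of the \<open>L\<^sup>2\<^sup>k\<close> norm
  of \<open>\<Sum>n\<le>N. n powr (-1/2) * z(n)\<close>, where \<open>z\<close> is completely multiplicative with independent values \<open>z(p)\<close>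
  uniform on the unit circle.

  Upper bound: the squared \<open>L\<^sup>2\<^sup>k\<close> norm of a polynomial \<open>\<Sum>j. a j * w ^ j\<close> in one such variable is at most a weighted sum of
  the \<open>\<bar>a j\<bar>\<^sup>2\<close> whose weight at \<open>j = 1\<close> is close to \<open>k\<close>. Minkowski's inequality tensorizes this to Dirichlet
  polynomials without small primes. The small primes are put back one at a time at the cost of the norm
  of their Euler factor, which is estimated by the contractive inequality
  \<open>\<integral>\<bar>1 - c * w\<bar> powr (-2k) \<le> (1 - k/m * \<bar>c\<bar>\<^sup>2) powr (-k * m)\<close> with \<open>m = \<lfloor>k\<rfloor>\<close>.

  Lower bound: for \<open>1 \<le> q \<le> 2\<close> one has \<open>\<parallel>\<Sum>j. a j * w ^ j\<parallel>\<^sup>2 \<ge> \<bar>a 0\<bar>\<^sup>2 + q/2 * \<bar>a 1\<bar>\<^sup>2\<close> in \<open>L\<^sup>q\<close>, which again tensorizes. It is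
  applied with \<open>q = 2k/M\<close>, \<open>M = \<lfloor>2k\<rfloor>\<close>, to the \<open>M\<close>-th power of the Dirichlet polynomial, keeping only the
  squarefree \<open>n \<le> N\<close>.

  Both bounds reduce to sums of nonnegative multiplicative functions, which are evaluated by Karamata's theorem.
\<close>

subsection \<open>Norms of bounded measurable functions\<close>

text \<open>The constants are the delicate point. Weights close to \<open>k\<close> at the primes
  already give the right power of the logarithm, but weights of total mass 1 leave little for the
  exponents \<open>j \<ge> 2\<close>, so every Euler factor comes out too large. These losses form a
  convergent product over the primes. Deleting the primes up to \<open>y\<close> confines them to a
  tail that tends to 1 with \<open>y\<close>, while the deleted primes return with the true norm of
  their Euler factor.

  In the lower bound \<open>M\<close> is the largest integer with \<open>2k/M \<ge> 1\<close>. At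
  squarefree \<open>n \<le> N\<close>, where the truncation is not yet felt, the \<open>M\<close>-th
  power has the coefficient \<open>M ^ \<omega>(n)\<close> (times \<open>n powr (-1/2)\<close>),
  with \<open>\<omega>(n)\<close> the number of prime factors, and
  \<open>q/2 * M\<^sup>2 = k * M\<close> is the resulting weight of a prime.

  The Gamma factors are those of Karamata's theorem: the multiplicative sums have logarithmic
  exponents \<open>k\<close> and \<open>k * M\<close>, and they are raised to the powers
  \<open>k\<close> and \<open>k / M\<close>, which gives \<open>k\<^sup>2\<close> both
  times.\<close>

definition bdd_measurable :: "'a measure \<Rightarrow> ('a \<Rightarrow> 'b::{real_normed_vector,second_countable_topology}) \<Rightarrow> bool" where
  "bdd_measurable M f \<longleftrightarrow> f \<in> borel_measurable M \<and> (\<exists>B. \<forall>x. norm (f x) \<le> B)"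

definition Lnorm :: "'a measure \<Rightarrow> real \<Rightarrow> ('a \<Rightarrow> 'b::{real_normed_vector,second_countable_topology}) \<Rightarrow> real" where
  "Lnorm M r f = (\<integral>x. norm (f x) powr r \<partial>M) powr (1 / r)"

lemma bdd_measurableI: "f \<in> borel_measurable M \<Longrightarrow> (\<And>x. norm (f x) \<le> B) \<Longrightarrow> bdd_measurable M f"
  by (auto simp: bdd_measurable_def)

lemma bdd_measurable_const[simp]: "bdd_measurable M (\<lambda>x. c)"
  by (auto simp: bdd_measurable_def)

lemma bdd_measurable_add: "bdd_measurable M f \<Longrightarrow> bdd_measurable M g \<Longrightarrow> bdd_measurable M (\<lambda>x. f x + g x)"
proof -
  assume a: "bdd_measurable M f" "bdd_measurable M g"
  then obtain B C where "\<And>x. norm (f x) \<le> B" "\<And>x. norm (g x) \<le> C" by (auto simp: bdd_measurable_def)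
  then have "norm (f x + g x) \<le> B + C" for x by (meson add_mono norm_triangle_le)
  with a show ?thesis by (intro bdd_measurableI[of _ _ "B + C"]) (auto simp: bdd_measurable_def)
qed

lemma bdd_measurable_uminus: "bdd_measurable M f \<Longrightarrow> bdd_measurable M (\<lambda>x. - f x)"
  by (auto simp: bdd_measurable_def)

lemma bdd_measurable_diff: "bdd_measurable M f \<Longrightarrow> bdd_measurable M g \<Longrightarrow> bdd_measurable M (\<lambda>x. f x - g x)"
  using bdd_measurable_add[of M f "\<lambda>x. - g x"] bdd_measurable_uminus[of M g] by auto

lemma bdd_measurable_sum: "(\<And>i. i \<in> I \<Longrightarrow> bdd_measurable M (f i)) \<Longrightarrow> bdd_measurable M (\<lambda>x. \<Sum>i\<in>I. f i x)"
  by (induction I rule: infinite_finite_induct) (auto intro!: bdd_measurable_add)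

lemma bdd_measurable_mult:
  fixes f :: "_ \<Rightarrow> 'b::{real_normed_algebra,second_countable_topology}"
  assumes "bdd_measurable M f" "bdd_measurable M g" shows "bdd_measurable M (\<lambda>x. f x * g x)"
proof -
  from assms obtain B C where B: "\<And>x. norm (f x) \<le> B" "\<And>x. norm (g x) \<le> C" by (auto simp: bdd_measurable_def)
  have "norm (f x * g x) \<le> B * C" for x
    using norm_mult_ineq[of "f x" "g x"] mult_mono[OF B(1)[of x] B(2)[of x]] B(1)[of x]
    by (meson norm_ge_zero order_trans)
  with assms show ?thesis by (intro bdd_measurableI[of _ _ "B * C"]) (auto simp: bdd_measurable_def)
qed

lemma bdd_measurable_power:
  fixes f :: "_ \<Rightarrow> 'b::{real_normed_algebra_1,second_countable_topology}"
  shows "bdd_measurable M f \<Longrightarrow> bdd_measurable M (\<lambda>x. f x ^ n)"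
  by (induction n) (auto intro!: bdd_measurable_mult)

lemma bdd_measurable_norm: "bdd_measurable M f \<Longrightarrow> bdd_measurable M (\<lambda>x. norm (f x))"
  by (auto simp: bdd_measurable_def)

lemma bdd_measurable_cnj: "bdd_measurable M f \<Longrightarrow> bdd_measurable M (\<lambda>x. cnj (f x))"
  by (auto simp: bdd_measurable_def intro: measurable_compose[OF _ borel_measurable_continuous_onI[OF continuous_on_cnj[OF continuous_on_id]]])

lemma bdd_measurable_powr:
  assumes "bdd_measurable M f" "r \<ge> 0" shows "bdd_measurable M (\<lambda>x. norm (f x) powr r)"
proof -
  from assms obtain B where B: "\<And>x. norm (f x) \<le> B" by (auto simp: bdd_measurable_def)
  show ?thesis
    using assms B by (intro bdd_measurableI[of _ _ "B powr r"]) (auto simp: bdd_measurable_def intro!: powr_mono2)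
qed

lemma bdd_measurable_powr':
  fixes f :: "_ \<Rightarrow> real"
  assumes "bdd_measurable M f" "r \<ge> 0" "\<And>x. f x \<ge> 0" shows "bdd_measurable M (\<lambda>x. f x powr r)"
  using bdd_measurable_powr[OF assms(1,2)] assms(3) by simp

lemma bdd_measurable_divide:
  fixes f :: "_ \<Rightarrow> 'b::{real_normed_field,second_countable_topology}"
  shows "bdd_measurable M f \<Longrightarrow> bdd_measurable M (\<lambda>x. f x / c)"
  using bdd_measurable_mult[of M f "\<lambda>x. inverse c"] by (simp add: divide_inverse)

text \<open>Boundedness is demanded everywhere, not just almost everywhere. The class is then stable
  under the usual operations and under integrating out one coordinate, and integrability follows
  from a single rule.\<close>

lemmas bdd_measurable_intros = bdd_measurable_const bdd_measurable_divide bdd_measurable_add bdd_measurable_uminus bdd_measurable_diff bdd_measurable_sum bdd_measurable_mult bdd_measurable_power bdd_measurable_norm bdd_measurable_cnj bdd_measurable_powr bdd_measurable_powr'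

context prob_space
begin

lemma bdd_measurable_integrable:
  fixes f :: "_ \<Rightarrow> 'b::{banach,second_countable_topology}"
  shows "bdd_measurable M f \<Longrightarrow> integrable M f"
  by (auto simp: bdd_measurable_def intro: integrable_const_bound)

lemma Lnorm_nonneg[simp]: "Lnorm M r f \<ge> 0"
  by (simp add: Lnorm_def)

lemma Lnorm_powr: "r > 0 \<Longrightarrow> Lnorm M r f powr r = (\<integral>x. norm (f x) powr r \<partial>M)"
  by (simp add: Lnorm_def powr_powr)

lemma Lnorm_le:
  assumes "r > 0" "c \<ge> 0" "(\<integral>x. norm (f x) powr r \<partial>M) \<le> c powr r"
  shows "Lnorm M r f \<le> c"
  using powr_mono2[OF _ _ assms(3), of "1/r"] assms by (simp add: Lnorm_def powr_powr)

lemma Lnorm_le_bound: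
  assumes "r > 0" "bdd_measurable M f" "\<And>x. norm (f x) \<le> c"
  shows "Lnorm M r f \<le> c"
proof (rule Lnorm_le)
  show "c \<ge> 0" using assms(3) norm_ge_zero order_trans by blast
  show "(\<integral>x. norm (f x) powr r \<partial>M) \<le> c powr r"
    using assms by (intro integral_le_const bdd_measurable_integrable bdd_measurable_powr) (auto intro!: powr_mono2)
qed fact

lemma Lnorm_mono:
  assumes "r > 0" "bdd_measurable M f" "bdd_measurable M g" "\<And>x. norm (f x) \<le> norm (g x)"
  shows "Lnorm M r f \<le> Lnorm M r g"
  unfolding Lnorm_def using assms
  by (intro powr_mono2 integral_mono bdd_measurable_integrable bdd_measurable_powr integral_nonneg) auto

lemma Lnorm_cmult:
  fixes f :: "_ \<Rightarrow> 'b::{real_normed_div_algebra,second_countable_topology}"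
  assumes "r > 0" shows "Lnorm M r (\<lambda>x. c * f x) = norm c * Lnorm M r f"
  using assms by (simp add: Lnorm_def norm_mult powr_mult powr_powr)

end

section \<open>Minkowski's inequality, a reverse of it, and Hoelder's inequality\<close>

lemma powr_convex_0:
  fixes r :: real assumes "r \<ge> 1" shows "convex_on {0..} (\<lambda>x. x powr r)"
proof (intro convex_onI)
  fix t x y :: real assume t: "0 < t" "t < 1" and xy: "x \<in> {0..}" "y \<in> {0..}"
  have *: "(s * z) powr r \<le> s * z powr r" if "0 < s" "s < 1" "z \<ge> 0" for s z :: real
  proof -
    have "s powr r \<le> s powr 1" using that assms by (intro powr_mono') auto
    then show ?thesis using that by (simp add: powr_mult mult_right_mono)
  qed
  show "((1 - t) *\<^sub>R x + t *\<^sub>R y) powr r \<le> (1 - t) * x powr r + t * y powr r"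
  proof (cases "x = 0 \<or> y = 0")
    case True then show ?thesis using *[of t y] *[of "1 - t" x] t xy by auto
  next
    case False
    then show ?thesis using convex_onD[OF powr_convex[OF assms], of t x y] t xy by auto
  qed
qed simp

context prob_space
begin

text \<open>With \<open>a\<close> and \<open>b\<close> slightly larger than the two norms,
  \<open>(\<bar>f\<bar> + \<bar>g\<bar>) / (a + b)\<close> is a convex combination of
  \<open>\<bar>f\<bar> / a\<close> and \<open>\<bar>g\<bar> / b\<close>, and the \<open>r\<close>-th
  power is convex. The \<open>\<epsilon>\<close> keeps \<open>a\<close> and \<open>b\<close>
  positive when a norm vanishes.\<close>

lemma Minkowski_ineq:
  assumes r: "r \<ge> 1" and f: "bdd_measurable M f" and g: "bdd_measurable M g"
  shows "Lnorm M r (\<lambda>x. f x + g x) \<le> Lnorm M r f + Lnorm M r g"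
proof (rule field_le_epsilon)
  fix \<epsilon> :: real assume e: "\<epsilon> > 0"
  define a b where "a = Lnorm M r f + \<epsilon>/2" and "b = Lnorm M r g + \<epsilon>/2"
  have ab: "a > 0" "b > 0" using e Lnorm_nonneg[of r f] Lnorm_nonneg[of r g]
    unfolding a_def b_def by linarith+
  have fa: "(\<integral>x. norm (f x) powr r \<partial>M) \<le> a powr r"
    using r e by (subst Lnorm_powr[symmetric]) (auto simp: a_def intro!: powr_mono2)
  have gb: "(\<integral>x. norm (g x) powr r \<partial>M) \<le> b powr r"
    using r e by (subst Lnorm_powr[symmetric]) (auto simp: b_def intro!: powr_mono2)
  have pt: "norm (f x + g x) powr r \<le>
     (a + b) powr r * (a / (a+b) * (norm (f x) powr r / a powr r) + b / (a+b) * (norm (g x) powr r / b powr r))" for x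
  proof -
    have "norm (f x + g x) powr r \<le> (norm (f x) + norm (g x)) powr r"
      using r by (intro powr_mono2 norm_triangle_ineq) auto
    also have "norm (f x) + norm (g x) = (a + b) * ((1 - b/(a+b)) * (norm (f x) / a) + b/(a+b) * (norm (g x) / b))"
    proof -
      have t: "1 - b/(a+b) = a/(a+b)" using ab by (simp add: field_simps)
      show ?thesis unfolding t using ab by (simp add: distrib_left)
    qed
    also have "\<dots> powr r = (a+b) powr r * ((1 - b/(a+b)) * (norm (f x) / a) + b/(a+b) * (norm (g x) / b)) powr r"
      using ab by (intro powr_mult)
    also have "\<dots> \<le> (a + b) powr r * ((1 - b / (a+b)) * (norm (f x) / a) powr r + b / (a+b) * (norm (g x) / b) powr r)"
      using convex_onD[OF powr_convex_0[OF r], of "b/(a+b)" "norm (f x) / a" "norm (g x) / b"] ab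
      by (intro mult_left_mono) auto
    also have "1 - b/(a+b) = a/(a+b)" using ab by (simp add: field_simps)
    finally show ?thesis using ab by (simp add: powr_divide)
  qed
  have "(\<integral>x. norm (f x + g x) powr r \<partial>M) \<le> (\<integral>x. (a + b) powr r * (a / (a+b) * (norm (f x) powr r / a powr r) + b / (a+b) * (norm (g x) powr r / b powr r)) \<partial>M)"
    using r by (intro integral_mono pt bdd_measurable_integrable bdd_measurable_intros f g) auto
  also have "\<dots> = (a + b) powr r * (a / (a+b) * ((\<integral>x. norm (f x) powr r \<partial>M) / a powr r) + b / (a+b) * ((\<integral>x. norm (g x) powr r \<partial>M) / b powr r))"
    using r by (subst integral_mult_right_zero, subst Bochner_Integration.integral_add)
      ((intro bdd_measurable_integrable bdd_measurable_intros f g; simp), (intro bdd_measurable_integrable bdd_measurable_intros f g; simp), simp)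
  also have "\<dots> \<le> (a + b) powr r * (a / (a+b) * 1 + b / (a+b) * 1)"
    using ab fa gb by (intro mult_left_mono add_mono) (auto simp: field_simps)
  also have "\<dots> = (a + b) powr r" using ab by (simp flip: add_divide_distrib)
  finally have "Lnorm M r (\<lambda>x. f x + g x) \<le> a + b"
    using ab r by (intro Lnorm_le) auto
  then show "Lnorm M r (\<lambda>x. f x + g x) \<le> Lnorm M r f + Lnorm M r g + \<epsilon>" by (simp add: a_def b_def)
qed

lemma Minkowski_sum:
  assumes r: "r \<ge> 1" and f: "\<And>i. i \<in> I \<Longrightarrow> bdd_measurable M (f i)"
  shows "Lnorm M r (\<lambda>x. \<Sum>i\<in>I. f i x) \<le> (\<Sum>i\<in>I. Lnorm M r (f i))"
  using f
proof (induction I rule: infinite_finite_induct)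
  case (insert i I)
  have "Lnorm M r (\<lambda>x. f i x + (\<Sum>i\<in>I. f i x)) \<le> Lnorm M r (f i) + Lnorm M r (\<lambda>x. \<Sum>i\<in>I. f i x)"
    using insert.prems by (intro Minkowski_ineq r bdd_measurable_sum) auto
  then show ?case using insert by auto
qed (auto simp: Lnorm_def)

text \<open>The exponents of \<open>g\<close> are chosen so that the case \<open>r = 1\<close> is included.\<close>

lemma Holder_ineq:
  assumes r: "r \<ge> 1" and f: "bdd_measurable M f" and g: "bdd_measurable M g" and g0: "\<And>x. g x \<ge> (0::real)"
  shows "(\<integral>x. norm (f x) * g x powr (2 - 2/r) \<partial>M) \<le> Lnorm M r f * (\<integral>x. (g x)\<^sup>2 \<partial>M) powr (1 - 1/r)"
proof (cases "r = 1")
  case True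
  have "norm (f x) * g x powr 0 \<le> norm (f x)" for x by (cases "g x = 0") auto
  then have "(\<integral>x. norm (f x) * g x powr 0 \<partial>M) \<le> (\<integral>x. norm (f x) \<partial>M)"
    by (intro integral_mono bdd_measurable_integrable bdd_measurable_intros f g g0) auto
  \<comment> \<open>By the convention \<open>0 powr 0 = 0\<close> the right-hand side is 0 when
    \<open>g\<close> vanishes almost everywhere, so the left-hand side must be seen to vanish as
    well.\<close>
  moreover have "(\<integral>x. (g x)\<^sup>2 \<partial>M) = 0 \<Longrightarrow> (\<integral>x. norm (f x) * g x powr 0 \<partial>M) \<le> 0"
  proof -
    assume "(\<integral>x. (g x)\<^sup>2 \<partial>M) = 0"
    then have "AE x in M. (g x)\<^sup>2 = 0"
      by (subst (asm) integral_nonneg_eq_0_iff_AE) (auto intro!: bdd_measurable_integrable bdd_measurable_intros g)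
    then have "AE x in M. norm (f x) * g x powr 0 = 0" by eventually_elim auto
    then show ?thesis by (simp add: integral_eq_zero_AE)
  qed
  ultimately show ?thesis using True by (auto simp: Lnorm_def)
next
  case False
  with r have r: "r > 1" by simp
  show ?thesis
  proof (rule field_le_epsilon)
    fix \<epsilon> :: real assume e: "\<epsilon> > 0"
    define F G where "F = (\<integral>x. norm (f x) powr r \<partial>M)" and "G = (\<integral>x. (g x)\<^sup>2 \<partial>M)"
    have FG: "F \<ge> 0" "G \<ge> 0" by (auto simp: F_def G_def)
    \<comment> \<open>The shift by \<open>\<delta>\<close> permits division by both integrals even
      if one of them is 0; it is removed by continuity at the end.\<close>
    define h where "h \<delta> = (F + \<delta>) powr (1/r) * (G + \<delta>) powr (1 - 1/r)" for \<delta>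
    have main: "(\<integral>x. norm (f x) * g x powr (2 - 2/r) \<partial>M) \<le> h \<delta>" if d: "\<delta> > 0" for \<delta>
    proof -
      have pos: "F + \<delta> > 0" "G + \<delta> > 0" using FG d by auto
      have pt: "norm (f x) * g x powr (2 - 2/r) \<le> h \<delta> * ((1/r) * (norm (f x) powr r / (F+\<delta>)) + (1-1/r) * ((g x)\<^sup>2 / (G+\<delta>)))" for x
      proof (cases "f x = 0 \<or> g x = 0")
        case True then show ?thesis using r pos by (auto simp: h_def)
      next
        case False
        then have gp: "g x > 0" "norm (f x) > 0" using g0[of x] by auto
        have gg: "(g x)\<^sup>2 powr (1 - 1/r) = g x powr (2 - 2/r)"
          using gp by (simp add: powr_powr right_diff_distrib flip: powr_numeral)
        have "(norm (f x) powr r / (F+\<delta>)) powr (1/r) * ((g x)\<^sup>2 / (G+\<delta>)) powr (1 - 1/r)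
           \<le> (1/r) * (norm (f x) powr r / (F+\<delta>)) + (1-1/r) * ((g x)\<^sup>2 / (G+\<delta>))"
          using r pos gp by (intro Youngs_inequality_0) auto
        moreover have "(norm (f x) powr r / (F+\<delta>)) powr (1/r) * ((g x)\<^sup>2 / (G+\<delta>)) powr (1 - 1/r)
          = norm (f x) * g x powr (2 - 2/r) / h \<delta>"
          using r pos gp by (simp add: powr_divide powr_powr h_def gg)
        moreover have "h \<delta> > 0" using pos by (simp add: h_def)
        ultimately show ?thesis by (simp add: field_simps)
      qed
      have "(\<integral>x. norm (f x) * g x powr (2 - 2/r) \<partial>M) \<le> (\<integral>x. h \<delta> * ((1/r) * (norm (f x) powr r / (F+\<delta>)) + (1-1/r) * ((g x)\<^sup>2 / (G+\<delta>))) \<partial>M)"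
        using r by (intro integral_mono pt bdd_measurable_integrable bdd_measurable_intros f g g0) (auto simp: field_simps)
      also have "\<dots> = h \<delta> * ((1/r) * (F / (F+\<delta>)) + (1-1/r) * (G / (G+\<delta>)))"
        using r unfolding F_def G_def by (subst integral_mult_right_zero, subst Bochner_Integration.integral_add)
          ((intro bdd_measurable_integrable bdd_measurable_intros f g; simp), (intro bdd_measurable_integrable bdd_measurable_intros f g; simp), simp)
      also have "\<dots> \<le> h \<delta> * ((1/r) * 1 + (1-1/r) * 1)"
        using r pos d by (intro mult_left_mono add_mono) (auto simp: h_def)
      finally show ?thesis by simp
    qed
    have "((\<lambda>\<delta>. h \<delta>) \<longlongrightarrow> (F + 0) powr (1/r) * (G + 0) powr (1 - 1/r)) (at_right 0)"
      unfolding h_def using r FG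
      by (intro tendsto_mult tendsto_powr' tendsto_intros) (auto simp: eventually_at_filter)
    moreover have "\<forall>\<^sub>F \<delta> in at_right 0. (\<integral>x. norm (f x) * g x powr (2 - 2/r) \<partial>M) \<le> h \<delta>"
      using main by (auto simp: eventually_at_right_less eventually_at_filter)
    ultimately have "(\<integral>x. norm (f x) * g x powr (2 - 2/r) \<partial>M) \<le> (F + 0) powr (1/r) * (G + 0) powr (1 - 1/r)"
      by (intro tendsto_lowerbound) auto
    then show "(\<integral>x. norm (f x) * g x powr (2 - 2/r) \<partial>M) \<le> Lnorm M r f * (\<integral>x. (g x)\<^sup>2 \<partial>M) powr (1 - 1/r) + \<epsilon>"
      using e by (simp add: Lnorm_def F_def G_def)
  qed
qed

text \<open>A supporting-line argument: the left-hand side is linear in \<open>u powr p\<close> and \<open>v powr p\<close> along the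
  tangent of the convex function \<open>(U, V) \<mapsto> (U powr (2/p) + c * V powr (2/p)) powr (p/2)\<close>.\<close>

lemma reverse_Minkowski_two:
  assumes p: "1 \<le> p" "p \<le> 2" and c: "c \<ge> 0" and f: "bdd_measurable M f" and g: "bdd_measurable M g"
  shows "(Lnorm M p f)\<^sup>2 + c * (Lnorm M p g)\<^sup>2 \<le> (\<integral>x. ((norm (f x))\<^sup>2 + c * (norm (g x))\<^sup>2) powr (p/2) \<partial>M) powr (2/p)"
proof -
  define U V where "U = Lnorm M p f" and "V = Lnorm M p g"
  define N where "N = U\<^sup>2 + c * V\<^sup>2"
  have UV: "U \<ge> 0" "V \<ge> 0" by (auto simp: U_def V_def)
  show ?thesis
  proof (cases "N = 0")
    case True then show ?thesis by (simp add: N_def U_def V_def)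
  next
    case False
    then have N: "N > 0" using c by (simp add: N_def order_less_le)
    have pt: "U powr (2 - p) * a powr p + c * V powr (2 - p) * b powr p \<le> N powr (1 - p/2) * (a\<^sup>2 + c * b\<^sup>2) powr (p/2)"
      if ab: "a \<ge> 0" "b \<ge> 0" for a b
    proof -
      define n where "n = a\<^sup>2 + c * b\<^sup>2"
      have n0: "n \<ge> 0" using c by (simp add: n_def)
      show ?thesis
      proof (cases "n = 0")
        case True
        then have "a = 0" "c = 0 \<or> b = 0" using c by (auto simp: n_def add_nonneg_eq_0_iff)
        then show ?thesis using p by auto
      next
        case False
        then have n: "n > 0" using n0 by simp
        \<comment> \<open>Young's inequality with weights \<open>1 - p/2\<close> and
          \<open>p/2\<close>, normalised by the common totals \<open>N\<close> and \<open>n\<close>.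
          When the case \<open>(U, a)\<close> and \<open>c\<close> times the case
          \<open>(V, b)\<close> are added, the brackets sum to 1.\<close>
        have Y: "s powr (2 - p) * t powr p \<le> (N powr (1 - p/2) * n powr (p/2)) * ((1 - p/2) * (s\<^sup>2/N) + (p/2) * (t\<^sup>2/n))"
          if st: "s \<ge> 0" "t \<ge> 0" for s t
        proof (cases "s = 0 \<or> t = 0")
          case True then show ?thesis using p N n by auto
        next
          case False
          then have st: "s > 0" "t > 0" using st by auto
          have "(s\<^sup>2/N) powr (1 - p/2) * (t\<^sup>2/n) powr (p/2) \<le> (1 - p/2) * (s\<^sup>2/N) + (p/2) * (t\<^sup>2/n)"
            using p N n st by (intro Youngs_inequality_0) auto
          moreover have *: "(s\<^sup>2/N) powr (1 - p/2) * (t\<^sup>2/n) powr (p/2) = s powr (2 - p) * t powr p / (N powr (1 - p/2) * n powr (p/2))"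
            using N n st by (simp add: powr_divide powr_powr right_diff_distrib flip: powr_numeral)
          moreover have "N powr (1 - p/2) * n powr (p/2) > 0" using N n by simp
          ultimately show ?thesis by (simp only: pos_divide_le_eq mult.commute)
        qed
        have "U powr (2 - p) * a powr p + c * (V powr (2 - p) * b powr p)
           \<le> (N powr (1 - p/2) * n powr (p/2)) * ((1 - p/2) * (U\<^sup>2/N) + (p/2) * (a\<^sup>2/n))
           + c * ((N powr (1 - p/2) * n powr (p/2)) * ((1 - p/2) * (V\<^sup>2/N) + (p/2) * (b\<^sup>2/n)))"
          using c UV ab by (intro add_mono mult_left_mono Y) auto
        also have "\<dots> = (N powr (1 - p/2) * n powr (p/2)) * ((1 - p/2) * ((U\<^sup>2 + c * V\<^sup>2)/N) + (p/2) * ((a\<^sup>2 + c * b\<^sup>2)/n))"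
          using N n by (simp add: field_simps)
        also have "\<dots> = N powr (1 - p/2) * n powr (p/2)"
          using N n by (simp flip: N_def n_def)
        finally show ?thesis by (simp add: n_def mult.assoc)
      qed
    qed
    define I where "I = (\<integral>x. ((norm (f x))\<^sup>2 + c * (norm (g x))\<^sup>2) powr (p/2) \<partial>M)"
    have U2: "U powr (2 - p) * U powr p = U\<^sup>2" if "U \<ge> 0" for U :: real
      using that by (cases "U = 0") (auto simp flip: powr_add powr_numeral)
    have "N = U powr (2 - p) * U powr p + c * V powr (2 - p) * V powr p"
      using UV by (simp add: N_def U2 mult.assoc)
    also have "\<dots> = U powr (2 - p) * (\<integral>x. norm (f x) powr p \<partial>M) + c * V powr (2 - p) * (\<integral>x. norm (g x) powr p \<partial>M)"
      using p by (simp add: U_def V_def Lnorm_powr)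
    also have "\<dots> = (\<integral>x. U powr (2 - p) * norm (f x) powr p + c * V powr (2 - p) * norm (g x) powr p \<partial>M)"
      using p by (subst Bochner_Integration.integral_add) (auto intro!: bdd_measurable_integrable bdd_measurable_intros f g)
    also have "\<dots> \<le> (\<integral>x. N powr (1 - p/2) * ((norm (f x))\<^sup>2 + c * (norm (g x))\<^sup>2) powr (p/2) \<partial>M)"
      using p c by (intro integral_mono bdd_measurable_integrable bdd_measurable_intros f g pt) auto
    also have "\<dots> = N powr (1 - p/2) * I" by (simp add: I_def)
    finally have "N \<le> N powr (1 - p/2) * I" .
    moreover have "N = N powr (1 - p/2) * N powr (p/2)" using N by (simp flip: powr_add)
    ultimately have "N powr (1 - p/2) * N powr (p/2) \<le> N powr (1 - p/2) * I" by simp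
    then have "N powr (p/2) \<le> I"
      using N by (subst (asm) mult_le_cancel_left_pos) auto
    then have "(N powr (p/2)) powr (2/p) \<le> I powr (2/p)" using p N by (intro powr_mono2) auto
    then show ?thesis using N p by (simp add: powr_powr I_def N_def U_def V_def)
  qed
qed

end

subsection \<open>Power series in a Steinhaus variable\<close>

definition circle :: "real measure" where
  "circle = uniform_measure lborel {0..1}"

definition e1 :: "real \<Rightarrow> complex" where
  "e1 y = cis (2 * pi * y)"

lemma sets_circle[simp, measurable_cong]: "sets circle = sets borel"
  and space_circle[simp]: "space circle = UNIV"
  by (auto simp: circle_def)

lemma prob_space_circle: "prob_space circle"
  unfolding circle_def by (intro prob_space_uniform_measure) auto

interpretation circle: prob_space circle
  by (rule prob_space_circle)

lemma continuous_on_e1: "continuous_on A e1"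
  unfolding e1_def by (intro continuous_intros)

lemma e1_measurable[measurable]: "e1 \<in> borel_measurable borel"
  by (intro borel_measurable_continuous_onI continuous_on_e1)

lemma norm_e1[simp]: "cmod (e1 y) = 1"
  by (simp add: e1_def)

lemma e1_cnj[simp]: "cnj (e1 y) * e1 y = 1"
  by (simp_all add: e1_def cis_cnj cis_mult)

lemma bdd_measurable_e1[simp]: "bdd_measurable circle e1"
  by (rule bdd_measurableI[of _ _ 1]) (simp_all add: measurable_cong_sets[OF sets_circle refl])

lemma integral_circle:
  fixes f :: "real \<Rightarrow> 'b::{banach,second_countable_topology}"
  assumes "f \<in> borel_measurable borel"
  shows "(\<integral>y. f y \<partial>circle) = (\<integral>y. indicator {0..1} y *\<^sub>R f y \<partial>lborel)"
proof -
  have "circle = density lborel (\<lambda>x. ennreal (indicator {0..1::real} x))"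
    unfolding circle_def uniform_measure_def by (simp add: ennreal_indicator divide_ennreal_def)
  then have "(\<integral>y. f y \<partial>circle) = (\<integral>y. f y \<partial>density lborel (\<lambda>x. ennreal (indicator {0..1::real} x)))"
    by (rule arg_cong)
  also have "\<dots> = (\<integral>y. indicator {0..1} y *\<^sub>R f y \<partial>lborel)"
    using assms by (intro integral_density) auto
  finally show ?thesis .
qed

lemma integral_circle_cis:
  "(\<integral>y. cis (2 * pi * of_int n * y) \<partial>circle) = (if n = 0 then 1 else 0)"
proof (cases "n = 0")
  case False
  define c where "c = 2 * pi * of_int n"
  have c: "c \<noteq> 0" using False by (simp add: c_def)
  have "(\<integral>y. indicator {0..1} y *\<^sub>R cis (c * y) \<partial>lborel) = cis (c * 1) / (\<i> * c) - cis (c * 0) / (\<i> * c)"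
  proof (rule integral_FTC_Icc)
    show "((\<lambda>y. cis (c * y) / (\<i> * c)) has_vector_derivative cis (c * x)) (at x within {0..1})" for x
      unfolding cis_conv_exp using c
      by (auto intro!: derivative_eq_intros has_vector_derivative_real_field simp: field_simps)
    show "continuous_on {0..1} (\<lambda>y. cis (c * y))" by (intro continuous_intros)
  qed auto
  also have "cis (c * 1) = cis (c * 0)"
    using cis_multiple_2pi[of n] by (simp add: c_def)
  finally show ?thesis using False
    by (subst integral_circle) (auto simp: c_def intro!: borel_measurable_continuous_onI continuous_intros)
next
  case True
  have "(\<integral>y. 1 \<partial>circle) = (1 :: complex)" using circle.prob_space by simp
  then show ?thesis using True by simp
qed

lemma integral_e1:
  "(\<integral>y. e1 y ^ i * cnj (e1 y) ^ j \<partial>circle) = (if i = j then 1 else 0)"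
proof -
  have "e1 y ^ i * cnj (e1 y) ^ j = cis (2 * pi * of_int (int i - int j) * y)" for y
    by (simp add: e1_def cis_cnj Complex.DeMoivre cis_mult algebra_simps)
  then show ?thesis by (simp only: integral_circle_cis) auto
qed

lemma gbinomial_complex_of_real: "(complex_of_real a gchoose n) = complex_of_real (a gchoose n)"
  by (simp add: gbinomial_prod_rev)

lemma gbinomial_abs_summable:
  assumes "cmod c < 1"
  shows "summable (\<lambda>j. cmod (complex_of_real (a gchoose j) * c ^ j))"
proof -
  obtain K where K: "cmod c < K" "K < 1" using dense[OF assms] by auto
  have "K > 0" using K norm_ge_zero[of c] by linarith
  then have "norm (complex_of_real K) < 1" using K by simp
  from gen_binomial_complex[OF this, of "of_real a"]
  have "summable (\<lambda>j. complex_of_real (a gchoose j) * complex_of_real K ^ j)"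
    by (auto simp: gbinomial_complex_of_real dest: sums_summable)
  from powser_insidea[OF this, of c] K \<open>K > 0\<close> show ?thesis by simp
qed


definition power_series :: "('a \<Rightarrow> complex) \<Rightarrow> (nat \<Rightarrow> complex) \<Rightarrow> 'a \<Rightarrow> complex" where
  "power_series w c y = (\<Sum>j. c j * w y ^ j)"

text \<open>Only the modulus and the mixed moments of \<open>w\<close> are prescribed, so each power
  \<open>w ^ j\<close> with \<open>j > 0\<close> is again an instance. This is how an estimate for
  linear polynomials reaches expressions such as \<open>a 0 + b * w ^ j\<close>.\<close>

locale steinhaus = prob_space M for M :: "'a measure" +
  fixes w :: "'a \<Rightarrow> complex"
  assumes w_measurable[measurable]: "w \<in> borel_measurable M"
    and norm_w: "cmod (w y) = 1"
    and w_orth: "(\<integral>y. w y ^ i * cnj (w y) ^ j \<partial>M) = (if i = j then 1 else 0)"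
begin

lemma w_orth': "(\<integral>y. w y ^ i \<partial>M) = (if i = 0 then 1 else 0)"
  using w_orth[of i 0] by simp

lemma bdd_measurable_w[simp]: "bdd_measurable M w"
  by (rule bdd_measurableI[of _ _ 1]) (simp_all add: norm_w)

lemma steinhaus_power: "j > 0 \<Longrightarrow> steinhaus M (\<lambda>y. w y ^ j)"
  by unfold_locales (auto simp: norm_power norm_w w_orth simp flip: power_mult)

lemma bdd_measurable_power_series:
  assumes "summable (\<lambda>j. cmod (c j))"
  shows "bdd_measurable M (power_series w c)"
proof (rule bdd_measurableI)
  show "power_series w c \<in> borel_measurable M" unfolding power_series_def by measurable
  show "cmod (power_series w c y) \<le> (\<Sum>j. cmod (c j))" for y
  proof -
    have "cmod (power_series w c y) \<le> (\<Sum>j. cmod (c j * w y ^ j))"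
      unfolding power_series_def using assms by (intro summable_norm) (auto simp: norm_mult norm_power norm_w)
    then show ?thesis by (simp add: norm_mult norm_power norm_w)
  qed
qed

lemma power_series_integral:
  assumes c: "summable (\<lambda>j. cmod (c j))" and h: "bdd_measurable M h"
  shows "(\<lambda>j. c j * (\<integral>y. w y ^ j * h y \<partial>M)) sums (\<integral>y. power_series w c y * h y \<partial>M)"
proof -
  from h obtain B where B: "\<And>y. cmod (h y) \<le> B" by (auto simp: bdd_measurable_def)
  have bmj: "bdd_measurable M (\<lambda>y. c j * w y ^ j * h y)" for j
    by (intro bdd_measurable_intros h) simp
  have le: "cmod (c j * w y ^ j * h y) \<le> cmod (c j) * B" for j y
    by (auto simp: norm_mult norm_power norm_w intro!: mult_left_mono B)
  have "(\<lambda>j. (\<integral>y. c j * w y ^ j * h y \<partial>M)) sums (\<integral>y. (\<Sum>j. c j * w y ^ j * h y) \<partial>M)"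
  proof (rule sums_integral)
    show "integrable M (\<lambda>y. c j * w y ^ j * h y)" for j by (intro bdd_measurable_integrable bmj)
    show "AE y in M. summable (\<lambda>j. norm (c j * w y ^ j * h y))"
      by (intro AE_I2 summable_comparison_test'[OF summable_mult2[OF c, of B]]) (use le in auto)
    show "summable (\<lambda>j. \<integral>y. norm (c j * w y ^ j * h y) \<partial>M)"
      by (intro summable_comparison_test'[OF summable_mult2[OF c, of B]])
        (auto intro!: integral_le_const bdd_measurable_integrable bdd_measurable_norm bmj le)
  qed
  also have "(\<lambda>y. (\<Sum>j. c j * w y ^ j * h y)) = (\<lambda>y. power_series w c y * h y)"
    unfolding power_series_def
    by (intro ext suminf_mult2[symmetric], rule summable_norm_cancel) (use c in \<open>simp add: norm_mult norm_power norm_w\<close>)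
  finally show ?thesis by (simp add: mult.assoc)
qed

lemma power_series_coeff:
  assumes c: "summable (\<lambda>j. cmod (c j))"
  shows "(\<integral>y. power_series w c y * cnj (w y) ^ i \<partial>M) = c i"
    and "(\<integral>y. power_series w c y * w y ^ i \<partial>M) = (if i = 0 then c 0 else 0)"
proof -
  have "(\<lambda>j. c j * (if j = i then 1 else 0)) sums (\<integral>y. power_series w c y * cnj (w y) ^ i \<partial>M)"
    using power_series_integral[OF c, of "\<lambda>y. cnj (w y) ^ i"] by (simp add: bdd_measurable_intros w_orth)
  moreover have "(\<lambda>j. c j * (if j = i then 1 else 0)) sums c i"
    using sums_single[of i c] by (auto simp: if_distrib cong: if_cong)
  ultimately show "(\<integral>y. power_series w c y * cnj (w y) ^ i \<partial>M) = c i" using sums_unique2 by blast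
next
  have "(\<lambda>j. c j * (if j + i = 0 then 1 else 0)) sums (\<integral>y. power_series w c y * w y ^ i \<partial>M)"
    using power_series_integral[OF c, of "\<lambda>y. w y ^ i"] by (simp add: bdd_measurable_intros w_orth' flip: power_add)
  moreover have "(\<lambda>j. c j * (if j + i = 0 then 1 else 0)) sums (if i = 0 then c 0 else 0)"
    using sums_single[of 0 c] by (auto simp: if_distrib cong: if_cong)
  ultimately show "(\<integral>y. power_series w c y * w y ^ i \<partial>M) = (if i = 0 then c 0 else 0)" using sums_unique2 by blast
qed

lemma power_series_Parseval:
  assumes c: "summable (\<lambda>j. cmod (c j))"
  shows "(\<lambda>j. (cmod (c j))\<^sup>2) sums (\<integral>y. (cmod (power_series w c y))\<^sup>2 \<partial>M)"
proof -
  have "cnj (\<integral>y. w y ^ j * cnj (power_series w c y) \<partial>M) = c j" for j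
    using power_series_coeff(1)[OF c, of j] by (subst Bochner_Integration.integral_cnj[symmetric]) (simp add: mult.commute)
  then have *: "(\<integral>y. w y ^ j * cnj (power_series w c y) \<partial>M) = cnj (c j)" for j
    by (metis complex_cnj_cnj)
  have "(\<lambda>j. c j * cnj (c j)) sums (\<integral>y. power_series w c y * cnj (power_series w c y) \<partial>M)"
    using power_series_integral[OF c, of "\<lambda>y. cnj (power_series w c y)"] by (simp add: bdd_measurable_cnj bdd_measurable_power_series c *)
  also have "(\<integral>y. power_series w c y * cnj (power_series w c y) \<partial>M) = complex_of_real (\<integral>y. (cmod (power_series w c y))\<^sup>2 \<partial>M)"
    by (simp only: complex_norm_square[symmetric] integral_complex_of_real)
  also have "(\<lambda>j. c j * cnj (c j)) = (\<lambda>j. complex_of_real ((cmod (c j))\<^sup>2))"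
    by (simp only: complex_norm_square)
  finally show ?thesis by (simp only: sums_of_real_iff)
qed

lemma power_series_binomial:
  assumes "cmod c < 1"
  shows "power_series w (\<lambda>j. complex_of_real (a gchoose j) * c ^ j) y = (1 + c * w y) powr of_real a"
proof -
  have "cmod (c * w y) < 1" using assms by (simp add: norm_mult norm_w)
  from gen_binomial_complex[OF this, of "of_real a"] show ?thesis
    by (simp add: power_series_def gbinomial_complex_of_real power_mult_distrib mult.assoc sums_iff)
qed

text \<open>\<open>\<bar>1 + c * w\<bar> powr (2 * a)\<close> is the squared modulus of a binomial
  series of exponent \<open>a\<close>. The case \<open>a = k\<close> serves linear polynomials, the
  case \<open>a = - k\<close> Euler factors.\<close>

lemma binomial_Parseval:
  assumes "cmod c < 1"
  shows "(\<lambda>j. (a gchoose j)\<^sup>2 * ((cmod c)\<^sup>2) ^ j) sums (\<integral>y. cmod (1 + c * w y) powr (2 * a) \<partial>M)"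
proof -
  have "cmod (1 + c * w y) powr (2 * a) = (cmod ((1 + c * w y) powr of_real a))\<^sup>2" for y
    by (simp add: norm_powr_real_powr' power2_eq_square flip: powr_add)
  moreover have "(cmod (complex_of_real (a gchoose j) * c ^ j))\<^sup>2 = (a gchoose j)\<^sup>2 * ((cmod c)\<^sup>2) ^ j" for j
    by (simp add: norm_mult norm_power norm_w power_mult_distrib) (simp add: mult.commute flip: power_mult)
  ultimately show ?thesis
    using power_series_Parseval[OF gbinomial_abs_summable[OF assms, of a]]
    by (simp add: power_series_binomial[OF assms])
qed

end

interpretation circle: steinhaus circle e1
  by unfold_locales (auto simp: integral_e1 measurable_cong_sets[OF sets_circle refl])

section \<open>Upper estimates in one variable\<close>

lemma gbinomial_Suc_real: "(real j + 1) * (k gchoose Suc j) = (k - real j) * (k gchoose j)" for k :: real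
  using gbinomial_absorption[of j k] gbinomial_absorb_comp[of k j] by (simp add: add.commute)

lemma gbinomial_sq_summable:
  fixes k x :: real
  assumes "\<bar>x\<bar> < 1" shows "summable (\<lambda>j. (k gchoose j)\<^sup>2 * x ^ j)"
proof -
  have "cmod (complex_of_real (sqrt \<bar>x\<bar>)) < 1" using assms by simp
  from sums_summable[OF circle.binomial_Parseval[OF this, of k]]
  have "summable (\<lambda>j. \<bar>(k gchoose j)\<^sup>2 * x ^ j\<bar>)"
    by (simp add: abs_mult power_abs)
  then show ?thesis by (rule summable_rabs_cancel)
qed

text \<open>The terms are nonnegative up to \<open>j = m\<close> and nonpositive from then on, since
  consecutive binomial coefficients beyond \<open>k\<close> alternate in sign or vanish. The
  nonpositive part is dominated by the telescoping differences of
  \<open>v j = (j * b j)\<^sup>2\<close>, and the last nonnegative term alone pays for the starting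
  value \<open>v (m + 1) / (2 * k)\<close>.\<close>

lemma gbinomial_consecutive_sum_nonneg:
  fixes k x :: real
  assumes k: "k \<ge> 1" and x: "0 \<le> x" "x \<le> 1" and s: "summable (\<lambda>j. real j * (k gchoose j) * (k gchoose Suc j) * x ^ j)"
  shows "(\<Sum>j. real j * (k gchoose j) * (k gchoose Suc j) * x ^ j) \<ge> 0"
proof -
  define b where "b j = k gchoose j" for j
  define m where "m = nat \<lfloor>k\<rfloor>"
  have m: "real m \<le> k" "k < real m + 1" "m \<ge> 1"
    using k unfolding m_def by linarith+
  have bS: "(real j + 1) * b (Suc j) = (k - real j) * b j" for j
    unfolding b_def by (rule gbinomial_Suc_real)
  define v where "v j = (real j)\<^sup>2 * (b j)\<^sup>2" for j
  have vS: "v (Suc j) = (k - real j)\<^sup>2 * (b j)\<^sup>2" for j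
    using bS[of j] by (simp add: v_def flip: power_mult_distrib) (simp add: add.commute)
  define S where "S n = (\<Sum>j\<le>n. real j * b j * b (Suc j) * x ^ j)" for n
  have bpos: "b j \<ge> 0" if "j \<le> Suc m" for j
    using that
  proof (induction j)
    case (Suc j)
    then have "(k - real j) * b j \<ge> 0" using m by (intro mult_nonneg_nonneg) auto
    then show ?case using bS[of j] by (metis of_nat_0_le_iff add_nonneg_pos zero_less_one zero_le_mult_iff not_less)
  qed (simp add: b_def)
  have base: "x ^ m * v (Suc m) / (2 * k) \<le> S m"
  proof -
    have "v (Suc m) / (2 * k) \<le> real m * b m * b (Suc m)"
    proof -
      have "(k - real m) * (real m + 1) \<le> 1 * (2 * real m)" using m by (intro mult_mono) auto
      also have "\<dots> \<le> 2 * k * real m" using k by (simp add: mult_mono)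
      finally have "(k - real m) * (b m)\<^sup>2 * ((k - real m) * (real m + 1)) \<le> (k - real m) * (b m)\<^sup>2 * (2 * k * real m)"
        using m by (intro mult_left_mono) auto
      also have "\<dots> = (2 * k) * (real m * b m * ((real m + 1) * b (Suc m)))"
        unfolding bS by (simp add: power2_eq_square)
      finally have "v (Suc m) * (real m + 1) \<le> (2 * k * (real m * b m * b (Suc m))) * (real m + 1)"
        by (simp add: vS power2_eq_square algebra_simps)
      then have "v (Suc m) \<le> 2 * k * (real m * b m * b (Suc m))"
        by (subst (asm) mult_le_cancel_right_pos) auto
      then show ?thesis using k by (simp add: field_simps)
    qed
    then have "x ^ m * (v (Suc m) / (2 * k)) \<le> x ^ m * (real m * b m * b (Suc m))"
      using x by (intro mult_left_mono) auto
    also have "\<dots> = real m * b m * b (Suc m) * x ^ m" by simp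
    also have "\<dots> \<le> S m" unfolding S_def
      by (rule member_le_sum) (use x in \<open>auto intro!: mult_nonneg_nonneg bpos\<close>)
    finally show ?thesis by simp
  qed
  have "x ^ m * v (Suc n) / (2 * k) \<le> S n" if "n \<ge> m" for n
    using that
  proof (induction n rule: dec_induct)
    case (step n)
    define j where "j = Suc n"
    have jk: "real j > k" using step m by (simp add: j_def)
    have vj: "v j \<ge> 0" by (simp add: v_def)
    have "- (real j * b j * b (Suc j)) \<le> (v j - v (Suc j)) / (2 * k)"
    proof -
      have "(real j + 1) * (- (real j * b j * b (Suc j))) = - (real j * b j * ((k - real j) * b j))"
        unfolding bS[symmetric] by (simp add: algebra_simps)
      also have "\<dots> = real j * (real j - k) * (b j)\<^sup>2" by (simp add: power2_eq_square algebra_simps)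
      \<comment> \<open>The recursion gives
        \<open>v (j + 1) = (k - j)\<^sup>2 * (b j)\<^sup>2\<close>, hence
        \<open>v j - v (j + 1) = 2 * k * (j - k/2) * (b j)\<^sup>2\<close>. This step brings the
        term into that shape.\<close>
      also have "\<dots> \<le> (real j + 1) * (real j - k/2) * (b j)\<^sup>2"
        using jk k by (intro mult_right_mono mult_mono) auto
      also have "\<dots> = (real j + 1) * ((v j - v (Suc j)) / (2 * k))"
        using k unfolding vS v_def[of j] by (simp add: field_simps power2_eq_square)
      finally show ?thesis by (subst (asm) mult_le_cancel_left_pos) auto
    qed
    then have "- (real j * b j * b (Suc j)) * x ^ j \<le> (v j - v (Suc j)) / (2 * k) * x ^ m"
    proof (cases "- (real j * b j * b (Suc j)) \<ge> 0")
      case True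
      then show ?thesis using \<open>_ \<le> (v j - v (Suc j)) / (2*k)\<close> x step
        by (intro mult_mono power_decreasing) (auto simp: j_def)
    next
      case False
      have "b j * b (Suc j) * (real j + 1) = (k - real j) * (b j)\<^sup>2"
        using arg_cong[OF bS[of j], of "\<lambda>t. b j * t"] by (simp add: power2_eq_square mult_ac)
      also have "\<dots> \<le> 0" using jk by (intro mult_nonpos_nonneg) auto
      finally have "(b j * b (Suc j)) * (real j + 1) \<le> 0 * (real j + 1)" by simp
      then have "b j * b (Suc j) \<le> 0" by (subst (asm) mult_le_cancel_right_pos) auto
      then have "real j * (b j * b (Suc j)) \<le> 0" by (simp add: mult_nonneg_nonpos)
      then have "real j * b j * b (Suc j) \<le> 0" by (simp add: mult.assoc)
      with False show ?thesis by linarith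
    qed
    moreover have "S j = S n + real j * b j * b (Suc j) * x ^ j" by (simp add: S_def j_def)
    ultimately have "S j \<ge> x ^ m * v (Suc n) / (2 * k) - (v j - v (Suc j)) / (2 * k) * x ^ m"
      using step.IH unfolding mult_minus_left by linarith
    also have "x ^ m * v (Suc n) / (2 * k) - (v j - v (Suc j)) / (2 * k) * x ^ m = x ^ m * v (Suc j) / (2 * k)"
      using k by (simp add: j_def field_simps)
    finally show ?case by (simp add: j_def)
  qed (rule base)
  moreover have "x ^ m * v (Suc n) / (2 * k) \<ge> 0" for n using x k by (simp add: v_def)
  ultimately have "S n \<ge> 0" if "n \<ge> m" for n using that order_trans by blast
  moreover have "S \<longlonglongrightarrow> (\<Sum>j. real j * b j * b (Suc j) * x ^ j)"
    unfolding S_def using s by (intro summable_LIMSEQ') (simp add: b_def)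
  ultimately show ?thesis unfolding b_def by (intro LIMSEQ_le_const) auto
qed

text \<open>Comparing coefficients, \<open>k\<^sup>2 * \<phi> - (1 + k * x) * \<phi>'\<close> equals
  \<open>k + 1\<close> times the nonnegative sum of consecutive products treated above. Hence
  \<open>\<phi> * (1 + k * x) powr (- k)\<close>, which is 1 at 0, has a nonpositive
  derivative.\<close>

lemma binomial_sq_series_le:
  fixes k x :: real
  assumes k: "k \<ge> 1" and x: "0 \<le> x" "x < 1"
  shows "(\<Sum>j. (k gchoose j)\<^sup>2 * x ^ j) \<le> (1 + k * x) powr k"
proof -
  define c where "c j = (k gchoose j)\<^sup>2" for j
  define \<phi> where "\<phi> x = (\<Sum>j. c j * x ^ j)" for x :: real
  define \<phi>' where "\<phi>' x = (\<Sum>j. diffs c j * x ^ j)" for x :: real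
  have sm: "summable (\<lambda>j. c j * z ^ j)" if "norm z < 1" for z :: real
    using gbinomial_sq_summable[of z k] that by (simp add: c_def)
  have D: "(\<phi> has_field_derivative \<phi>' z) (at z)" if "\<bar>z\<bar> < 1" for z
    unfolding \<phi>_def \<phi>'_def using termdiffs_strong'[of 1 c z] sm that by auto
  have smd: "summable (\<lambda>j. diffs c j * z ^ j)" if "\<bar>z\<bar> < 1" for z
    using termdiff_converges[of z 1 c] sm that by auto
  have ineq: "(1 + k * z) * \<phi>' z \<le> k\<^sup>2 * \<phi> z" if z: "0 \<le> z" "z < 1" for z
  proof -
    have z': "\<bar>z\<bar> < 1" using z by simp
    have sd: "(\<lambda>j. diffs c j * z ^ j) sums \<phi>' z" unfolding \<phi>'_def using smd[OF z'] by (rule summable_sums)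
    have sc: "(\<lambda>j. c j * z ^ j) sums \<phi> z" unfolding \<phi>_def using sm z' by (intro summable_sums) auto
    have "(\<lambda>n. real (Suc n) * c (Suc n) * z ^ Suc n) sums (\<phi>' z * z)"
      using sums_mult2[OF sd, of z] by (simp add: diffs_def mult_ac)
    from sums_Suc[OF this] have sz: "(\<lambda>n. real n * c n * z ^ n) sums (\<phi>' z * z)" by simp
    have "(\<lambda>j. k\<^sup>2 * (c j * z ^ j) - diffs c j * z ^ j - k * (real j * c j * z ^ j)) sums (k\<^sup>2 * \<phi> z - \<phi>' z - k * (\<phi>' z * z))"
      by (intro sums_diff sums_mult sc sd sz)
    moreover have "k\<^sup>2 * (c j * z ^ j) - diffs c j * z ^ j - k * (real j * c j * z ^ j)
       = (k + 1) * (real j * (k gchoose j) * (k gchoose Suc j) * z ^ j)" for j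
    proof -
      define b where "b = k gchoose j"
      define b' where "b' = k gchoose Suc j"
      have b': "b' = (k - real j) * b / (real j + 1)"
        using gbinomial_Suc_real[of j k] unfolding b_def b'_def by (simp add: field_simps)
      have "k\<^sup>2 * b\<^sup>2 - (real j + 1) * b'\<^sup>2 - k * (real j * b\<^sup>2) = (k + 1) * (real j * b * b')"
        unfolding b' by (simp add: power2_eq_square divide_simps) (simp add: algebra_simps)
      then have "(k\<^sup>2 * b\<^sup>2 - (real j + 1) * b'\<^sup>2 - k * (real j * b\<^sup>2)) * z ^ j = (k + 1) * (real j * b * b') * z ^ j" by simp
      then show ?thesis by (simp add: diffs_def c_def b_def b'_def algebra_simps)
    qed
    ultimately have S: "(\<lambda>j. (k + 1) * (real j * (k gchoose j) * (k gchoose Suc j) * z ^ j)) sums (k\<^sup>2 * \<phi> z - \<phi>' z - k * (\<phi>' z * z))"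
      by simp
    have "summable (\<lambda>j. (k + 1) * (real j * (k gchoose j) * (k gchoose Suc j) * z ^ j))"
      using S by (rule sums_summable)
    then have s1: "summable (\<lambda>j. real j * (k gchoose j) * (k gchoose Suc j) * z ^ j)"
      using k by (subst (asm) summable_cmult_iff) auto
    have "k\<^sup>2 * \<phi> z - \<phi>' z - k * (\<phi>' z * z) = (k + 1) * (\<Sum>j. real j * (k gchoose j) * (k gchoose Suc j) * z ^ j)"
      using sums_unique[OF S] suminf_mult[OF s1, of "k+1"] by simp
    also have "\<dots> \<ge> 0"
      using gbinomial_consecutive_sum_nonneg[OF k _ _ s1] z k by simp
    finally show ?thesis by (simp add: algebra_simps)
  qed
  define \<psi> where "\<psi> z = \<phi> z * (1 + k * z) powr (- k)" for z
  have "\<psi> x \<le> \<psi> 0"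
  proof (rule DERIV_nonpos_imp_nonincreasing[OF x(1)])
    fix z assume z: "0 \<le> z" "z \<le> x"
    have pos: "1 + k * z > 0" using z k by (simp add: add_pos_nonneg)
    have "(\<psi> has_field_derivative (\<phi>' z * (1 + k * z) powr (- k) + \<phi> z * ((- k) * (1 + k * z) powr (- k - 1) * k))) (at z)"
      unfolding \<psi>_def using pos z x
      by (auto intro!: derivative_eq_intros D DERIV_powr simp: powr_diff field_simps)
    moreover have "\<phi>' z * (1 + k * z) powr (- k) + \<phi> z * ((- k) * (1 + k * z) powr (- k - 1) * k)
       = (1 + k * z) powr (- k - 1) * ((1 + k * z) * \<phi>' z - k\<^sup>2 * \<phi> z)"
      using pos by (simp add: powr_diff field_simps power2_eq_square)
    moreover have "\<dots> \<le> 0" using ineq[of z] z x by (intro mult_nonneg_nonpos) auto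
    ultimately show "\<exists>y. (\<psi> has_real_derivative y) (at z) \<and> y \<le> 0" by auto
  qed
  moreover have "\<psi> 0 = 1" by (simp add: \<psi>_def \<phi>_def c_def)
  moreover have "1 + k * x > 0" using x k by (simp add: add_pos_nonneg)
  moreover from this have "(1 + k * x) powr k > 0" by simp
  ultimately have "\<phi> x \<le> (1 + k * x) powr k"
    by (simp add: \<psi>_def powr_minus field_simps)
  then show ?thesis by (simp add: \<phi>_def c_def)
qed

context steinhaus
begin

lemma bdd_measurable_w_power[simp]: "bdd_measurable M (\<lambda>y. w y ^ j)"
  by (intro bdd_measurable_intros bdd_measurable_w)

lemma linear_norm_le_aux:
  assumes k: "k \<ge> 1" and c: "cmod c < 1"
  shows "Lnorm M (2 * k) (\<lambda>y. 1 + c * w y) \<le> sqrt (1 + k * (cmod c)\<^sup>2)"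
proof (rule Lnorm_le)
  have "(\<integral>y. cmod (1 + c * w y) powr (2 * k) \<partial>M) = (\<Sum>j. (k gchoose j)\<^sup>2 * ((cmod c)\<^sup>2) ^ j)"
    using binomial_Parseval[OF c, of k] by (rule sums_unique)
  also have "\<dots> \<le> (1 + k * (cmod c)\<^sup>2) powr k"
    using c by (intro binomial_sq_series_le k) (auto simp: power_less_one_iff abs_square_less_1)
  also have "\<dots> = sqrt (1 + k * (cmod c)\<^sup>2) powr (2 * k)"
    using k by (simp add: powr_half_sqrt[symmetric] powr_powr add_nonneg_nonneg)
  finally show "(\<integral>y. cmod (1 + c * w y) powr (2 * k) \<partial>M) \<le> sqrt (1 + k * (cmod c)\<^sup>2) powr (2 * k)" .
qed (use k in auto)

lemma linear_norm_le_aux':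
  assumes k: "k \<ge> 1" and c: "cmod a1 < cmod a0"
  shows "Lnorm M (2 * k) (\<lambda>y. a0 + a1 * w y) \<le> sqrt ((cmod a0)\<^sup>2 + k * (cmod a1)\<^sup>2)"
proof -
  have a0: "a0 \<noteq> 0" using c by auto
  have "Lnorm M (2 * k) (\<lambda>y. a0 + a1 * w y) = Lnorm M (2 * k) (\<lambda>y. a0 * (1 + a1 / a0 * w y))"
    using a0 by (simp add: distrib_left)
  also have "\<dots> = cmod a0 * Lnorm M (2 * k) (\<lambda>y. 1 + a1 / a0 * w y)"
    using k by (intro Lnorm_cmult) auto
  also have "\<dots> \<le> cmod a0 * sqrt (1 + k * (cmod (a1/a0))\<^sup>2)"
    using c a0 by (intro mult_left_mono linear_norm_le_aux k) (auto simp: norm_divide)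
  also have "\<dots> = sqrt ((cmod a0)\<^sup>2 * (1 + k * (cmod (a1/a0))\<^sup>2))"
    by (simp add: real_sqrt_mult)
  also have "(cmod a0)\<^sup>2 * (1 + k * (cmod (a1/a0))\<^sup>2) = (cmod a0)\<^sup>2 + k * (cmod a1)\<^sup>2"
    using a0 by (simp add: norm_divide field_simps)
  finally show ?thesis .
qed

text \<open>If \<open>\<bar>a0\<bar> < \<bar>a1\<bar>\<close>, conjugation and multiplication by
  \<open>w\<close> interchange the coefficients without changing the modulus, and the bound so
  obtained is at least as good because \<open>k \<ge> 1\<close>. Equal moduli are approached by
  shrinking \<open>a1\<close>.\<close>

lemma linear_norm_le:
  assumes k: "k \<ge> 1"
  shows "Lnorm M (2 * k) (\<lambda>y. a0 + a1 * w y) \<le> sqrt ((cmod a0)\<^sup>2 + k * (cmod a1)\<^sup>2)"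
proof -
  consider "cmod a1 < cmod a0" | "cmod a0 < cmod a1" | "cmod a0 = cmod a1" by linarith
  then show ?thesis
  proof cases
    case 1 then show ?thesis by (intro linear_norm_le_aux' k)
  next
    case 2
    have "cmod (a0 + a1 * w y) = cmod (cnj a1 + cnj a0 * w y)" for y
    proof -
      have "cmod (cnj a1 + cnj a0 * w y) = cmod (cnj (cnj a1 + cnj a0 * w y))" by (simp only: complex_mod_cnj)
      also have "\<dots> = cmod (w y) * cmod (a1 + a0 * cnj (w y))" by (simp add: norm_w)
      also have "\<dots> = cmod (a1 * w y + a0 * (w y * cnj (w y)))"
        by (simp add: norm_mult[symmetric] algebra_simps)
      also have "w y * cnj (w y) = 1" using norm_w[of y] by (simp add: complex_norm_square[symmetric])
      finally show ?thesis by (simp add: add.commute)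
    qed
    then have "Lnorm M (2 * k) (\<lambda>y. a0 + a1 * w y) = Lnorm M (2 * k) (\<lambda>y. cnj a1 + cnj a0 * w y)"
      by (simp add: Lnorm_def)
    also have "\<dots> \<le> sqrt ((cmod a1)\<^sup>2 + k * (cmod a0)\<^sup>2)"
      using linear_norm_le_aux'[OF k, of "cnj a0" "cnj a1"] 2 by simp
    also have "\<dots> \<le> sqrt ((cmod a0)\<^sup>2 + k * (cmod a1)\<^sup>2)"
    proof -
      have "(k - 1) * (cmod a0)\<^sup>2 \<le> (k - 1) * (cmod a1)\<^sup>2" using k 2 by (intro mult_left_mono power_mono) auto
      then show ?thesis by (simp add: algebra_simps)
    qed
    finally show ?thesis .
  next
    case 3
    show ?thesis
    proof (rule field_le_epsilon)
      fix \<epsilon> :: real assume e: "\<epsilon> > 0"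
      show "Lnorm M (2 * k) (\<lambda>y. a0 + a1 * w y) \<le> sqrt ((cmod a0)\<^sup>2 + k * (cmod a1)\<^sup>2) + \<epsilon>"
      proof (cases "a1 = 0")
        case True
        have "Lnorm M (2 * k) (\<lambda>y. a0 + a1 * w y) \<le> cmod a0"
          using True k by (intro Lnorm_le_bound) auto
        then show ?thesis using True e by simp
      next
        case False
        \<comment> \<open>The discarded part \<open>(1 - t) * a1\<close> has modulus at most
          \<open>\<epsilon>\<close>; the maximum with 0 covers large
          \<open>\<epsilon>\<close>.\<close>
        define t where "t = max 0 (1 - \<epsilon> / cmod a1)"
        have t: "0 \<le> t" "t < 1" "(1 - t) * cmod a1 \<le> \<epsilon>"
          using e False by (auto simp: t_def max_def field_simps)
        have "Lnorm M (2 * k) (\<lambda>y. (a0 + (t * a1) * w y) + (complex_of_real (1 - t) * a1) * w y)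
          \<le> Lnorm M (2 * k) (\<lambda>y. a0 + (t * a1) * w y) + Lnorm M (2 * k) (\<lambda>y. (complex_of_real (1 - t) * a1) * w y)"
          using k by (intro Minkowski_ineq bdd_measurable_intros bdd_measurable_w) auto
        also have "Lnorm M (2 * k) (\<lambda>y. a0 + (t * a1) * w y) \<le> sqrt ((cmod a0)\<^sup>2 + k * (cmod (t * a1))\<^sup>2)"
          using t 3 False by (intro linear_norm_le_aux' k) (auto simp: norm_mult)
        also have "\<dots> \<le> sqrt ((cmod a0)\<^sup>2 + k * (cmod a1)\<^sup>2)"
          using t k by (auto simp: norm_mult power_mult_distrib mult_left_le_one_le power_le_one intro!: mult_left_mono)
        also have "Lnorm M (2 * k) (\<lambda>y. (complex_of_real (1 - t) * a1) * w y) \<le> (1 - t) * cmod a1"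
          using k t by (intro Lnorm_le_bound bdd_measurable_intros bdd_measurable_w) (auto simp: norm_mult norm_w simp del: of_real_diff)
        also have "\<dots> \<le> \<epsilon>" by (rule t)
        finally show ?thesis by (simp add: algebra_simps)
      qed
    qed
  qed
qed

text \<open>Writing \<open>f\<close> as the convex combination of the functions \<open>a 0 + (a j / \<lambda> j) * w ^ j\<close> reduces to
  the linear case at the cost of slightly larger weights.\<close>

lemma polynomial_norm_le:
  assumes k: "k \<ge> 1" and l: "\<And>j. j \<in> {1..J} \<Longrightarrow> l j > 0" "(\<Sum>j=1..J. l j) \<le> 1"
  shows "(Lnorm M (2 * k) (\<lambda>y. \<Sum>j\<le>J. a j * w y ^ j))\<^sup>2 \<le> (cmod (a 0))\<^sup>2 + (\<Sum>j=1..J. k / l j * (cmod (a j))\<^sup>2)"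
proof -
  define l0 where "l0 = 1 - (\<Sum>j=1..J. l j)"
  define s where "s j = sqrt ((cmod (a 0))\<^sup>2 + k * (cmod (a j / l j))\<^sup>2)" for j
  have l0: "l0 \<ge> 0" using l by (simp add: l0_def)
  have s0: "s j \<ge> 0" for j using k by (simp add: s_def)
  have dec: "(\<Sum>j\<le>J. a j * w y ^ j) = l0 * a 0 + (\<Sum>j=1..J. l j * (a 0 + a j / l j * w y ^ j))" for y
  proof -
    have "(\<Sum>j=1..J. l j * (a 0 + a j / l j * w y ^ j)) = (\<Sum>j=1..J. l j * a 0 + a j * w y ^ j)"
    proof (intro sum.cong refl)
      fix j assume "j \<in> {1..J}"
      then have "l j \<noteq> 0" using l(1)[of j] by auto
      then show "l j * (a 0 + a j / l j * w y ^ j) = l j * a 0 + a j * w y ^ j" by (simp add: field_simps)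
    qed
    also have "\<dots> = complex_of_real (\<Sum>j=1..J. l j) * a 0 + (\<Sum>j=1..J. a j * w y ^ j)"
      by (simp add: sum.distrib sum_distrib_right)
    also have "{..J} = insert 0 {1..J}" by auto
    ultimately show ?thesis by (simp add: l0_def algebra_simps)
  qed
  have "Lnorm M (2 * k) (\<lambda>y. \<Sum>j\<le>J. a j * w y ^ j) \<le>
     Lnorm M (2 * k) (\<lambda>y. l0 * a 0) + Lnorm M (2 * k) (\<lambda>y. \<Sum>j=1..J. l j * (a 0 + a j / l j * w y ^ j))"
    unfolding dec using k by (intro Minkowski_ineq bdd_measurable_intros bdd_measurable_w) auto
  also have "Lnorm M (2 * k) (\<lambda>y. l0 * a 0) \<le> l0 * cmod (a 0)"
    using k l0 by (intro Lnorm_le_bound) (auto simp: norm_mult)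
  also have "Lnorm M (2 * k) (\<lambda>y. \<Sum>j=1..J. l j * (a 0 + a j / l j * w y ^ j))
     \<le> (\<Sum>j=1..J. Lnorm M (2 * k) (\<lambda>y. l j * (a 0 + a j / l j * w y ^ j)))"
    using k by (intro Minkowski_sum bdd_measurable_intros bdd_measurable_w) auto
  also have "\<dots> \<le> (\<Sum>j=1..J. l j * s j)"
  proof (intro sum_mono)
    fix j assume j: "j \<in> {1..J}"
    interpret wj: steinhaus M "\<lambda>y. w y ^ j" using j by (intro steinhaus_power) auto
    have "Lnorm M (2 * k) (\<lambda>y. l j * (a 0 + a j / l j * w y ^ j)) = l j * Lnorm M (2 * k) (\<lambda>y. a 0 + a j / l j * w y ^ j)"
      using k l(1)[OF j] by (subst Lnorm_cmult) auto
    also have "\<dots> \<le> l j * s j" unfolding s_def using l(1)[OF j] by (intro mult_left_mono wj.linear_norm_le k) auto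
    finally show "Lnorm M (2 * k) (\<lambda>y. l j * (a 0 + a j / l j * w y ^ j)) \<le> l j * s j" .
  qed
  finally have "Lnorm M (2 * k) (\<lambda>y. \<Sum>j\<le>J. a j * w y ^ j) \<le> l0 * cmod (a 0) + (\<Sum>j=1..J. l j * s j)" by simp
  then have "(Lnorm M (2 * k) (\<lambda>y. \<Sum>j\<le>J. a j * w y ^ j))\<^sup>2 \<le> (l0 * cmod (a 0) + (\<Sum>j=1..J. l j * s j))\<^sup>2"
    by (intro power_mono) auto
  also have "\<dots> \<le> l0 * (cmod (a 0))\<^sup>2 + (\<Sum>j=1..J. l j * (s j)\<^sup>2)"
  proof -
    \<comment> \<open>Index 0 receives the unassigned mass \<open>l0\<close>. The weights then sum
      to exactly 1, and Cauchy-Schwarz becomes convexity of the square.\<close>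
    define L where "L = (\<lambda>j. if j = 0 then l0 else l j)"
    define S where "S = (\<lambda>j. if j = 0 then cmod (a 0) else s j)"
    have L0: "L j \<ge> 0" if "j \<le> J" for j using l0 l(1)[of j] that by (auto simp: L_def less_imp_le)
    have split: "(\<Sum>j\<le>J. L j * f (S j)) = l0 * f (cmod (a 0)) + (\<Sum>j=1..J. l j * f (s j))" for f :: "real \<Rightarrow> real"
    proof -
      have "{..J} = insert 0 {1..J}" by auto
      moreover have "(\<Sum>j=1..J. L j * f (S j)) = (\<Sum>j=1..J. l j * f (s j))"
        by (intro sum.cong) (auto simp: L_def S_def)
      ultimately show ?thesis by (simp add: L_def S_def)
    qed
    have L1: "(\<Sum>j\<le>J. L j) = 1" using split[of "\<lambda>_. 1"] by (simp add: l0_def)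
    have "(\<Sum>j\<le>J. sqrt (L j) * (sqrt (L j) * S j))\<^sup>2 \<le> (\<Sum>j\<le>J. (sqrt (L j))\<^sup>2) * (\<Sum>j\<le>J. (sqrt (L j) * S j)\<^sup>2)"
      by (rule Cauchy_Schwarz_ineq_sum)
    also have "(\<Sum>j\<le>J. (sqrt (L j))\<^sup>2) = 1" using L0 L1 by simp
    also have "(\<Sum>j\<le>J. (sqrt (L j) * S j)\<^sup>2) = (\<Sum>j\<le>J. L j * (S j)\<^sup>2)"
      using L0 by (simp add: power_mult_distrib)
    also have "(\<Sum>j\<le>J. sqrt (L j) * (sqrt (L j) * S j)) = (\<Sum>j\<le>J. L j * S j)"
      using L0 by (simp flip: mult.assoc)
    finally show ?thesis using split[of "\<lambda>x. x"] split[of "\<lambda>x. x\<^sup>2"] by simp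
  qed
  also have "(\<Sum>j=1..J. l j * (s j)\<^sup>2) = (\<Sum>j=1..J. l j * (cmod (a 0))\<^sup>2 + k / l j * (cmod (a j))\<^sup>2)"
  proof (intro sum.cong refl)
    fix j assume j: "j \<in> {1..J}"
    have "(s j)\<^sup>2 = (cmod (a 0))\<^sup>2 + k * (cmod (a j / l j))\<^sup>2" using k by (simp add: s_def)
    then show "l j * (s j)\<^sup>2 = l j * (cmod (a 0))\<^sup>2 + k / l j * (cmod (a j))\<^sup>2"
      using l(1)[OF j] by (simp add: norm_divide field_simps power2_eq_square)
  qed
  also have "l0 * (cmod (a 0))\<^sup>2 + \<dots> = (cmod (a 0))\<^sup>2 + (\<Sum>j=1..J. k / l j * (cmod (a j))\<^sup>2)"
    by (simp add: l0_def sum.distrib sum_distrib_right algebra_simps)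
  finally show ?thesis .
qed

text \<open>Parseval's identity turns the integral into a power series in
  \<open>x = \<bar>c\<bar>\<^sup>2\<close>, which is compared termwise with the binomial series of
  the right-hand side. The two series agree at \<open>j = 0\<close> and \<open>j = 1\<close>, so the
  loss is only of order \<open>x\<^sup>2\<close>.\<close>

lemma geometric_norm_le:
  assumes k: "k \<ge> 1" and m: "real m \<le> k" "k < real m + 1" and c: "(cmod c)\<^sup>2 * (k / m) < 1"
  shows "(\<integral>y. cmod (1 - c * w y) powr (- (2 * k)) \<partial>M) \<le> (1 - k / m * (cmod c)\<^sup>2) powr (- (k * m))"
proof -
  define x where "x = (cmod c)\<^sup>2"
  define s where "s = k / m"
  have m0: "m > 0" using k m by (auto intro: Nat.gr0I)
  have s: "s \<ge> 1" using m m0 by (simp add: s_def)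
  have x: "0 \<le> x" "s * x < 1" using c by (auto simp: x_def s_def mult.commute)
  have "x \<le> s * x" using s x by (simp add: mult_le_cancel_right1)
  with x have x1: "x < 1" by simp
  have c1: "cmod (- c) < 1" using x1 by (simp add: x_def abs_square_less_1)
  from binomial_Parseval[OF c1, of "- k"]
  have S1: "(\<lambda>j. (- k gchoose j)\<^sup>2 * x ^ j) sums (\<integral>y. cmod (1 - c * w y) powr (- (2 * k)) \<partial>M)"
    by (simp add: x_def)
  have "\<bar>- (s * x)\<bar> < 1" using x s by simp
  from gen_binomial_real[OF this, of "- (k * m)"]
  have S2: "(\<lambda>j. (- (k * m) gchoose j) * (- (s * x)) ^ j) sums (1 - s * x) powr (- (k * m))" by simp
  have le: "(- k gchoose j)\<^sup>2 \<le> (- (k * m) gchoose j) * (- s) ^ j" for j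
  proof (induction j)
    case (Suc j)
    define u where "u = - k gchoose j"
    define v where "v = (- (k * m) gchoose j) * (- s) ^ j"
    have uv: "u\<^sup>2 \<le> v" using Suc by (simp add: u_def v_def)
    have v0: "v \<ge> 0" using uv zero_le_power2[of u] by linarith
    have a: "(real j + 1) * (- k gchoose Suc j) = - ((k + j) * u)"
      unfolding u_def gbinomial_Suc_real by (simp add: algebra_simps)
    have b: "(real j + 1) * ((- (k * m) gchoose Suc j) * (- s) ^ Suc j) = s * (k * m + j) * v"
    proof -
      have "(real j + 1) * ((- (k * m) gchoose Suc j) * (- s) ^ Suc j) = ((real j + 1) * (- (k * m) gchoose Suc j)) * (- s) ^ Suc j" by simp
      also have "\<dots> = s * (k * m + j) * v" unfolding v_def gbinomial_Suc_real by (simp add: algebra_simps)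
      finally show ?thesis .
    qed
    \<comment> \<open>The ratios of consecutive coefficients are
      \<open>(k + j)\<^sup>2 / (j + 1)\<^sup>2\<close> on the left and
      \<open>s * (k * m + j) / (j + 1)\<close> on the right; this compares them.\<close>
    have key: "(k + j)\<^sup>2 \<le> (real j + 1) * (s * (k * m + j))"
    proof -
      have "s * (k * m + j) = k\<^sup>2 + s * j" using m0 by (simp add: s_def field_simps power2_eq_square)
      moreover have "(real j + 1) * (k\<^sup>2 + s * j) - (k + j)\<^sup>2 = j * ((k - 1)\<^sup>2 + (real j + 1) * (s - 1))"
        by (simp add: power2_eq_square algebra_simps)
      moreover have "\<dots> \<ge> 0" using s by (intro mult_nonneg_nonneg add_nonneg_nonneg) auto
      ultimately show ?thesis by simp
    qed
    have "(real j + 1)\<^sup>2 * (- k gchoose Suc j)\<^sup>2 = (k + j)\<^sup>2 * u\<^sup>2"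
      using arg_cong[OF a, of "\<lambda>t. t\<^sup>2"] by (simp only: power_mult_distrib power2_minus)
    also have "\<dots> \<le> ((real j + 1) * (s * (k * m + j))) * v"
      using key uv v0 s k by (intro mult_mono) (auto intro!: mult_nonneg_nonneg add_nonneg_nonneg)
    also have "\<dots> = (real j + 1)\<^sup>2 * ((- (k * m) gchoose Suc j) * (- s) ^ Suc j)"
      by (simp only: power2_eq_square b mult.assoc)
    finally show ?case by (subst (asm) mult_le_cancel_left_pos) auto
  qed simp
  have "(\<integral>y. cmod (1 - c * w y) powr (- (2 * k)) \<partial>M) \<le> (1 - s * x) powr (- (k * m))"
  proof (rule sums_le[OF _ S1 S2])
    fix j
    have "(- k gchoose j)\<^sup>2 * x ^ j \<le> ((- (k * m) gchoose j) * (- s) ^ j) * x ^ j"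
      using x by (intro mult_right_mono le) auto
    also have "\<dots> = (- (k * m) gchoose j) * (- (s * x)) ^ j" by (simp flip: power_mult_distrib)
    finally show "(- k gchoose j)\<^sup>2 * x ^ j \<le> (- (k * m) gchoose j) * (- (s * x)) ^ j" .
  qed
  then show ?thesis by (simp add: s_def x_def)
qed

end

section \<open>The lower estimate in one variable\<close>

lemma Bernoulli_powr:
  fixes x u :: real
  assumes "x \<ge> 0" "u \<ge> 1"
  shows "1 + u * x \<le> (1 + x) powr u"
proof -
  have pos: "1 + u * x > 0" using assms by (simp add: add_pos_nonneg)
  have "(1 + u * x) powr (1/u) * 1 powr (1 - 1/u) \<le> (1/u) * (1 + u * x) + (1 - 1/u) * 1"
    using assms pos by (intro Youngs_inequality_0) auto
  also have "\<dots> = 1 + x" using assms by (simp add: field_simps)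
  finally have "((1 + u * x) powr (1/u)) powr u \<le> (1 + x) powr u"
    using assms by (intro powr_mono2) auto
  then show ?thesis using assms pos by (simp add: powr_powr)
qed

context steinhaus
begin

lemma w_cnj: "w y * cnj (w y) = 1" "cnj (w y) * w y = 1"
  using norm_w[of y] by (simp_all add: complex_norm_square[symmetric] mult.commute)

text \<open>Duality. The test function
  \<open>(\<alpha> + \<gamma> * cnj w) * (1 + b * w) powr (1 - 2/p)\<close> has modulus
  \<open>\<bar>1 + b * w\<bar> powr (2 - 2/p)\<close>, so Hoelder's inequality leaves an
  \<open>L\<^sup>2\<close> norm that is explicit. The second factor expands in nonnegative powers of
  \<open>w\<close>, and \<open>cnj w\<close> lowers degrees by one, so the pairing sees
  \<open>a 0\<close> and \<open>a 1\<close> alone.\<close>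

lemma polynomial_test_bound:
  assumes p: "1 \<le> p" and b: "cmod b < 1" and J: "J \<ge> 1"
    and al: "\<And>y. cmod (\<alpha> + \<gamma> * cnj (w y)) = cmod (1 + b * w y)"
  shows "cmod (\<alpha> * a 0 + \<gamma> * (a 1 - (2/p - 1) * b * a 0)) \<le>
    Lnorm M p (\<lambda>y. \<Sum>j\<le>J. a j * w y ^ j) * (1 + (cmod b)\<^sup>2) powr (1 - 1/p)"
proof -
  define \<beta> where "\<beta> = 2/p - 1"
  define c where "c j = complex_of_real (- \<beta> gchoose j) * b ^ j" for j
  define G where "G = power_series w c"
  define f where "f y = (\<Sum>j\<le>J. a j * w y ^ j)" for y
  have c: "summable (\<lambda>j. cmod (c j))" unfolding c_def by (rule gbinomial_abs_summable[OF b])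
  have bmG: "bdd_measurable M G" unfolding G_def by (rule bdd_measurable_power_series[OF c])
  have bmf: "bdd_measurable M f" unfolding f_def by (intro bdd_measurable_intros bdd_measurable_w)
  have c01: "c 0 = 1" "c (Suc 0) = - \<beta> * b" by (simp_all add: c_def)
  have Gv: "G y = (1 + b * w y) powr of_real (- \<beta>)" for y
    unfolding G_def c_def by (rule power_series_binomial[OF b])
  have nz: "cmod (1 + b * w y) > 0" for y
  proof -
    have "cmod (b * w y) < 1" using b by (simp add: norm_mult norm_w)
    then show ?thesis by (metis add_diff_cancel_left' add_eq_0_iff norm_minus_cancel norm_one order_less_irrefl zero_less_norm_iff)
  qed
  have i1: "(\<integral>y. w y ^ j * G y \<partial>M) = (if j = 0 then 1 else 0)" for j
    using power_series_coeff(2)[OF c, of j] by (simp add: G_def c01 mult.commute)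
  have i2: "(\<integral>y. w y ^ j * (cnj (w y) * G y) \<partial>M) = (if j = 0 then - \<beta> * b else if j = 1 then 1 else 0)" for j
  proof (cases j)
    case 0 then show ?thesis using power_series_coeff(1)[OF c, of 1] by (simp add: G_def c01 mult.commute)
  next
    case (Suc i)
    have "w y ^ j * (cnj (w y) * G y) = w y ^ i * G y" for y
    proof -
      have "w y ^ j * (cnj (w y) * G y) = w y ^ i * G y * (w y * cnj (w y))" by (simp add: Suc)
      then show ?thesis by (simp only: w_cnj mult_1_right)
    qed
    then have "(\<integral>y. w y ^ j * (cnj (w y) * G y) \<partial>M) = (\<integral>y. w y ^ i * G y \<partial>M)" by (simp only:)
    then show ?thesis using i1[of i] Suc by simp
  qed
  have "(\<integral>y. f y * ((\<alpha> + \<gamma> * cnj (w y)) * G y) \<partial>M)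
     = (\<integral>y. (\<Sum>j\<le>J. \<alpha> * a j * (w y ^ j * G y) + \<gamma> * a j * (w y ^ j * (cnj (w y) * G y))) \<partial>M)"
    unfolding f_def sum_distrib_right by (intro Bochner_Integration.integral_cong sum.cong refl) (simp add: algebra_simps)
  also have "\<dots> = (\<Sum>j\<le>J. \<alpha> * a j * (\<integral>y. w y ^ j * G y \<partial>M) + \<gamma> * a j * (\<integral>y. w y ^ j * (cnj (w y) * G y) \<partial>M))"
    by (subst Bochner_Integration.integral_sum, (intro bdd_measurable_integrable bdd_measurable_intros bdd_measurable_w bmG),
        intro sum.cong refl, subst Bochner_Integration.integral_add)
       (auto intro!: bdd_measurable_integrable bdd_measurable_intros bdd_measurable_w bmG)
  also have "\<dots> = (\<Sum>j\<le>J. if j = 0 then \<alpha> * a 0 - \<gamma> * a 0 * \<beta> * b else if j = 1 then \<gamma> * a 1 else 0)"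
    by (intro sum.cong refl, unfold i1 i2) (simp add: algebra_simps)
  also have "\<dots> = (\<Sum>j\<in>{0,1::nat}. if j = 0 then \<alpha> * a 0 - \<gamma> * a 0 * \<beta> * b else if j = 1 then \<gamma> * a 1 else 0)"
    using J by (intro sum.mono_neutral_right) auto
  also have "\<dots> = \<alpha> * a 0 + \<gamma> * (a 1 - \<beta> * b * a 0)" by (simp add: algebra_simps)
  finally have eq: "(\<integral>y. f y * ((\<alpha> + \<gamma> * cnj (w y)) * G y) \<partial>M) = \<alpha> * a 0 + \<gamma> * (a 1 - \<beta> * b * a 0)" .
  have "cmod (\<integral>y. f y * ((\<alpha> + \<gamma> * cnj (w y)) * G y) \<partial>M) \<le> (\<integral>y. cmod (f y * ((\<alpha> + \<gamma> * cnj (w y)) * G y)) \<partial>M)"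
    by (rule integral_norm_bound)
  also have "\<dots> = (\<integral>y. cmod (f y) * cmod (1 + b * w y) powr (2 - 2/p) \<partial>M)"
  proof (intro Bochner_Integration.integral_cong refl)
    fix y
    have "cmod (1 + b * w y) powr (2 - 2/p) = cmod (1 + b * w y) powr (1 + (- \<beta>))" by (simp add: \<beta>_def)
    also have "\<dots> = cmod (1 + b * w y) * cmod (1 + b * w y) powr (- \<beta>)"
      using nz[of y] by (subst powr_add) simp
    finally show "cmod (f y * ((\<alpha> + \<gamma> * cnj (w y)) * G y)) = cmod (f y) * cmod (1 + b * w y) powr (2 - 2/p)"
      by (simp add: norm_mult al Gv norm_powr_real_powr' flip: of_real_minus)
  qed
  also have "\<dots> \<le> Lnorm M p f * (\<integral>y. (cmod (1 + b * w y))\<^sup>2 \<partial>M) powr (1 - 1/p)"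
    using p by (intro Holder_ineq bmf bdd_measurable_intros bdd_measurable_w) auto
  also have "(\<integral>y. (cmod (1 + b * w y))\<^sup>2 \<partial>M) = 1 + (cmod b)\<^sup>2"
  proof -
    define d where "d j = (if j = 0 then 1 else if j = Suc 0 then b else 0)" for j :: nat
    have fin: "finite {0, Suc 0}" and d0: "j \<notin> {0, Suc 0} \<Longrightarrow> d j = 0" for j by (auto simp: d_def)
    have "summable (\<lambda>j. cmod (d j))" by (rule summable_finite[OF fin]) (auto simp: d_def)
    from power_series_Parseval[OF this] have "(\<lambda>j. (cmod (d j))\<^sup>2) sums (\<integral>y. (cmod (power_series w d y))\<^sup>2 \<partial>M)" .
    moreover have "power_series w d y = 1 + b * w y" for y
      unfolding power_series_def by (subst suminf_finite[OF fin]) (auto simp: d_def)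
    moreover have "(\<lambda>j. (cmod (d j))\<^sup>2) sums (\<Sum>j\<in>{0, Suc 0}. (cmod (d j))\<^sup>2)"
      by (rule sums_finite[OF fin]) (auto simp: d_def)
    ultimately show ?thesis by (simp add: d_def sums_iff)
  qed
  finally show ?thesis unfolding eq by (simp add: \<beta>_def f_def[abs_def])
qed

text \<open>Put \<open>u = 2/p\<close> and let \<open>x\<close>, \<open>z\<close> be the moduli of
  the two coefficients. The functions \<open>x * (1 + t * w) powr u\<close> and
  \<open>c * (t + w) * (1 + t * w) powr (u - 1)\<close> with \<open>0 \<le> t \<le> 1\<close> have
  modulus proportional to \<open>\<bar>1 + t * w\<bar> powr u\<close> and realise every pair
  \<open>(x, z)\<close>: the first family those with \<open>z \<le> u * x\<close>, the second the
  others. The test functions above show that no polynomial with these coefficients has a smaller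
  norm, and the norm of the extremal function is then compared with
  \<open>x\<^sup>2 + z\<^sup>2 / u\<close>.\<close>

lemma polynomial_norm_ge:
  assumes p: "1 \<le> p" "p \<le> 2" and J: "J \<ge> 1"
  shows "(cmod (a 0))\<^sup>2 + p/2 * (cmod (a 1))\<^sup>2 \<le> (Lnorm M p (\<lambda>y. \<Sum>j\<le>J. a j * w y ^ j))\<^sup>2"
proof -
  define N where "N = Lnorm M p (\<lambda>y. \<Sum>j\<le>J. a j * w y ^ j)"
  define u where "u = 2/p"
  define x where "x = cmod (a 0)"
  define z where "z = cmod (a 1)"
  have u: "1 \<le> u" "u \<le> 2" using p by (auto simp: u_def field_simps)
  have pu: "1 - 1/p = 1 - u/2" by (simp add: u_def)
  have xz: "x \<ge> 0" "z \<ge> 0" by (simp_all add: x_def z_def)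
  have N0: "N \<ge> 0" by (simp add: N_def)
  \<comment> \<open>A phase that puts \<open>\<theta> * a 0\<close> and \<open>a 1\<close> on the
    same ray, so that the moduli in the test functionals add up. If one coefficient vanishes, any
    phase will do.\<close>
  define \<theta> where "\<theta> = (if a 0 = 0 \<or> a 1 = 0 then 1 else (a 1 * cnj (a 0)) / (x * z))"
  have th1: "cmod \<theta> = 1"
    by (auto simp: \<theta>_def x_def z_def norm_divide norm_mult)
  have th2: "\<theta> * a 0 * z = a 1 * x"
  proof (cases "a 0 = 0 \<or> a 1 = 0")
    case False
    then have nz: "complex_of_real x \<noteq> 0" "complex_of_real z \<noteq> 0" by (auto simp: x_def z_def)
    have "a 0 * cnj (a 0) = complex_of_real (x\<^sup>2)" unfolding x_def by (rule complex_norm_square[symmetric])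
    then have "\<theta> * a 0 * z = a 1 * complex_of_real (x\<^sup>2) * z / (x * z)" using False by (simp add: \<theta>_def mult_ac)
    then show ?thesis using nz by (simp add: power2_eq_square)
  qed (auto simp: x_def z_def)
  have th3: "cnj \<theta> * a 1 * x = a 0 * z"
  proof -
    have "cnj \<theta> * (\<theta> * a 0 * z) = cnj \<theta> * (a 1 * x)" by (simp add: th2)
    moreover have "cnj \<theta> * \<theta> = 1" using th1 by (metis complex_norm_square mult.commute of_real_1 one_power2)
    ultimately show ?thesis by (simp add: mult.assoc[symmetric])
  qed
  have ray: "cmod (r * v + s * v') = r * cmod v + s * cmod v'"
    if "v' * cmod v = v * cmod v'" "r \<ge> 0" "s \<ge> 0" for r s :: real and v v' :: complex
  proof (cases "v = 0")
    case False
    then have "complex_of_real (cmod v) \<noteq> 0" by simp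
    then have "v' = v * (cmod v' / cmod v)" using that by (simp add: field_simps)
    moreover have "r * v + s * (v * (cmod v' / cmod v)) = v * complex_of_real (r + s * (cmod v' / cmod v))" by (simp add: algebra_simps)
    ultimately have "r * v + s * v' = v * complex_of_real (r + s * (cmod v' / cmod v))" by simp
    then have "cmod (r * v + s * v') = cmod v * \<bar>r + s * (cmod v' / cmod v)\<bar>" by (simp only: norm_mult norm_of_real)
    also have "\<dots> = cmod v * (r + s * (cmod v' / cmod v))" using that by simp
    also have "\<dots> = r * cmod v + s * cmod v'" using False by (simp add: distrib_left)
    finally show ?thesis .
  qed (use that in \<open>auto simp: norm_mult\<close>)
  have I1: "x * (1 - (u - 1) * t\<^sup>2) + t * z \<le> N * (1 + t\<^sup>2) powr (1 - u/2)" if t: "0 \<le> t" "t < 1" for t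
  proof -
    define b where "b = t * \<theta>"
    have b: "cmod b = t" using t th1 by (simp add: b_def norm_mult)
    have "cmod (1 + cnj b * cnj (w y)) = cmod (1 + b * w y)" for y
      by (metis complex_cnj_add complex_cnj_mult complex_cnj_one complex_mod_cnj)
    from polynomial_test_bound[OF p(1) _ J this, of a] b t
    have A: "cmod (1 * a 0 + cnj b * (a 1 - (u - 1) * b * a 0)) \<le> N * (1 + t\<^sup>2) powr (1 - u/2)"
      by (simp add: N_def u_def)
    have B: "1 * a 0 + cnj b * (a 1 - (u - 1) * b * a 0) = complex_of_real (1 - (u - 1) * t\<^sup>2) * a 0 + t * (cnj \<theta> * a 1)"
    proof -
      have "cnj b * b = complex_of_real (t\<^sup>2)" using b by (metis complex_norm_square mult.commute)
      moreover have "1 * a 0 + cnj b * (a 1 - (u - 1) * b * a 0) = a 0 + cnj b * a 1 - (u - 1) * (cnj b * b) * a 0"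
        by (simp only: algebra_simps mult_1_left)
      ultimately have "1 * a 0 + cnj b * (a 1 - (u - 1) * b * a 0) = a 0 + cnj b * a 1 - (u - 1) * complex_of_real (t\<^sup>2) * a 0"
        by (simp only:)
      then show ?thesis by (simp add: algebra_simps) (simp add: b_def)
    qed
    have C: "cmod (complex_of_real (1 - (u - 1) * t\<^sup>2) * a 0 + t * (cnj \<theta> * a 1)) = (1 - (u - 1) * t\<^sup>2) * cmod (a 0) + t * cmod (cnj \<theta> * a 1)"
    proof (rule ray)
      show "cnj \<theta> * a 1 * cmod (a 0) = a 0 * cmod (cnj \<theta> * a 1)" using th3 th1 by (simp add: norm_mult x_def z_def)
      have "(u - 1) * t\<^sup>2 \<le> 1 * 1" using u t by (intro mult_mono) (auto simp: power_le_one)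
      then show "0 \<le> 1 - (u - 1) * t\<^sup>2" by simp
    qed (use t in auto)
    show ?thesis using A[unfolded B C] th1 by (simp add: norm_mult x_def z_def algebra_simps)
  qed
  have I2: "z + (2 - u) * t * x \<le> N * (1 + t\<^sup>2) powr (1 - u/2)" if t: "0 \<le> t" "t < 1" for t
  proof -
    define b where "b = t * \<theta>"
    have b: "cmod b = t" using t th1 by (simp add: b_def norm_mult)
    have "cmod (b + 1 * cnj (w y)) = cmod (1 + b * w y)" for y
    proof -
      have "cmod (b + 1 * cnj (w y)) = cmod ((b + 1 * cnj (w y)) * w y)" by (simp only: norm_mult norm_w mult_1_right)
      also have "(b + 1 * cnj (w y)) * w y = 1 + b * w y" using w_cnj[of y] by (simp add: algebra_simps)
      finally show ?thesis .
    qed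
    from polynomial_test_bound[OF p(1) _ J this, of a] b t
    have A: "cmod (b * a 0 + 1 * (a 1 - (u - 1) * b * a 0)) \<le> N * (1 + t\<^sup>2) powr (1 - u/2)"
      by (simp add: N_def u_def)
    have B: "b * a 0 + 1 * (a 1 - (u - 1) * b * a 0) = complex_of_real 1 * a 1 + complex_of_real ((2 - u) * t) * (\<theta> * a 0)"
      by (simp add: b_def algebra_simps)
    have C: "cmod (complex_of_real 1 * a 1 + complex_of_real ((2 - u) * t) * (\<theta> * a 0)) = 1 * cmod (a 1) + ((2 - u) * t) * cmod (\<theta> * a 0)"
      using u t th2 th1 by (intro ray) (auto simp: norm_mult x_def z_def)
    show ?thesis using A[unfolded B C] th1 by (simp add: norm_mult x_def z_def)
  qed
  \<comment> \<open>The test bound requires \<open>\<bar>b\<bar> < 1\<close>, while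
    \<open>z = u * x\<close> leads to \<open>t = 1\<close>; this case is reached as a limit.\<close>
  have I1': "x * (1 - (u - 1) * t\<^sup>2) + t * z \<le> N * (1 + t\<^sup>2) powr (1 - u/2)" if t: "0 \<le> t" "t \<le> 1" for t
  proof (cases "t = 1")
    case True
    have "((\<lambda>t::real. x * (1 - (u - 1) * t\<^sup>2) + t * z) \<longlongrightarrow> x * (1 - (u - 1) * 1\<^sup>2) + 1 * z) (at_left 1)"
      by (intro tendsto_intros)
    moreover have "((\<lambda>t::real. N * (1 + t\<^sup>2) powr (1 - u/2)) \<longlongrightarrow> N * (1 + 1\<^sup>2) powr (1 - u/2)) (at_left 1)"
      by (intro tendsto_intros) auto
    moreover have "\<forall>\<^sub>F t in at_left 1. x * (1 - (u - 1) * t\<^sup>2) + t * z \<le> N * (1 + t\<^sup>2) powr (1 - u/2)"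
      using eventually_at_left_real[of 0 1] by (auto elim!: eventually_mono intro!: I1)
    ultimately show ?thesis unfolding True by (intro tendsto_le[OF _ _ ]) auto
  qed (use t I1 in auto)
  have conc: "(c * (1 + t\<^sup>2) powr (u/2)) \<le> N" if "c * (1 + t\<^sup>2) \<le> N * (1 + t\<^sup>2) powr (1 - u/2)" for c t
  proof -
    have pos: "1 + t\<^sup>2 > 0" by (simp add: add_pos_nonneg)
    have "c * (1 + t\<^sup>2) powr (u/2) * (1 + t\<^sup>2) powr (1 - u/2) = c * (1 + t\<^sup>2)"
      using pos by (simp add: mult.assoc flip: powr_add)
    with that have "c * (1 + t\<^sup>2) powr (u/2) * (1 + t\<^sup>2) powr (1 - u/2) \<le> N * (1 + t\<^sup>2) powr (1 - u/2)"
      by (simp only:)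
    then show ?thesis using pos by (subst (asm) mult_le_cancel_right_pos) auto
  qed
  have bern: "c\<^sup>2 * (1 + u * t\<^sup>2) \<le> N\<^sup>2" if "c * (1 + t\<^sup>2) powr (u/2) \<le> N" "c \<ge> 0" for c t
  proof -
    have "(c * (1 + t\<^sup>2) powr (u/2))\<^sup>2 \<le> N\<^sup>2" using that by (intro power_mono) auto
    moreover have "(c * (1 + t\<^sup>2) powr (u/2))\<^sup>2 = c\<^sup>2 * (1 + t\<^sup>2) powr u"
      by (simp add: power_mult_distrib power2_eq_square[of "_ powr _"] flip: powr_add)
    moreover have "1 + u * t\<^sup>2 \<le> (1 + t\<^sup>2) powr u"
      using Bernoulli_powr[of "t\<^sup>2" u] u by simp
    ultimately show ?thesis by (smt (verit) mult_left_mono zero_le_power2)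
  qed
  have "x\<^sup>2 + z\<^sup>2 / u \<le> N\<^sup>2"
  proof (cases "z \<le> u * x")
    case True
    show ?thesis
    proof (cases "x = 0")
      case x0: True
      then have "z = 0" using True xz by simp
      then show ?thesis using x0 by simp
    next
      case False
      then have x: "x > 0" using xz by simp
      define t where "t = z / (u * x)"
      have t: "0 \<le> t" "t \<le> 1" "z = u * x * t" using True x u xz by (auto simp: t_def field_simps)
      have "x * (1 + t\<^sup>2) = x * (1 - (u - 1) * t\<^sup>2) + t * z"
        unfolding t(3) by (simp add: algebra_simps power2_eq_square)
      also have "\<dots> \<le> N * (1 + t\<^sup>2) powr (1 - u/2)" by (rule I1'[OF t(1,2)])
      finally have "x\<^sup>2 * (1 + u * t\<^sup>2) \<le> N\<^sup>2" using xz by (intro bern conc)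
      moreover have "x\<^sup>2 * (1 + u * t\<^sup>2) = x\<^sup>2 + z\<^sup>2 / u"
        unfolding t(3) using u by (simp add: field_simps power2_eq_square)
      ultimately show ?thesis by simp
    qed
  next
    case False
    \<comment> \<open>These are the first two coefficients of
      \<open>c * (t + w) * (1 + t * w) powr (u - 1)\<close>. For \<open>x > 0\<close>, eliminating
      \<open>c\<close> leaves a quadratic expression in \<open>t\<close> that is positive at 0 and,
      because \<open>z > u * x\<close>, negative at 1.\<close>
    obtain t c where tc: "0 \<le> t" "t < 1" "c \<ge> 0" "x = t * c" "z = c * (1 + (u - 1) * t\<^sup>2)"
    proof (cases "x = 0")
      case True
      then show ?thesis using that[of 0 z] xz by simp
    next
      case x0: False
      then have x: "x > 0" using xz by simp
      have "\<exists>t\<ge>0. t \<le> 1 \<and> (u - 1) * x * t\<^sup>2 - z * t + x = 0"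
      proof (rule IVT2[of "\<lambda>t. (u - 1) * x * t\<^sup>2 - z * t + x" 1 0 0])
        show "(u - 1) * x * 1\<^sup>2 - z * 1 + x \<le> 0" using False by (simp add: algebra_simps)
      qed (use x in auto)
      then obtain t where t: "0 \<le> t" "t \<le> 1" "(u - 1) * x * t\<^sup>2 - z * t + x = 0" by auto
      have "t \<noteq> 0" using t x by auto
      moreover have "t \<noteq> 1" using t False by (auto simp: algebra_simps)
      ultimately have t': "0 < t" "t < 1" using t by auto
      have "z * t = x * (1 + (u - 1) * t\<^sup>2)" using t by (simp add: algebra_simps)
      then have "z = x / t * (1 + (u - 1) * t\<^sup>2)" using t' by (simp add: field_simps)
      then show ?thesis using that[of t "x / t"] t' x by simp
    qed
    have "c * (1 + t\<^sup>2) = z + (2 - u) * t * x"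
      unfolding tc by (simp add: algebra_simps power2_eq_square)
    also have "\<dots> \<le> N * (1 + t\<^sup>2) powr (1 - u/2)" by (rule I2[OF tc(1,2)])
    finally have 1: "c\<^sup>2 * (1 + u * t\<^sup>2) \<le> N\<^sup>2" using tc by (intro bern conc)
    define X where "X = t\<^sup>2"
    have X: "0 \<le> X" "X \<le> 1" using tc by (auto simp: X_def power_le_one)
    have "u * (1 + u * X) - u * X - (1 + (u - 1) * X)\<^sup>2 = (u - 1) * ((1 - X) * (1 + (u - 1) * X))"
      by (simp add: power2_eq_square algebra_simps)
    also have "\<dots> \<ge> 0" using X u by (intro mult_nonneg_nonneg add_nonneg_nonneg) auto
    finally have "u * X + (1 + (u - 1) * X)\<^sup>2 \<le> u * (1 + u * X)" by simp
    then have "X + (1 + (u - 1) * X)\<^sup>2 / u \<le> 1 + u * X" using u by (simp add: field_simps)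
    then have "c\<^sup>2 * (X + (1 + (u - 1) * X)\<^sup>2 / u) \<le> c\<^sup>2 * (1 + u * X)" by (intro mult_left_mono) auto
    also have "\<dots> \<le> N\<^sup>2" using 1 by (simp add: X_def)
    also have "c\<^sup>2 * (X + (1 + (u - 1) * X)\<^sup>2 / u) = x\<^sup>2 + z\<^sup>2 / u"
      by (simp only: tc(4,5) X_def power_mult_distrib distrib_left[of "c\<^sup>2"] times_divide_eq_right mult.commute)
    finally show ?thesis .
  qed
  moreover have "z\<^sup>2 / u = p/2 * z\<^sup>2" by (simp add: u_def)
  ultimately have "x\<^sup>2 + p/2 * z\<^sup>2 \<le> N\<^sup>2" by (simp only:)
  then show ?thesis unfolding x_def z_def N_def .
qed

end

subsection \<open>Sums over smooth numbers\<close>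

text \<open>Bounding the exponents as well as the primes gives a finite box, over which sums can be
  split off prime by prime. For a set \<open>P\<close> of primes, \<open>smooth P 1\<close> consists
  of the squarefree products of elements of \<open>P\<close>.\<close>

definition smooth :: "nat set \<Rightarrow> nat \<Rightarrow> nat set" where
  "smooth P J = {n. n > 0 \<and> prime_factors n \<subseteq> P \<and> (\<forall>p\<in>P. multiplicity p n \<le> J)}"

text \<open>The multiplicative function with value \<open>w p j\<close> at \<open>p ^ j\<close> for
  \<open>j > 0\<close>. At 0 it is the empty product 1; in the series with factor
  \<open>n powr t\<close> that term is annihilated by \<open>0 powr t = 0\<close>.\<close>

definition mult_fun :: "(nat \<Rightarrow> nat \<Rightarrow> 'a) \<Rightarrow> nat \<Rightarrow> 'a::comm_monoid_mult" where
  "mult_fun w n = (\<Prod>p\<in>prime_factors n. w p (multiplicity p n))"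

definition chi :: "(nat \<Rightarrow> complex) \<Rightarrow> nat \<Rightarrow> complex" where
  "chi z n = prod_mset (image_mset z (prime_factorization n))"

lemma smooth_empty[simp]: "smooth {} J = {1}"
  by (auto simp: smooth_def prime_factorization_empty_iff)

lemma smooth_pos: "n \<in> smooth P J \<Longrightarrow> n > 0"
  by (simp add: smooth_def)

lemma smooth_not_dvd: "n \<in> smooth P J \<Longrightarrow> prime p \<Longrightarrow> p \<notin> P \<Longrightarrow> \<not> p dvd n"
  by (auto simp: smooth_def prime_factors_dvd)

lemma prime_power_mult:
  assumes "prime p" "\<not> p dvd m" "m > 0"
  shows "multiplicity p (p ^ j * m) = j"
    and "prime q \<Longrightarrow> q \<noteq> p \<Longrightarrow> multiplicity q (p ^ j * m) = multiplicity q m"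
    and "prime_factors (p ^ j * m) = (if j = 0 then prime_factors m else insert p (prime_factors m))"
proof -
  have "m \<noteq> 0" "p \<noteq> 0" using assms by auto
  show "multiplicity p (p ^ j * m) = j"
    using assms by (subst prime_elem_multiplicity_mult_distrib)
      (auto simp: not_dvd_imp_multiplicity_0 prime_gt_0_nat)
  show "multiplicity q (p ^ j * m) = multiplicity q m" if "prime q" "q \<noteq> p"
    using assms that by (subst prime_elem_multiplicity_mult_distrib)
      (auto simp: prime_gt_0_nat multiplicity_distinct_prime_power)
  show "prime_factors (p ^ j * m) = (if j = 0 then prime_factors m else insert p (prime_factors m))"
    using assms by (subst prime_factors_product)
     (auto simp: prime_factorization_prime_power prime_gt_0_nat)
qed

lemma smooth_insert_bij:
  assumes p: "prime p" "p \<notin> P" and P: "\<And>q. q \<in> P \<Longrightarrow> prime q"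
  shows "bij_betw (\<lambda>(j,m). p ^ j * m) ({..J} \<times> smooth P J) (smooth (insert p P) J)"
proof (rule bij_betwI[where g = "\<lambda>n. (multiplicity p n, n div p ^ multiplicity p n)"])
  show "(\<lambda>(j, m). p ^ j * m) \<in> {..J} \<times> smooth P J \<rightarrow> smooth (insert p P) J"
  proof safe
    fix j m assume jm: "j \<le> J" "m \<in> smooth P J"
    have m: "\<not> p dvd m" "m > 0" using jm p by (auto simp: smooth_not_dvd smooth_pos)
    have "multiplicity q (p ^ j * m) \<le> J" if "q \<in> insert p P" for q
      using that jm p P prime_power_mult[OF p(1) m] by (cases "q = p") (auto simp: smooth_def)
    moreover have "prime_factors (p ^ j * m) \<subseteq> insert p P"
      using prime_power_mult(3)[OF p(1) m] jm by (auto simp: smooth_def)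
    moreover have "p ^ j * m > 0" using m p by (auto simp: prime_gt_0_nat)
    ultimately show "p ^ j * m \<in> smooth (insert p P) J" by (auto simp: smooth_def)
  qed
  show "(\<lambda>n. (multiplicity p n, n div p ^ multiplicity p n)) \<in> smooth (insert p P) J \<rightarrow> {..J} \<times> smooth P J"
  proof
    fix n assume n: "n \<in> smooth (insert p P) J"
    then have n0: "n > 0" by (rule smooth_pos)
    obtain y where y: "n = p ^ multiplicity p n * y" "\<not> p dvd y"
      using n0 p by (metis multiplicity_decompose' not_prime_unit less_numeral_extra(3))
    define j where "j = multiplicity p n"
    have n': "n = p ^ j * y" using y by (simp add: j_def)
    have y0: "y > 0" using n0 n' by (auto intro: Nat.gr0I)
    have "n div p ^ j = y" using n' p by (simp add: prime_gt_0_nat)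
    moreover have "j \<le> J" using n by (simp add: smooth_def j_def)
    moreover have "y \<in> smooth P J"
      unfolding smooth_def
    proof (intro CollectI conjI ballI y0)
      show "prime_factors y \<subseteq> P"
      proof
        fix q assume q: "q \<in> prime_factors y"
        then have "q \<noteq> p" using y by auto
        moreover have "q \<in> prime_factors n" unfolding n' using prime_power_mult(3)[OF p(1) y(2) y0, of j] q by auto
        ultimately show "q \<in> P" using n by (auto simp: smooth_def)
      qed
      fix q assume q: "q \<in> P"
      then have "multiplicity q y = multiplicity q n"
        unfolding n' using prime_power_mult(2)[OF p(1) y(2) y0, of q j] p P by metis
      then show "multiplicity q y \<le> J" using n q by (simp add: smooth_def)
    qed
    ultimately show "(multiplicity p n, n div p ^ multiplicity p n) \<in> {..J} \<times> smooth P J"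
      by (simp add: j_def)
  qed
  fix jm assume "jm \<in> {..J} \<times> smooth P J"
  then obtain j m where jm: "jm = (j, m)" "m \<in> smooth P J" by auto
  have m: "\<not> p dvd m" "m > 0" using jm p by (auto simp: smooth_not_dvd smooth_pos)
  show "(\<lambda>n. (multiplicity p n, n div p ^ multiplicity p n)) ((\<lambda>(j, m). p ^ j * m) jm) = jm"
    using prime_power_mult(1)[OF p(1) m, of j] p by (simp add: jm prime_gt_0_nat)
next
  fix n assume "n \<in> smooth (insert p P) J"
  show "(\<lambda>(j, m). p ^ j * m) ((\<lambda>n. (multiplicity p n, n div p ^ multiplicity p n)) n) = n"
    by (simp add: multiplicity_dvd)
qed

lemma sum_smooth_insert:
  assumes p: "prime p" "p \<notin> P" and P: "\<And>q. q \<in> P \<Longrightarrow> prime q"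
  shows "(\<Sum>n\<in>smooth (insert p P) J. f n) = (\<Sum>j\<le>J. \<Sum>m\<in>smooth P J. f (p ^ j * m))"
  using sum.reindex_bij_betw[OF smooth_insert_bij[OF assms, of J], of f]
  by (simp add: sum.cartesian_product case_prod_unfold)

lemma finite_smooth:
  assumes "finite P" "\<And>q. q \<in> P \<Longrightarrow> prime q"
  shows "finite (smooth P J)"
  using assms
proof (induction P)
  case (insert p P)
  then show ?case using bij_betw_finite[OF smooth_insert_bij[of p P J]] by auto
qed simp

lemma multiplicity_less: "n > 0 \<Longrightarrow> multiplicity p n < n" if "prime p" for p n :: nat
proof -
  assume n: "n > 0"
  have "multiplicity p n < 2 ^ multiplicity p n" by (rule less_exp)
  also have "\<dots> \<le> p ^ multiplicity p n" using that by (intro power_mono) (auto simp: prime_ge_2_nat)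
  also have "\<dots> \<le> n" using n by (intro dvd_imp_le multiplicity_dvd)
  finally show ?thesis .
qed

lemma atLeastAtMost_subset_smooth: "{1..N} \<subseteq> smooth {p. prime p \<and> p \<le> N} N"
proof
  fix n assume n: "n \<in> {1..N}"
  then have "multiplicity p n \<le> N" if "prime p" for p
    using multiplicity_less[OF that, of n] by simp
  moreover have "p \<le> N" if "p \<in> prime_factors n" for p
    using that n dvd_imp_le[of p n] by (auto simp: prime_factors_dvd)
  ultimately show "n \<in> smooth {p. prime p \<and> p \<le> N} N" using n by (auto simp: smooth_def)
qed

lemma mult_fun_1[simp]: "mult_fun w (Suc 0) = 1"
  by (simp add: mult_fun_def)

lemma mult_fun_prime_power:
  assumes p: "prime p" "\<not> p dvd m" "m > 0" and w: "w p 0 = 1"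
  shows "mult_fun w (p ^ j * m) = w p j * mult_fun w m"
proof -
  have "p \<notin> prime_factors m" using p by (auto simp: prime_factors_dvd)
  moreover have "(\<Prod>q\<in>prime_factors m. w q (multiplicity q (p ^ j * m))) = (\<Prod>q\<in>prime_factors m. w q (multiplicity q m))"
  proof (intro prod.cong refl)
    fix q assume "q \<in> prime_factors m"
    moreover from this have "q \<noteq> p" using p by (auto simp: prime_factors_dvd)
    ultimately show "w q (multiplicity q (p ^ j * m)) = w q (multiplicity q m)"
      using prime_power_mult(2)[OF p, of q j] p by (auto simp: prime_factors_dvd)
  qed
  ultimately show ?thesis
    unfolding mult_fun_def prime_power_mult(3)[OF p] using prime_power_mult(1)[OF p, of j] w by auto
qed

lemma mult_fun_nonneg:
  fixes w :: "nat \<Rightarrow> nat \<Rightarrow> real"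
  assumes "\<And>p j. prime p \<Longrightarrow> w p j \<ge> 0" shows "mult_fun w n \<ge> 0"
  unfolding mult_fun_def using assms by (intro prod_nonneg) (auto simp: prime_factors_dvd)

lemma sum_mult_fun_smooth:
  fixes w :: "nat \<Rightarrow> nat \<Rightarrow> real"
  assumes "finite P" "\<And>q. q \<in> P \<Longrightarrow> prime q" "\<And>q. q \<in> P \<Longrightarrow> w q 0 = 1"
  shows "(\<Sum>n\<in>smooth P J. mult_fun w n * real n powr t) = (\<Prod>p\<in>P. \<Sum>j\<le>J. w p j * (real p powr t) ^ j)"
  using assms
proof (induction P)
  case (insert p P)
  have pp: "prime p" using insert by auto
  have "(\<Sum>n\<in>smooth (insert p P) J. mult_fun w n * real n powr t) = (\<Sum>j\<le>J. \<Sum>m\<in>smooth P J. (w p j * (real p powr t) ^ j) * (mult_fun w m * real m powr t))"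
  proof (subst sum_smooth_insert, goal_cases)
    case 4
    show ?case
    proof (intro sum.cong refl)
      fix j m assume m: "m \<in> smooth P J"
      have "mult_fun w (p ^ j * m) = w p j * mult_fun w m"
        using m insert pp by (intro mult_fun_prime_power) (auto simp: smooth_not_dvd smooth_pos)
      moreover have "real (p ^ j * m) powr t = (real p powr t) ^ j * real m powr t"
        using pp by (simp add: powr_mult powr_power prime_gt_0_nat powr_powr mult.commute flip: powr_realpow)
      ultimately show "mult_fun w (p ^ j * m) * real (p ^ j * m) powr t = (w p j * (real p powr t) ^ j) * (mult_fun w m * real m powr t)"
        by simp
    qed
  qed (use insert in auto)
  also have "\<dots> = (\<Sum>j\<le>J. w p j * (real p powr t) ^ j) * (\<Sum>m\<in>smooth P J. mult_fun w m * real m powr t)"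
    by (simp add: sum_product)
  finally show ?case using insert by simp
qed (simp add: mult_fun_def)

lemma chi_1[simp]: "chi z (Suc 0) = 1"
  by (simp add: chi_def)

lemma chi_mult: "m > 0 \<Longrightarrow> n > 0 \<Longrightarrow> chi z (m * n) = chi z m * chi z n"
  by (simp add: chi_def prime_factorization_mult)

lemma chi_prime_power: "prime p \<Longrightarrow> chi z (p ^ j) = z p ^ j"
  by (simp add: chi_def prime_factorization_prime_power)

lemma chi_prime_power_mult: "prime p \<Longrightarrow> m > 0 \<Longrightarrow> chi z (p ^ j * m) = z p ^ j * chi z m"
  by (simp add: chi_mult chi_prime_power prime_gt_0_nat)

lemma chi_cong: "(\<And>p. p \<in> prime_factors n \<Longrightarrow> z p = z' p) \<Longrightarrow> chi z n = chi z' n"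
  unfolding chi_def by (intro arg_cong[of _ _ prod_mset] image_mset_cong) auto

lemma norm_chi: "(\<And>p. cmod (z p) = 1) \<Longrightarrow> cmod (chi z n) = 1"
proof -
  assume "\<And>p. cmod (z p) = 1"
  then have "cmod (prod_mset (image_mset z M)) = 1" for M by (induction M) (auto simp: norm_mult)
  then show ?thesis by (simp add: chi_def)
qed

lemma chi_prod_form: "chi z n = (\<Prod>p\<in>prime_factors n. z p ^ multiplicity p n)"
  unfolding chi_def image_prod_mset_multiplicity
  by (intro prod.cong refl) (metis count_prime_factorization_prime in_prime_factors_imp_prime)

subsection \<open>Dirichlet polynomials on the infinite torus\<close>

definition torus :: "(nat \<Rightarrow> real) measure" where
  "torus = PiM UNIV (\<lambda>_. circle)"

definition cx :: "(nat \<Rightarrow> real) \<Rightarrow> nat \<Rightarrow> complex" where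
  "cx x n = chi (\<lambda>p. e1 (x p)) n"

lemma prob_space_torus: "prob_space torus"
  unfolding torus_def by (intro prob_space_PiM prob_space_circle)

interpretation torus: prob_space torus
  by (rule prob_space_torus)

lemma torus_component: "(\<lambda>x. x p) \<in> borel_measurable torus"
proof -
  have "(\<lambda>x. x p) \<in> measurable torus circle"
    unfolding torus_def by (rule measurable_component_singleton) simp
  then show ?thesis by (simp add: measurable_cong_sets[OF refl sets_circle])
qed

lemma cx_measurable[measurable]: "(\<lambda>x. cx x n) \<in> borel_measurable torus"
proof -
  note torus_component[measurable]
  show ?thesis unfolding cx_def chi_prod_form by measurable
qed

lemma norm_cx[simp]: "cmod (cx x n) = 1"
  unfolding cx_def by (rule norm_chi) simp

lemma bdd_measurable_cx[simp]: "bdd_measurable torus (\<lambda>x. cx x n)"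
  by (rule bdd_measurableI[of _ _ 1]) auto

lemma cx_upd_other: "prime p \<Longrightarrow> \<not> p dvd n \<Longrightarrow> cx (x(p := y)) n = cx x n"
  unfolding cx_def by (rule chi_cong) (auto simp: prime_factors_dvd)

lemma cx_upd: "prime p \<Longrightarrow> \<not> p dvd n \<Longrightarrow> n > 0 \<Longrightarrow> cx (x(p := y)) (p ^ j * n) = e1 y ^ j * cx x n"
  using cx_upd_other[of p n x y] by (simp add: cx_def chi_prime_power_mult)

lemma cx_mult: "m > 0 \<Longrightarrow> n > 0 \<Longrightarrow> cx x (m * n) = cx x m * cx x n"
  by (simp add: cx_def chi_mult)

lemma torus_upd_measurable: "(\<lambda>(y, x). x(p := y)) \<in> measurable (circle \<Otimes>\<^sub>M torus) torus"
proof -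
  have "(\<lambda>(y, x). x(p := y)) \<in> measurable (circle \<Otimes>\<^sub>M torus) (PiM (insert p UNIV) (\<lambda>_. circle))"
    unfolding torus_def by measurable
  then show ?thesis by (simp add: torus_def)
qed

lemma torus_distr: "distr (circle \<Otimes>\<^sub>M torus) torus (\<lambda>(y, x). x(p := y)) = torus"
  using distr_pair_PiM_eq_PiM[of UNIV "\<lambda>_. circle" p] prob_space_circle by (simp add: torus_def)

text \<open>Redrawing one coordinate independently preserves the product measure. Combined with
  Fubini's theorem this isolates the variable of a single prime while the outer integral is still
  over the whole torus.\<close>

lemma torus_resample:
  fixes f :: "(nat \<Rightarrow> real) \<Rightarrow> 'b::{banach,second_countable_topology}"
  assumes f: "bdd_measurable torus f"
  shows "(\<integral>x. f x \<partial>torus) = (\<integral>x. (\<integral>y. f (x(p := y)) \<partial>circle) \<partial>torus)"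
    and "bdd_measurable torus (\<lambda>x. (\<integral>y. f (x(p := y)) \<partial>circle))"
proof -
  interpret P: pair_prob_space circle torus ..
  obtain B where B: "\<And>x. norm (f x) \<le> B" using f by (auto simp: bdd_measurable_def)
  have fm: "f \<in> borel_measurable torus" using f by (simp add: bdd_measurable_def)
  have m: "(\<lambda>(y, x). f (x(p := y))) \<in> borel_measurable (circle \<Otimes>\<^sub>M torus)"
    using measurable_compose[OF torus_upd_measurable[of p] fm] by (simp add: case_prod_unfold)
  have int: "integrable (circle \<Otimes>\<^sub>M torus) (\<lambda>(y, x). f (x(p := y)))"
    by (rule P.integrable_const_bound[of _ B]) (use m B in auto)
  have "(\<integral>x. f x \<partial>torus) = (\<integral>x. f x \<partial>distr (circle \<Otimes>\<^sub>M torus) torus (\<lambda>(y, x). x(p := y)))"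
    by (simp add: torus_distr)
  also have "\<dots> = (\<integral>z. f ((\<lambda>(y, x). x(p := y)) z) \<partial>(circle \<Otimes>\<^sub>M torus))"
    by (rule integral_distr[OF torus_upd_measurable fm])
  also have "\<dots> = (\<integral>(y, x). f (x(p := y)) \<partial>(circle \<Otimes>\<^sub>M torus))" by (simp add: case_prod_unfold)
  also have "\<dots> = (\<integral>x. (\<integral>y. f (x(p := y)) \<partial>circle) \<partial>torus)"
    using P.integral_snd[OF int] by simp
  finally show "(\<integral>x. f x \<partial>torus) = (\<integral>x. (\<integral>y. f (x(p := y)) \<partial>circle) \<partial>torus)" .
  have sm: "(\<lambda>y. f (x(p := y))) \<in> borel_measurable circle" for x
  proof -
    have "(\<lambda>y. (y, x)) \<in> measurable circle (circle \<Otimes>\<^sub>M torus)"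
      by (rule measurable_Pair2') (simp add: torus_def space_PiM)
    from measurable_compose[OF this m] show ?thesis by simp
  qed
  show "bdd_measurable torus (\<lambda>x. (\<integral>y. f (x(p := y)) \<partial>circle))"
  proof (rule bdd_measurableI)
    have "(\<lambda>(x, y). f (x(p := y))) \<in> borel_measurable (torus \<Otimes>\<^sub>M circle)"
      using measurable_compose[OF measurable_pair_swap' m] by (simp add: case_prod_unfold)
    then show "(\<lambda>x. (\<integral>y. f (x(p := y)) \<partial>circle)) \<in> borel_measurable torus"
      by (rule circle.borel_measurable_lebesgue_integral)
    show "norm (\<integral>y. f (x(p := y)) \<partial>circle) \<le> B" for x
    proof -
      have "bdd_measurable circle (\<lambda>y. f (x(p := y)))" using sm B by (intro bdd_measurableI) auto
      then have "(\<integral>y. norm (f (x(p := y))) \<partial>circle) \<le> B"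
        by (intro circle.integral_le_const circle.bdd_measurable_integrable bdd_measurable_norm) (auto simp: B)
      then show ?thesis by (rule order_trans[OF integral_norm_bound])
    qed
  qed
qed

lemma prime_power_decompose:
  assumes "n > 0" "prime p"
  obtains n' :: nat where "n = p ^ multiplicity p n * n'" "\<not> p dvd n'" "n' > 0"
proof -
  have "n \<noteq> 0" "\<not> is_unit p" using assms by auto
  then obtain y where "n = p ^ multiplicity p n * y" "\<not> p dvd y" by (rule multiplicity_decompose')
  with that show ?thesis by (metis dvd_0_right gr0I)
qed

text \<open>Distinct integers differ in the exponent of some prime, and redrawing that coordinate
  leaves the integral of \<open>e1 y ^ a * cnj (e1 y) ^ b\<close> with
  \<open>a \<noteq> b\<close>.\<close>

lemma cx_orth:
  assumes "m > 0" "n > 0"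
  shows "(\<integral>x. cx x m * cnj (cx x n) \<partial>torus) = (if m = n then 1 else 0)"
proof (cases "m = n")
  case True
  have "cx x n * cnj (cx x n) = 1" for x by (simp add: complex_norm_square[symmetric])
  then show ?thesis using True torus.prob_space by simp
next
  case False
  then obtain p where p: "prime p" "multiplicity p m \<noteq> multiplicity p n"
    using multiplicity_eq_nat assms by blast
  define a b where "a = multiplicity p m" and "b = multiplicity p n"
  have ab: "a \<noteq> b" using p by (simp add: a_def b_def)
  obtain m' where m: "m = p ^ a * m'" "\<not> p dvd m'" "m' > 0"
    using prime_power_decompose[OF assms(1) p(1)] unfolding a_def by metis
  obtain n' where n: "n = p ^ b * n'" "\<not> p dvd n'" "n' > 0"
    using prime_power_decompose[OF assms(2) p(1)] unfolding b_def by metis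
  have "(\<integral>x. cx x m * cnj (cx x n) \<partial>torus) = (\<integral>x. (\<integral>y. cx (x(p := y)) m * cnj (cx (x(p := y)) n) \<partial>circle) \<partial>torus)"
    by (rule torus_resample) (auto intro!: bdd_measurable_intros)
  also have "\<dots> = (\<integral>x. (\<integral>y. (cx x m' * cnj (cx x n')) * (e1 y ^ a * cnj (e1 y) ^ b) \<partial>circle) \<partial>torus)"
  proof (intro Bochner_Integration.integral_cong refl)
    fix x y
    have "cx (x(p := y)) m = e1 y ^ a * cx x m'" unfolding m(1) using p m(2,3) by (intro cx_upd)
    moreover have "cx (x(p := y)) n = e1 y ^ b * cx x n'" unfolding n(1) using p n(2,3) by (intro cx_upd)
    ultimately show "cx (x(p := y)) m * cnj (cx (x(p := y)) n) = (cx x m' * cnj (cx x n')) * (e1 y ^ a * cnj (e1 y) ^ b)"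
      by simp
  qed
  also have "\<dots> = 0" using ab by (simp add: integral_e1)
  finally show ?thesis using False by simp
qed

section \<open>Dirichlet polynomials and tensorization over the primes\<close>

definition dirichlet_poly :: "(nat \<Rightarrow> complex) \<Rightarrow> nat set \<Rightarrow> (nat \<Rightarrow> real) \<Rightarrow> complex" where
  "dirichlet_poly c S x = (\<Sum>n\<in>S. c n * cx x n)"

lemma bdd_measurable_dirichlet_poly[simp]: "bdd_measurable torus (dirichlet_poly c S)"
  unfolding dirichlet_poly_def by (intro bdd_measurable_intros bdd_measurable_cx)

lemma dirichlet_poly_smooth_upd:
  assumes "prime p" "p \<notin> P" "\<And>q. q \<in> P \<Longrightarrow> prime q"
  shows "dirichlet_poly c (smooth (insert p P) J) (x(p := y)) = (\<Sum>j\<le>J. dirichlet_poly (\<lambda>m. c (p ^ j * m)) (smooth P J) x * e1 y ^ j)"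
proof -
  have "dirichlet_poly c (smooth (insert p P) J) (x(p := y)) = (\<Sum>j\<le>J. \<Sum>m\<in>smooth P J. c (p ^ j * m) * cx (x(p := y)) (p ^ j * m))"
    unfolding dirichlet_poly_def using assms by (intro sum_smooth_insert) auto
  also have "\<dots> = (\<Sum>j\<le>J. \<Sum>m\<in>smooth P J. c (p ^ j * m) * cx x m * e1 y ^ j)"
    using assms by (intro sum.cong refl) (simp add: cx_upd smooth_not_dvd smooth_pos)
  finally show ?thesis by (simp only: dirichlet_poly_def sum_distrib_right)
qed

lemma Lnorm_torus_upd:
  assumes r: "r > 0" and f: "bdd_measurable torus f"
  shows "(\<integral>x. norm (f x) powr r \<partial>torus) = (\<integral>x. Lnorm circle r (\<lambda>y. f (x(p := y))) powr r \<partial>torus)"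
    and "bdd_measurable torus (\<lambda>x. Lnorm circle r (\<lambda>y. f (x(p := y))) powr r)"
  using torus_resample[OF bdd_measurable_powr[OF f, of r], of p] r by (simp_all add: circle.Lnorm_powr)

text \<open>Induction over the primes. With the other coordinates frozen, the one-variable
  hypothesis bounds the squared inner norm by the weighted sum \<open>H\<close> of the
  \<open>\<bar>G j\<bar>\<^sup>2\<close>. The outer norm of \<open>H\<close> is then taken in
  \<open>L\<^sup>k\<close>, where Minkowski's inequality applies since
  \<open>k \<ge> 1\<close>.\<close>

theorem tensor_upper:
  fixes W :: "nat \<Rightarrow> nat \<Rightarrow> real"
  assumes k: "k \<ge> 1" and P: "finite P" "\<And>q. q \<in> P \<Longrightarrow> prime q"
    and W0: "\<And>q. q \<in> P \<Longrightarrow> W q 0 = 1" and Wn: "\<And>q j. q \<in> P \<Longrightarrow> W q j \<ge> 0"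
    and W: "\<And>q a. q \<in> P \<Longrightarrow> (Lnorm circle (2 * k) (\<lambda>y. \<Sum>j\<le>J. a j * e1 y ^ j))\<^sup>2 \<le> (\<Sum>j\<le>J. W q j * (cmod (a j))\<^sup>2)"
  shows "(Lnorm torus (2 * k) (dirichlet_poly c (smooth P J)))\<^sup>2 \<le> (\<Sum>n\<in>smooth P J. mult_fun W n * (cmod (c n))\<^sup>2)"
  using P W0 Wn W
proof (induction P arbitrary: c)
  case empty
  have "Lnorm torus (2 * k) (dirichlet_poly c (smooth {} J)) \<le> cmod (c 1)"
    using k by (intro torus.Lnorm_le_bound) (auto simp: dirichlet_poly_def norm_mult)
  then show ?case by (auto intro!: power_mono)
next
  case (insert p P)
  define G where "G j = dirichlet_poly (\<lambda>m. c (p ^ j * m)) (smooth P J)" for j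
  have bG: "bdd_measurable torus (G j)" for j by (simp add: G_def)
  define F where "F = dirichlet_poly c (smooth (insert p P) J)"
  define H where "H x = (\<Sum>j\<le>J. W p j * (cmod (G j x))\<^sup>2)" for x
  have Wp: "W p j \<ge> 0" for j using insert.prems by auto
  have H0: "H x \<ge> 0" for x unfolding H_def by (intro sum_nonneg mult_nonneg_nonneg Wp) auto
  have bH: "bdd_measurable torus H" unfolding H_def by (intro bdd_measurable_intros bG)
  have upd: "F (x(p := y)) = (\<Sum>j\<le>J. G j x * e1 y ^ j)" for x y
    unfolding F_def G_def using insert by (intro dirichlet_poly_smooth_upd) auto
  have bF: "bdd_measurable torus F" by (simp add: F_def)
  have "(\<integral>x. cmod (F x) powr (2*k) \<partial>torus) = (\<integral>x. Lnorm circle (2*k) (\<lambda>y. F (x(p := y))) powr (2*k) \<partial>torus)"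
    using k bF by (intro Lnorm_torus_upd) auto
  also have "\<dots> \<le> (\<integral>x. norm (H x) powr k \<partial>torus)"
  proof (intro integral_mono torus.bdd_measurable_integrable Lnorm_torus_upd bF bdd_measurable_powr bH)
    fix x
    have "(Lnorm circle (2*k) (\<lambda>y. F (x(p := y))))\<^sup>2 \<le> H x"
      unfolding upd H_def using insert.prems by auto
    then have "((Lnorm circle (2*k) (\<lambda>y. F (x(p := y))))\<^sup>2) powr k \<le> H x powr k"
      using k by (intro powr_mono2) auto
    also have "((Lnorm circle (2*k) (\<lambda>y. F (x(p := y))))\<^sup>2) powr k = Lnorm circle (2*k) (\<lambda>y. F (x(p := y))) powr (2*k)"
      by (simp add: powr_powr flip: powr_numeral)
    finally show "Lnorm circle (2*k) (\<lambda>y. F (x(p := y))) powr (2*k) \<le> norm (H x) powr k" using H0[of x] by simp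
  qed (use k in auto)
  finally have le: "(\<integral>x. cmod (F x) powr (2*k) \<partial>torus) \<le> (\<integral>x. norm (H x) powr k \<partial>torus)" .
  have sq: "(Lnorm torus (2*k) f)\<^sup>2 = (\<integral>x. cmod (f x) powr (2*k) \<partial>torus) powr (1/k)" for f :: "_ \<Rightarrow> complex"
    using k by (simp add: Lnorm_def powr_powr flip: powr_numeral)
  have "(Lnorm torus (2*k) F)\<^sup>2 \<le> Lnorm torus k H"
    unfolding sq unfolding Lnorm_def using k le by (intro powr_mono2) auto
  also have "\<dots> \<le> (\<Sum>j\<le>J. Lnorm torus k (\<lambda>x. W p j * (cmod (G j x))\<^sup>2))"
    unfolding H_def using k by (intro torus.Minkowski_sum bdd_measurable_intros bG) auto
  also have "\<dots> = (\<Sum>j\<le>J. W p j * (Lnorm torus (2*k) (G j))\<^sup>2)"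
  proof (intro sum.cong refl)
    fix j
    have "Lnorm torus k (\<lambda>x. W p j * (cmod (G j x))\<^sup>2) = W p j * Lnorm torus k (\<lambda>x. (cmod (G j x))\<^sup>2)"
      using k Wp by (subst torus.Lnorm_cmult) auto
    also have "Lnorm torus k (\<lambda>x. (cmod (G j x))\<^sup>2) = (Lnorm torus (2*k) (G j))\<^sup>2"
      unfolding sq unfolding Lnorm_def by (simp add: powr_powr flip: powr_numeral)
    finally show "Lnorm torus k (\<lambda>x. W p j * (cmod (G j x))\<^sup>2) = W p j * (Lnorm torus (2*k) (G j))\<^sup>2" .
  qed
  also have "\<dots> \<le> (\<Sum>j\<le>J. W p j * (\<Sum>m\<in>smooth P J. mult_fun W m * (cmod (c (p ^ j * m)))\<^sup>2))"
    unfolding G_def using insert.prems by (intro sum_mono mult_left_mono insert.IH Wp) auto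
  also have "\<dots> = (\<Sum>j\<le>J. \<Sum>m\<in>smooth P J. mult_fun W (p ^ j * m) * (cmod (c (p ^ j * m)))\<^sup>2)"
    unfolding sum_distrib_left using insert
    by (intro sum.cong refl) (auto simp: mult_fun_prime_power smooth_not_dvd smooth_pos)
  also have "\<dots> = (\<Sum>n\<in>smooth (insert p P) J. mult_fun W n * (cmod (c n))\<^sup>2)"
    using insert by (intro sum_smooth_insert[symmetric]) auto
  finally show ?case by (simp add: F_def)
qed

text \<open>Here the outer exponent is \<open>q/2 \<le> 1\<close>, so the summands are recombined by
  the reverse Minkowski inequality. It handles two summands, matching the exponents 0 and 1 that the
  one-variable estimate retains for each prime; hence the sum over squarefree numbers on the
  left.\<close>

theorem tensor_lower:
  assumes q: "1 \<le> q" "q \<le> 2" and J: "J \<ge> 1" and P: "finite P" "\<And>p. p \<in> P \<Longrightarrow> prime p"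
  shows "(\<Sum>n\<in>smooth P 1. mult_fun (\<lambda>p j. (q/2) ^ j) n * (cmod (c n))\<^sup>2) \<le> (Lnorm torus q (dirichlet_poly c (smooth P J)))\<^sup>2"
  using P
proof (induction P arbitrary: c)
  case empty
  have "Lnorm torus q (dirichlet_poly c (smooth {} J)) = cmod (c 1)"
    using q torus.prob_space by (simp add: dirichlet_poly_def Lnorm_def norm_mult powr_powr)
  then show ?case by simp
next
  case (insert p P)
  define G where "G j = dirichlet_poly (\<lambda>m. c (p ^ j * m)) (smooth P J)" for j
  have bG: "bdd_measurable torus (G j)" for j by (simp add: G_def)
  define F where "F = dirichlet_poly c (smooth (insert p P) J)"
  define H where "H x = (cmod (G 0 x))\<^sup>2 + q/2 * (cmod (G 1 x))\<^sup>2" for x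
  have H0: "H x \<ge> 0" for x unfolding H_def using q by auto
  have bH: "bdd_measurable torus H" unfolding H_def by (intro bdd_measurable_intros bG)
  have upd: "F (x(p := y)) = (\<Sum>j\<le>J. G j x * e1 y ^ j)" for x y
    unfolding F_def G_def using insert by (intro dirichlet_poly_smooth_upd) auto
  have bF: "bdd_measurable torus F" by (simp add: F_def)
  have "(\<integral>x. H x powr (q/2) \<partial>torus) \<le> (\<integral>x. Lnorm circle q (\<lambda>y. F (x(p := y))) powr q \<partial>torus)"
  proof (intro integral_mono torus.bdd_measurable_integrable Lnorm_torus_upd bF bdd_measurable_powr' bH H0)
    fix x
    have "H x \<le> (Lnorm circle q (\<lambda>y. F (x(p := y))))\<^sup>2"
      unfolding upd H_def using circle.polynomial_norm_ge[OF q J, of "\<lambda>j. G j x"] .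
    then have "H x powr (q/2) \<le> ((Lnorm circle q (\<lambda>y. F (x(p := y))))\<^sup>2) powr (q/2)"
      using q H0 by (intro powr_mono2) auto
    also have "\<dots> = Lnorm circle q (\<lambda>y. F (x(p := y))) powr q"
      by (simp add: powr_powr flip: powr_numeral)
    finally show "H x powr (q/2) \<le> Lnorm circle q (\<lambda>y. F (x(p := y))) powr q" .
  qed (use q in auto)
  also have "\<dots> = (\<integral>x. cmod (F x) powr q \<partial>torus)"
    using q bF by (intro Lnorm_torus_upd(1)[symmetric]) auto
  finally have le: "(\<integral>x. H x powr (q/2) \<partial>torus) \<le> (\<integral>x. cmod (F x) powr q \<partial>torus)" .
  have "(\<Sum>n\<in>smooth (insert p P) 1. mult_fun (\<lambda>p j. (q/2) ^ j) n * (cmod (c n))\<^sup>2)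
     = (\<Sum>j\<le>1. \<Sum>m\<in>smooth P 1. mult_fun (\<lambda>p j. (q/2) ^ j) (p ^ j * m) * (cmod (c (p ^ j * m)))\<^sup>2)"
    using insert by (intro sum_smooth_insert) auto
  also have "\<dots> = (\<Sum>j\<le>1. (q/2) ^ j * (\<Sum>m\<in>smooth P 1. mult_fun (\<lambda>p j. (q/2) ^ j) m * (cmod (c (p ^ j * m)))\<^sup>2))"
    unfolding sum_distrib_left using insert
    by (intro sum.cong refl) (auto simp: mult_fun_prime_power smooth_not_dvd smooth_pos)
  also have "\<dots> \<le> (\<Sum>j\<le>1. (q/2) ^ j * (Lnorm torus q (G j))\<^sup>2)"
    unfolding G_def using q insert by (intro sum_mono mult_left_mono insert.IH) auto
  also have "\<dots> = (Lnorm torus q (G 0))\<^sup>2 + q/2 * (Lnorm torus q (G 1))\<^sup>2" by simp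
  also have "\<dots> \<le> (\<integral>x. ((cmod (G 0 x))\<^sup>2 + q/2 * (cmod (G 1 x))\<^sup>2) powr (q/2) \<partial>torus) powr (2/q)"
    using q by (intro torus.reverse_Minkowski_two bG) auto
  also have "\<dots> \<le> (\<integral>x. cmod (F x) powr q \<partial>torus) powr (2/q)"
    using q le by (intro powr_mono2) (auto simp: H_def)
  also have "\<dots> = (Lnorm torus q F)\<^sup>2" by (simp add: Lnorm_def powr_powr flip: powr_numeral)
  finally show ?case by (simp add: F_def)
qed

lemma dirichlet_polynomial_mult:
  fixes c d :: "nat \<Rightarrow> complex"
  assumes "finite S" "finite T" "0 \<notin> S" "0 \<notin> T"
  shows "\<exists>U b. finite U \<and> 0 \<notin> U \<and> (\<forall>\<psi>. (\<forall>m>0. \<forall>n>0. \<psi> (m * n) = \<psi> m * \<psi> n) \<longrightarrow>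
     (\<Sum>m\<in>S. c m * \<psi> m) * (\<Sum>n\<in>T. d n * \<psi> n) = (\<Sum>l\<in>U. b l * \<psi> l))"
proof -
  define h where "h = (\<lambda>(m, n). m * n :: nat)"
  define U where "U = h ` (S \<times> T)"
  define b where "b l = (\<Sum>x\<in>{x\<in>S \<times> T. h x = l}. c (fst x) * d (snd x))" for l
  have fin: "finite (S \<times> T)" using assms by simp
  have "(\<Sum>m\<in>S. c m * \<psi> m) * (\<Sum>n\<in>T. d n * \<psi> n) = (\<Sum>l\<in>U. b l * \<psi> l)"
    if \<psi>: "\<forall>m>0. \<forall>n>0. \<psi> (m * n) = \<psi> m * \<psi> n" for \<psi>
  proof -
    have "(\<Sum>m\<in>S. c m * \<psi> m) * (\<Sum>n\<in>T. d n * \<psi> n) = (\<Sum>x\<in>S \<times> T. c (fst x) * d (snd x) * \<psi> (h x))"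
      unfolding sum_product sum.cartesian_product
    proof (intro sum.cong refl)
      fix x assume x: "x \<in> S \<times> T"
      then have "fst x > 0" "snd x > 0" using assms by (auto intro: Nat.gr0I)
      then show "(case x of (i, j) \<Rightarrow> c i * \<psi> i * (d j * \<psi> j)) = c (fst x) * d (snd x) * \<psi> (h x)"
        using \<psi> by (simp add: h_def case_prod_unfold mult_ac)
    qed
    also have "\<dots> = (\<Sum>l\<in>U. \<Sum>x\<in>{x\<in>S \<times> T. h x = l}. c (fst x) * d (snd x) * \<psi> (h x))"
      unfolding U_def by (rule sum.image_gen[OF fin])
    also have "\<dots> = (\<Sum>l\<in>U. b l * \<psi> l)"
      unfolding b_def sum_distrib_right by (intro sum.cong refl) auto
    finally show ?thesis .
  qed
  moreover have "finite U" "0 \<notin> U" using assms by (auto simp: U_def h_def)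
  ultimately show ?thesis by blast
qed

text \<open>The set \<open>U\<close> and the coefficients \<open>b\<close> are chosen before
  \<open>\<psi>\<close>. The same expansion therefore holds for the functions
  \<open>nat_powr_it t\<close> on the line and \<open>cx x\<close> on the torus, which is what
  allows even moments to be transferred.\<close>

lemma dirichlet_polynomial_power:
  fixes c :: "nat \<Rightarrow> complex"
  assumes "finite S" "0 \<notin> S"
  shows "\<exists>U b. finite U \<and> 0 \<notin> U \<and> (\<forall>\<psi>. \<psi> (Suc 0) = 1 \<longrightarrow> (\<forall>m>0. \<forall>n>0. \<psi> (m * n) = \<psi> m * \<psi> n) \<longrightarrow>
     (\<Sum>m\<in>S. c m * \<psi> m) ^ j = (\<Sum>l\<in>U. b l * \<psi> l))"
proof (induction j)
  case 0
  show ?case by (rule exI[of _ "{1}"], rule exI[of _ "\<lambda>_. 1"]) auto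
next
  case (Suc j)
  then obtain U b where U: "finite U" "0 \<notin> U" "\<And>\<psi>. \<psi> (Suc 0) = 1 \<Longrightarrow> (\<forall>m>0. \<forall>n>0. \<psi> (m * n) = \<psi> m * \<psi> n) \<Longrightarrow>
     (\<Sum>m\<in>S. c m * \<psi> m) ^ j = (\<Sum>l\<in>U. b l * \<psi> l)" by blast
  obtain V d where V: "finite V" "0 \<notin> V" "\<And>\<psi>. \<forall>m>0. \<forall>n>0. \<psi> (m * n) = \<psi> m * \<psi> n \<Longrightarrow>
     (\<Sum>m\<in>S. c m * \<psi> m) * (\<Sum>n\<in>U. b n * \<psi> n) = (\<Sum>l\<in>V. d l * \<psi> l)"
    using dirichlet_polynomial_mult[OF assms(1) U(1) assms(2) U(2), of c b] by blast
  show ?case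
  proof (rule exI[of _ V], rule exI[of _ d], intro conjI allI impI V)
    fix \<psi> :: "nat \<Rightarrow> complex"
    assume a: "\<psi> (Suc 0) = 1" "\<forall>m>0. \<forall>n>0. \<psi> (m * n) = \<psi> m * \<psi> n"
    show "(\<Sum>m\<in>S. c m * \<psi> m) ^ Suc j = (\<Sum>l\<in>V. d l * \<psi> l)"
      by (simp only: power_Suc U(3)[OF a] V(3)[OF a(2)])
  qed
qed

subsection \<open>Pseudomoments as norms on the torus\<close>

definition nat_powr_it :: "real \<Rightarrow> nat \<Rightarrow> complex" where
  "nat_powr_it t n = cis (- t * ln (real n))"

lemma nat_powr_it_mult: "m > 0 \<Longrightarrow> n > 0 \<Longrightarrow> nat_powr_it t (m * n) = nat_powr_it t m * nat_powr_it t n"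
  by (simp add: nat_powr_it_def cis_mult ln_mult algebra_simps)

lemma nat_powr_it_1[simp]: "nat_powr_it t (Suc 0) = 1"
  by (simp add: nat_powr_it_def)

lemma continuous_on_nat_powr_it: "continuous_on A (\<lambda>t. nat_powr_it t n)"
  unfolding nat_powr_it_def by (intro continuous_intros)

lemma mean_cis:
  assumes w: "\<omega> \<noteq> 0"
  shows "((\<lambda>T::real. 1 / T * integral {0..T} (\<lambda>t. Re (c * cis (\<omega> * t)))) \<longlongrightarrow> 0) at_top"
proof (rule Lim_null_comparison)
  have "\<forall>\<^sub>F T::real in at_top. T > 0" by (rule eventually_gt_at_top)
  then show "\<forall>\<^sub>F T::real in at_top. norm (1 / T * integral {0..T} (\<lambda>t. Re (c * cis (\<omega> * t)))) \<le> 2 * cmod c / \<bar>\<omega>\<bar> * (1 / T)"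
  proof eventually_elim
    case (elim T)
    define F where "F t = Re (c * cis (\<omega> * t) / (\<i> * \<omega>))" for t
    have "((\<lambda>t. Re (c * cis (\<omega> * t))) has_integral (F T - F 0)) {0..T}"
    proof (rule fundamental_theorem_of_calculus)
      show "0 \<le> T" using elim by simp
      fix x assume "x \<in> {0..T}"
      have "((\<lambda>t. c * cis (\<omega> * t) / (\<i> * \<omega>)) has_vector_derivative c * cis (\<omega> * x)) (at x within {0..T})"
        unfolding cis_conv_exp using w
        by (auto intro!: derivative_eq_intros has_vector_derivative_real_field simp: field_simps)
      from bounded_linear.has_vector_derivative[OF bounded_linear_Re this]
      show "(F has_vector_derivative Re (c * cis (\<omega> * x))) (at x within {0..T})" unfolding F_def .
    qed
    then have "integral {0..T} (\<lambda>t. Re (c * cis (\<omega> * t))) = F T - F 0" by (rule integral_unique)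
    moreover have Fb: "\<bar>F t\<bar> \<le> cmod c / \<bar>\<omega>\<bar>" for t
    proof -
      have "\<bar>F t\<bar> \<le> cmod (c * cis (\<omega> * t) / (\<i> * \<omega>))" unfolding F_def by (rule abs_Re_le_cmod)
      also have "\<dots> = cmod c / \<bar>\<omega>\<bar>" by (simp add: norm_mult norm_divide)
      finally show ?thesis .
    qed
    ultimately have "\<bar>integral {0..T} (\<lambda>t. Re (c * cis (\<omega> * t)))\<bar> \<le> 2 * (cmod c / \<bar>\<omega>\<bar>)"
      using Fb[of T] Fb[of 0] by linarith
    then show ?case using elim by (simp add: abs_mult field_simps)
  qed
  have "((\<lambda>T::real. 2 * cmod c / \<bar>\<omega>\<bar> * inverse T) \<longlongrightarrow> 2 * cmod c / \<bar>\<omega>\<bar> * 0) at_top"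
    by (intro tendsto_mult tendsto_const tendsto_inverse_0_at_top filterlim_ident)
  then show "((\<lambda>T::real. 2 * cmod c / \<bar>\<omega>\<bar> * (1 / T)) \<longlongrightarrow> 0) at_top" by (simp add: divide_inverse)
qed

lemma mean_sq_dirichlet_polynomial:
  assumes S: "finite S" "0 \<notin> S"
  shows "((\<lambda>T::real. 1 / T * integral {0..T} (\<lambda>t. (cmod (\<Sum>n\<in>S. b n * nat_powr_it t n))\<^sup>2)) \<longlongrightarrow> (\<Sum>n\<in>S. (cmod (b n))\<^sup>2)) at_top"
proof -
  define g where "g m n t = Re (b m * cnj (b n) * cis ((ln (real n) - ln (real m)) * t))" for m n t
  have sq: "(cmod (\<Sum>n\<in>S. b n * nat_powr_it t n))\<^sup>2 = (\<Sum>m\<in>S. \<Sum>n\<in>S. g m n t)" for t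
  proof -
    have "complex_of_real ((cmod (\<Sum>n\<in>S. b n * nat_powr_it t n))\<^sup>2) = (\<Sum>m\<in>S. \<Sum>n\<in>S. (b m * nat_powr_it t m) * cnj (b n * nat_powr_it t n))"
      by (simp only: complex_norm_square cnj_sum sum_product)
    also have "\<dots> = (\<Sum>m\<in>S. \<Sum>n\<in>S. b m * cnj (b n) * cis ((ln (real n) - ln (real m)) * t))"
    proof (intro sum.cong refl)
      fix m n
      have "nat_powr_it t m * cnj (nat_powr_it t n) = cis ((ln (real n) - ln (real m)) * t)"
        by (simp add: nat_powr_it_def cis_cnj cis_mult algebra_simps)
      then show "(b m * nat_powr_it t m) * cnj (b n * nat_powr_it t n) = b m * cnj (b n) * cis ((ln (real n) - ln (real m)) * t)"
        by (simp add: mult_ac)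
    qed
    finally show ?thesis by (subst Re_complex_of_real[symmetric], simp add: g_def)
  qed
  have int: "g m n integrable_on {0..T}" for m n T
    unfolding g_def by (intro integrable_continuous_real continuous_intros)
  have "((\<lambda>T::real. \<Sum>m\<in>S. \<Sum>n\<in>S. 1 / T * integral {0..T} (g m n)) \<longlongrightarrow> (\<Sum>m\<in>S. \<Sum>n\<in>S. if m = n then (cmod (b n))\<^sup>2 else 0)) at_top"
  proof (intro tendsto_sum)
    fix m n assume mn: "m \<in> S" "n \<in> S"
    show "((\<lambda>T::real. 1 / T * integral {0..T} (g m n)) \<longlongrightarrow> (if m = n then (cmod (b n))\<^sup>2 else 0)) at_top"
    proof (cases "m = n")
      case True
      have "g m n t = (cmod (b n))\<^sup>2" for t using True by (simp add: g_def complex_norm_square[symmetric])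
      then have gc: "g m n = (\<lambda>_. (cmod (b n))\<^sup>2)" by auto
      have "\<forall>\<^sub>F T::real in at_top. T > 0" by (rule eventually_gt_at_top)
      then have "\<forall>\<^sub>F T::real in at_top. (cmod (b n))\<^sup>2 = 1 / T * integral {0..T} (g m n)"
        by eventually_elim (simp add: gc)
      then show ?thesis using True by (simp add: tendsto_eventually eventually_mono[of _ at_top] eq_commute)
    next
      case False
      have "real m > 0" "real n > 0" using mn S by (auto intro: Nat.gr0I)
      then have "ln (real n) - ln (real m) \<noteq> 0" using False by simp
      from mean_cis[OF this, of "b m * cnj (b n)"] show ?thesis using False by (simp add: g_def[abs_def])
    qed
  qed
  also have "(\<Sum>m\<in>S. \<Sum>n\<in>S. if m = n then (cmod (b n))\<^sup>2 else 0) = (\<Sum>n\<in>S. (cmod (b n))\<^sup>2)"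
    using S by simp
  also have "(\<lambda>T::real. \<Sum>m\<in>S. \<Sum>n\<in>S. 1 / T * integral {0..T} (g m n)) = (\<lambda>T. 1 / T * integral {0..T} (\<lambda>t. (cmod (\<Sum>n\<in>S. b n * nat_powr_it t n))\<^sup>2))"
    unfolding sq using S int by (simp add: integral_sum integrable_sum sum_distrib_left)
  finally show ?thesis .
qed

lemma integral_sq_dirichlet_poly:
  assumes S: "finite S" "0 \<notin> S"
  shows "(\<integral>x. (cmod (dirichlet_poly b S x))\<^sup>2 \<partial>torus) = (\<Sum>n\<in>S. (cmod (b n))\<^sup>2)"
proof -
  have "complex_of_real (\<integral>x. (cmod (dirichlet_poly b S x))\<^sup>2 \<partial>torus) = (\<integral>x. dirichlet_poly b S x * cnj (dirichlet_poly b S x) \<partial>torus)"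
    by (simp only: complex_norm_square[symmetric] integral_complex_of_real)
  also have "\<dots> = (\<integral>x. (\<Sum>m\<in>S. \<Sum>n\<in>S. b m * cnj (b n) * (cx x m * cnj (cx x n))) \<partial>torus)"
    unfolding dirichlet_poly_def by (simp add: sum_product mult_ac)
  also have "\<dots> = (\<Sum>m\<in>S. \<Sum>n\<in>S. b m * cnj (b n) * (\<integral>x. cx x m * cnj (cx x n) \<partial>torus))"
    by (subst Bochner_Integration.integral_sum, (intro torus.bdd_measurable_integrable bdd_measurable_intros bdd_measurable_cx),
        subst Bochner_Integration.integral_sum, (intro torus.bdd_measurable_integrable bdd_measurable_intros bdd_measurable_cx), simp)
  also have "\<dots> = (\<Sum>m\<in>S. \<Sum>n\<in>S. if m = n then complex_of_real ((cmod (b n))\<^sup>2) else 0)"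
  proof (intro sum.cong refl)
    fix m n assume "m \<in> S" "n \<in> S"
    then have "m > 0" "n > 0" using S by (auto intro: Nat.gr0I)
    then show "b m * cnj (b n) * (\<integral>x. cx x m * cnj (cx x n) \<partial>torus) = (if m = n then complex_of_real ((cmod (b n))\<^sup>2) else 0)"
      by (auto simp: cx_orth complex_norm_square simp del: of_real_power)
  qed
  also have "\<dots> = complex_of_real (\<Sum>n\<in>S. (cmod (b n))\<^sup>2)" using S by simp
  finally show ?thesis by (simp only: of_real_eq_iff)
qed

text \<open>Even moments agree: the \<open>j\<close>-th powers on both sides have the same
  coefficients, and both mean squares are the sum of their squared moduli, on the line because
  distinct integers have distinct logarithms, on the torus by orthogonality. Weierstrass
  approximation of \<open>u powr k\<close> on \<open>[0, B]\<close> by polynomials in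
  \<open>u = \<bar>F\<bar>\<^sup>2\<close> then reaches every real \<open>k > 0\<close>.\<close>

lemma mean_dirichlet_polynomial:
  assumes S: "finite S" "0 \<notin> S" and k: "k > 0"
  shows "((\<lambda>T::real. 1 / T * integral {0..T} (\<lambda>t. cmod (\<Sum>n\<in>S. c n * nat_powr_it t n) powr (2 * k))) \<longlongrightarrow>
     (\<integral>x. cmod (dirichlet_poly c S x) powr (2 * k) \<partial>torus)) at_top"
proof -
  define F where "F t = (\<Sum>n\<in>S. c n * nat_powr_it t n)" for t
  define B where "B = (\<Sum>n\<in>S. cmod (c n))\<^sup>2"
  have contF: "continuous_on A F" for A unfolding F_def by (intro continuous_intros continuous_on_nat_powr_it)
  have FB: "(cmod (F t))\<^sup>2 \<in> {0..B}" for t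
  proof -
    have "cmod (F t) \<le> (\<Sum>n\<in>S. cmod (c n))"
      unfolding F_def by (rule sum_norm_le) (simp add: norm_mult nat_powr_it_def)
    then show ?thesis by (auto simp: B_def intro!: power_mono)
  qed
  have DB: "(cmod (dirichlet_poly c S x))\<^sup>2 \<in> {0..B}" for x
  proof -
    have "cmod (dirichlet_poly c S x) \<le> (\<Sum>n\<in>S. cmod (c n))"
      unfolding dirichlet_poly_def by (rule sum_norm_le) (simp add: norm_mult)
    then show ?thesis by (auto simp: B_def intro!: power_mono)
  qed
  have pw: "u powr (2 * k) = (u\<^sup>2) powr k" if "u \<ge> 0" for u :: real
    using that by (cases "u = 0") (auto simp: powr_powr simp flip: powr_numeral)
  have mono: "((\<lambda>T::real. 1 / T * integral {0..T} (\<lambda>t. ((cmod (F t))\<^sup>2) ^ j)) \<longlongrightarrow> (\<integral>x. ((cmod (dirichlet_poly c S x))\<^sup>2) ^ j \<partial>torus)) at_top" for j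
  proof -
    obtain U b where U: "finite U" "0 \<notin> U" "\<And>\<psi>. \<psi> (Suc 0) = 1 \<Longrightarrow> (\<forall>m>0. \<forall>n>0. \<psi> (m * n) = \<psi> m * \<psi> n) \<Longrightarrow>
     (\<Sum>m\<in>S. c m * \<psi> m) ^ j = (\<Sum>l\<in>U. b l * \<psi> l)" using dirichlet_polynomial_power[OF S, of c j] by blast
    have pj: "((cmod z)\<^sup>2) ^ j = (cmod (z ^ j))\<^sup>2" for z by (simp add: norm_power mult.commute flip: power_mult)
    have "F t ^ j = (\<Sum>n\<in>U. b n * nat_powr_it t n)" for t
      unfolding F_def by (rule U(3)) (auto simp: nat_powr_it_mult)
    then have 1: "((cmod (F t))\<^sup>2) ^ j = (cmod (\<Sum>n\<in>U. b n * nat_powr_it t n))\<^sup>2" for t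
      by (simp only: pj)
    have "dirichlet_poly c S x ^ j = dirichlet_poly b U x" for x
      unfolding dirichlet_poly_def by (rule U(3)) (auto simp: cx_mult, simp add: cx_def)
    then have 2: "((cmod (dirichlet_poly c S x))\<^sup>2) ^ j = (cmod (dirichlet_poly b U x))\<^sup>2" for x
      by (simp only: pj)
    show ?thesis unfolding 1 2 integral_sq_dirichlet_poly[OF U(1,2)] by (rule mean_sq_dirichlet_polynomial[OF U(1,2)])
  qed
  show ?thesis
  proof (rule tendstoI)
    fix \<epsilon> :: real assume e: "\<epsilon> > 0"
    have "continuous_on {0..B} (\<lambda>u. u powr k)" using k by (intro continuous_on_powr') (auto intro: continuous_intros)
    \<comment> \<open>The approximation error enters twice, once on the line and once on the torus,
      and the limit for \<open>g\<close> costs a third \<open>\<epsilon>/4\<close>.\<close>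
    then obtain g where g: "real_polynomial_function g" "\<And>u. u \<in> {0..B} \<Longrightarrow> \<bar>u powr k - g u\<bar> < \<epsilon>/4"
      using Stone_Weierstrass_real_polynomial_function[of "{0..B}" "\<lambda>u. u powr k" "\<epsilon>/4"] e by auto
    obtain a d where ad: "g = (\<lambda>u. \<Sum>i\<le>d. a i * u ^ i)" using g(1) real_polynomial_function_iff_sum by auto
    define L where "L = (\<integral>x. g ((cmod (dirichlet_poly c S x))\<^sup>2) \<partial>torus)"
    have bmp: "bdd_measurable torus (\<lambda>x. ((cmod (dirichlet_poly c S x))\<^sup>2) ^ j)" for j by (intro bdd_measurable_intros bdd_measurable_dirichlet_poly)
    have bmg: "bdd_measurable torus (\<lambda>x. g ((cmod (dirichlet_poly c S x))\<^sup>2))" unfolding ad by (intro bdd_measurable_intros bdd_measurable_dirichlet_poly)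
    have L: "L = (\<Sum>i\<le>d. a i * (\<integral>x. ((cmod (dirichlet_poly c S x))\<^sup>2) ^ i \<partial>torus))"
      unfolding L_def ad by (subst Bochner_Integration.integral_sum) (auto intro!: torus.bdd_measurable_integrable bdd_measurable_mult bmp)
    have cg: "continuous_on A (\<lambda>t. g ((cmod (F t))\<^sup>2))" for A
      unfolding ad by (intro continuous_intros contF)
    have "((\<lambda>T::real. \<Sum>i\<le>d. a i * (1 / T * integral {0..T} (\<lambda>t. ((cmod (F t))\<^sup>2) ^ i))) \<longlongrightarrow> L) at_top"
      unfolding L by (intro tendsto_intros mono)
    moreover have "(\<Sum>i\<le>d. a i * (1 / T * integral {0..T} (\<lambda>t. ((cmod (F t))\<^sup>2) ^ i))) = 1 / T * integral {0..T} (\<lambda>t. g ((cmod (F t))\<^sup>2))" for T :: real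
    proof -
      have "integral {0..T} (\<lambda>t. g ((cmod (F t))\<^sup>2)) = (\<Sum>i\<le>d. integral {0..T} (\<lambda>t. a i * ((cmod (F t))\<^sup>2) ^ i))"
        unfolding ad by (intro integral_sum integrable_continuous_real continuous_intros contF) auto
      then show ?thesis by (simp add: sum_distrib_left mult_ac)
    qed
    ultimately have "((\<lambda>T::real. 1 / T * integral {0..T} (\<lambda>t. g ((cmod (F t))\<^sup>2))) \<longlongrightarrow> L) at_top" by simp
    from tendstoD[OF this, of "\<epsilon>/4"] e
    have "\<forall>\<^sub>F T in at_top. dist (1 / T * integral {0..T} (\<lambda>t. g ((cmod (F t))\<^sup>2))) L < \<epsilon>/4" by simp
    moreover have "\<forall>\<^sub>F T::real in at_top. T > 0" by (rule eventually_gt_at_top)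
    ultimately show "\<forall>\<^sub>F T in at_top. dist (1 / T * integral {0..T} (\<lambda>t. cmod (\<Sum>n\<in>S. c n * nat_powr_it t n) powr (2 * k)))
       (\<integral>x. cmod (dirichlet_poly c S x) powr (2 * k) \<partial>torus) < \<epsilon>"
    proof eventually_elim
      case (elim T)
      have cp: "continuous_on A (\<lambda>t. cmod (F t) powr (2 * k))" for A
        using k by (intro continuous_on_powr' continuous_intros contF) auto
      have "norm (integral {0..T} (\<lambda>t. cmod (F t) powr (2 * k) - g ((cmod (F t))\<^sup>2))) \<le> \<epsilon>/4 * (T - 0)"
      proof (rule integral_bound)
        show "continuous_on {0..T} (\<lambda>t. cmod (F t) powr (2 * k) - g ((cmod (F t))\<^sup>2))" by (intro continuous_on_diff cp cg)
        show "norm (cmod (F t) powr (2 * k) - g ((cmod (F t))\<^sup>2)) \<le> \<epsilon>/4" for t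
          using g(2)[OF FB[of t]] by (simp add: pw)
      qed (use elim in auto)
      moreover have "integral {0..T} (\<lambda>t. cmod (F t) powr (2 * k) - g ((cmod (F t))\<^sup>2)) = integral {0..T} (\<lambda>t. cmod (F t) powr (2 * k)) - integral {0..T} (\<lambda>t. g ((cmod (F t))\<^sup>2))"
        by (intro Henstock_Kurzweil_Integration.integral_diff integrable_continuous_real cp cg)
      ultimately have "\<bar>integral {0..T} (\<lambda>t. cmod (F t) powr (2 * k)) - integral {0..T} (\<lambda>t. g ((cmod (F t))\<^sup>2))\<bar> \<le> \<epsilon>/4 * T" by simp
      then have 1: "\<bar>1 / T * integral {0..T} (\<lambda>t. cmod (F t) powr (2 * k)) - 1 / T * integral {0..T} (\<lambda>t. g ((cmod (F t))\<^sup>2))\<bar> \<le> \<epsilon>/4"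
        using elim by (simp add: abs_mult field_simps flip: right_diff_distrib diff_divide_distrib)
      have bd: "bdd_measurable torus (\<lambda>x. cmod (dirichlet_poly c S x) powr (2 * k))" using k by (intro bdd_measurable_intros bdd_measurable_dirichlet_poly) auto
      have "(\<integral>x. cmod (dirichlet_poly c S x) powr (2 * k) \<partial>torus) - L = (\<integral>x. cmod (dirichlet_poly c S x) powr (2 * k) - g ((cmod (dirichlet_poly c S x))\<^sup>2) \<partial>torus)"
        unfolding L_def by (intro Bochner_Integration.integral_diff[symmetric] torus.bdd_measurable_integrable bd bmg)
      moreover have "norm \<dots> \<le> (\<integral>x. norm (cmod (dirichlet_poly c S x) powr (2 * k) - g ((cmod (dirichlet_poly c S x))\<^sup>2)) \<partial>torus)"
        by (rule integral_norm_bound)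
      moreover have "\<dots> \<le> \<epsilon>/4"
      proof (intro torus.integral_le_const torus.bdd_measurable_integrable bdd_measurable_norm bdd_measurable_diff bd bmg AE_I2)
        show "norm (cmod (dirichlet_poly c S x) powr (2 * k) - g ((cmod (dirichlet_poly c S x))\<^sup>2)) \<le> \<epsilon>/4" for x
          using g(2)[OF DB[of x]] by (simp add: pw)
      qed
      ultimately have 2: "\<bar>(\<integral>x. cmod (dirichlet_poly c S x) powr (2 * k) \<partial>torus) - L\<bar> \<le> \<epsilon>/4"
        unfolding real_norm_def by linarith
      show ?case using 1 2 elim(1) e unfolding dist_real_def F_def[symmetric] by linarith
    qed
  qed
qed

definition zcoef :: "nat \<Rightarrow> complex" where
  "zcoef n = complex_of_real (real n powr (- 1/2))"

theorem pseudomoment_eq: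
  assumes k: "k > 0"
  shows "pseudomoment k N = Lnorm torus (2 * k) (dirichlet_poly zcoef {1..N}) powr (2 * k)"
proof -
  have z: "zeta_partial N (\<i> * of_real t) = (\<Sum>n\<in>{1..N}. zcoef n * nat_powr_it t n)" for t
    unfolding zeta_partial_def
  proof (intro sum.cong refl)
    fix n assume "n \<in> {1..N}"
    then have n: "n > 0" by simp
    have "of_nat n powr (- (1/2) - \<i> * of_real t) = exp (complex_of_real ((- 1/2) * ln (real n))) * exp (\<i> * complex_of_real (- t * ln (real n)))"
      using n by (simp add: powr_def Ln_of_nat algebra_simps flip: exp_add)
    also have "\<dots> = zcoef n * nat_powr_it t n"
      unfolding zcoef_def nat_powr_it_def cis_conv_exp powr_def exp_of_real using n by simp
    finally show "of_nat n powr (- (1/2) - \<i> * of_real t) = zcoef n * nat_powr_it t n" .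
  qed
  have "((\<lambda>T::real. 1 / T * integral {0..T} (\<lambda>t. cmod (zeta_partial N (\<i> * of_real t)) powr (2 * k))) \<longlongrightarrow>
     (\<integral>x. cmod (dirichlet_poly zcoef {1..N} x) powr (2 * k) \<partial>torus)) at_top"
    unfolding z using k by (intro mean_dirichlet_polynomial) auto
  then have "pseudomoment k N = (\<integral>x. cmod (dirichlet_poly zcoef {1..N} x) powr (2 * k) \<partial>torus)"
    unfolding pseudomoment_def by (intro tendsto_Lim) auto
  then show ?thesis using k by (simp add: torus.Lnorm_powr)
qed

subsection \<open>Euler products\<close>

definition primes_upto :: "nat \<Rightarrow> nat set" where
  "primes_upto N = {p. prime p \<and> p \<le> N}"

lemma finite_primes_upto[simp]: "finite (primes_upto N)"
  unfolding primes_upto_def by (rule finite_subset[of _ "{..N}"]) auto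

lemma primes_uptoD: "p \<in> primes_upto N \<Longrightarrow> prime p"
  by (simp add: primes_upto_def)

definition euler_factor :: "(nat \<Rightarrow> nat \<Rightarrow> real) \<Rightarrow> real \<Rightarrow> nat \<Rightarrow> real" where
  "euler_factor w t p = (\<Sum>j. w p j * (real p powr t) ^ j)"

locale euler =
  fixes w :: "nat \<Rightarrow> nat \<Rightarrow> real" and t :: real
  assumes w_nonneg: "prime p \<Longrightarrow> w p j \<ge> 0" and w_0: "prime p \<Longrightarrow> w p 0 = 1"
    and w_summable: "prime p \<Longrightarrow> summable (\<lambda>j. w p j * (real p powr t) ^ j)"
begin

lemma terms_nonneg: "mult_fun w n * real n powr t \<ge> 0"
  by (intro mult_nonneg_nonneg mult_fun_nonneg w_nonneg) auto

lemma euler_factor_ge_1: "prime p \<Longrightarrow> euler_factor w t p \<ge> 1"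
  using sum_le_suminf[OF w_summable, of p "{0}"] w_nonneg[of p] w_0[of p]
  by (auto simp: euler_factor_def)

lemma partial_sum_le_prod: "(\<Sum>n=1..N. mult_fun w n * real n powr t) \<le> (\<Prod>p\<in>primes_upto N. euler_factor w t p)"
proof -
  have "(\<Sum>n=1..N. mult_fun w n * real n powr t) \<le> (\<Sum>n\<in>smooth (primes_upto N) N. mult_fun w n * real n powr t)"
    using atLeastAtMost_subset_smooth[of N]
    by (intro sum_mono2 finite_smooth) (auto simp: primes_upto_def terms_nonneg)
  also have "\<dots> = (\<Prod>p\<in>primes_upto N. \<Sum>j\<le>N. w p j * (real p powr t) ^ j)"
    by (intro sum_mult_fun_smooth) (auto simp: w_0 primes_uptoD)
  also have "\<dots> \<le> (\<Prod>p\<in>primes_upto N. euler_factor w t p)"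
  proof (intro prod_mono conjI)
    fix p assume "p \<in> primes_upto N"
    then have p: "prime p" by (rule primes_uptoD)
    show "0 \<le> (\<Sum>j\<le>N. w p j * (real p powr t) ^ j)" by (intro sum_nonneg mult_nonneg_nonneg w_nonneg p) auto
    show "(\<Sum>j\<le>N. w p j * (real p powr t) ^ j) \<le> euler_factor w t p"
      unfolding euler_factor_def by (intro sum_le_suminf w_summable p) (auto simp: w_nonneg p)
  qed
  finally show ?thesis .
qed

lemma sum_lessThan_eq: "(\<Sum>n<Suc N. mult_fun w n * real n powr t) = (\<Sum>n=1..N. mult_fun w n * real n powr t)"
proof -
  have "{..<Suc N} = insert 0 {1..N}" by auto
  then show ?thesis by simp
qed

lemma euler_summable:
  assumes "\<And>N. (\<Prod>p\<in>primes_upto N. euler_factor w t p) \<le> H"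
  shows "summable (\<lambda>n. mult_fun w n * real n powr t)"
proof (rule summableI_nonneg_bounded[of _ H])
  fix n
  have "(\<Sum>i<n. mult_fun w i * real i powr t) \<le> (\<Sum>i<Suc n. mult_fun w i * real i powr t)"
    by (intro sum_mono2) (auto simp: terms_nonneg)
  also have "\<dots> \<le> H" unfolding sum_lessThan_eq using partial_sum_le_prod[of n] assms[of n] by linarith
  finally show "(\<Sum>i<n. mult_fun w i * real i powr t) \<le> H" .
qed (rule terms_nonneg)

lemma euler_prod_le_suminf:
  assumes s: "summable (\<lambda>n. mult_fun w n * real n powr t)"
  shows "(\<Prod>p\<in>primes_upto N. euler_factor w t p) \<le> (\<Sum>n. mult_fun w n * real n powr t)"
proof (rule LIMSEQ_le_const2)
  show "(\<lambda>J. \<Prod>p\<in>primes_upto N. \<Sum>j\<le>J. w p j * (real p powr t) ^ j) \<longlonglongrightarrow> (\<Prod>p\<in>primes_upto N. euler_factor w t p)"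
    unfolding euler_factor_def
    by (intro tendsto_prod summable_LIMSEQ' w_summable) (auto simp: primes_uptoD)
  have "(\<Prod>p\<in>primes_upto N. \<Sum>j\<le>J. w p j * (real p powr t) ^ j) \<le> (\<Sum>n. mult_fun w n * real n powr t)" for J
  proof -
    have "(\<Prod>p\<in>primes_upto N. \<Sum>j\<le>J. w p j * (real p powr t) ^ j) = (\<Sum>n\<in>smooth (primes_upto N) J. mult_fun w n * real n powr t)"
      by (intro sum_mult_fun_smooth[symmetric]) (auto simp: w_0 primes_uptoD)
    also have "\<dots> \<le> (\<Sum>n. mult_fun w n * real n powr t)"
      by (intro sum_le_suminf s finite_smooth) (auto simp: terms_nonneg primes_uptoD)
    finally show ?thesis .
  qed
  then show "\<exists>N'. \<forall>J\<ge>N'. (\<Prod>p\<in>primes_upto N. \<Sum>j\<le>J. w p j * (real p powr t) ^ j) \<le> (\<Sum>n. mult_fun w n * real n powr t)"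
    by blast
qed

text \<open>All terms being nonnegative, each finite product lies between a partial sum and the full
  sum.\<close>

lemma euler_limit:
  assumes s: "summable (\<lambda>n. mult_fun w n * real n powr t)"
  shows "(\<lambda>N. \<Prod>p\<in>primes_upto N. euler_factor w t p) \<longlonglongrightarrow> (\<Sum>n. mult_fun w n * real n powr t)"
proof (rule tendsto_sandwich)
  show "\<forall>\<^sub>F N in sequentially. (\<Sum>n<Suc N. mult_fun w n * real n powr t) \<le> (\<Prod>p\<in>primes_upto N. euler_factor w t p)"
    unfolding sum_lessThan_eq using partial_sum_le_prod by auto
  show "\<forall>\<^sub>F N in sequentially. (\<Prod>p\<in>primes_upto N. euler_factor w t p) \<le> (\<Sum>n. mult_fun w n * real n powr t)"
    using euler_prod_le_suminf[OF s] by auto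
  show "(\<lambda>N. \<Sum>n<Suc N. mult_fun w n * real n powr t) \<longlonglongrightarrow> (\<Sum>n. mult_fun w n * real n powr t)"
    using summable_LIMSEQ[OF s] by (rule LIMSEQ_Suc)
qed simp

end

section \<open>The zeta function near its pole\<close>

definition zeta_series :: "real \<Rightarrow> real" where
  "zeta_series \<sigma> = (\<Sum>n. real n powr (- (1 + \<sigma>)))"

lemma zeta_series_summable: "\<sigma> > 0 \<Longrightarrow> summable (\<lambda>n. real n powr (- (1 + \<sigma>)))"
  by (simp add: summable_real_powr_iff)

lemma powr_diff_bounds:
  assumes "\<sigma> > 0" "n \<ge> 1"
  shows "real n powr (-\<sigma>) - real (Suc n) powr (-\<sigma>) \<le> \<sigma> * real n powr (- (1 + \<sigma>))"
    and "\<sigma> * real (Suc n) powr (- (1 + \<sigma>)) \<le> real n powr (-\<sigma>) - real (Suc n) powr (-\<sigma>)"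
proof -
  have "\<exists>z. real n < z \<and> z < real (Suc n) \<and> real (Suc n) powr (-\<sigma>) - real n powr (-\<sigma>) = (real (Suc n) - real n) * (-\<sigma> * z powr (-\<sigma> - 1))"
  proof (rule MVT2)
    fix x assume "real n \<le> x"
    then have "x > 0" using assms by simp
    then show "((\<lambda>x. x powr -\<sigma>) has_real_derivative - \<sigma> * x powr (-\<sigma> - 1)) (at x)"
      by (auto intro!: derivative_eq_intros)
  qed simp
  then obtain z where z: "real n < z" "z < real (Suc n)" "real n powr (-\<sigma>) - real (Suc n) powr (-\<sigma>) = \<sigma> * z powr (-\<sigma> - 1)"
    by (auto simp: algebra_simps)
  have e: "-\<sigma> - 1 = - (1 + \<sigma>)" by simp
  have n: "real n > 0" using assms by simp
  have "z powr (-(1+\<sigma>)) \<le> real n powr (-(1+\<sigma>))" using assms z n by (intro powr_mono2') auto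
  moreover have "real (Suc n) powr (-(1+\<sigma>)) \<le> z powr (-(1+\<sigma>))" using assms z n by (intro powr_mono2') auto
  ultimately show "real n powr (-\<sigma>) - real (Suc n) powr (-\<sigma>) \<le> \<sigma> * real n powr (- (1 + \<sigma>))"
     "\<sigma> * real (Suc n) powr (- (1 + \<sigma>)) \<le> real n powr (-\<sigma>) - real (Suc n) powr (-\<sigma>)"
    using z(3) assms unfolding e by auto
qed

text \<open>The mean value theorem compares \<open>\<sigma> * n powr (- (1 + \<sigma>))\<close> with
  the telescoping differences of \<open>n powr (- \<sigma>)\<close>. Together the two bounds give
  the residue 1.\<close>

lemma zeta_series_bounds:
  assumes s: "\<sigma> > 0"
  shows "1 \<le> \<sigma> * zeta_series \<sigma>" "\<sigma> * zeta_series \<sigma> \<le> 1 + \<sigma>"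
proof -
  define f where "f n = real (Suc n) powr (-\<sigma>)" for n
  have "f \<longlonglongrightarrow> 0" unfolding f_def
    using s by (intro LIMSEQ_Suc tendsto_neg_powr filterlim_real_sequentially) auto
  from telescope_sums'[OF this] have t: "(\<lambda>n. f n - f (Suc n)) sums (f 0 - 0)" .
  have sm: "summable (\<lambda>n. real (Suc n) powr (- (1 + \<sigma>)))"
    using zeta_series_summable[OF s] by (subst summable_Suc_iff)
  have z: "zeta_series \<sigma> = (\<Sum>n. real (Suc n) powr (- (1 + \<sigma>)))"
    unfolding zeta_series_def using suminf_split_head[OF zeta_series_summable[OF s]] by simp
  have s1: "(\<lambda>n. \<sigma> * real (Suc n) powr (- (1 + \<sigma>))) sums (\<sigma> * zeta_series \<sigma>)"
    unfolding z using sm by (intro sums_mult summable_sums)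
  have "f 0 - 0 \<le> \<sigma> * zeta_series \<sigma>"
    by (rule sums_le[OF _ t s1]) (use powr_diff_bounds(1)[OF s, of "Suc _"] in \<open>auto simp: f_def\<close>)
  then show "1 \<le> \<sigma> * zeta_series \<sigma>" by (simp add: f_def)
  have sm2: "summable (\<lambda>n. real (Suc (Suc n)) powr (- (1 + \<sigma>)))"
    using sm by (subst summable_Suc_iff)
  have z2: "zeta_series \<sigma> = 1 + (\<Sum>n. real (Suc (Suc n)) powr (- (1 + \<sigma>)))"
    unfolding z using suminf_split_head[OF sm] by simp
  have s2: "(\<lambda>n. \<sigma> * real (Suc (Suc n)) powr (- (1 + \<sigma>))) sums (\<sigma> * (zeta_series \<sigma> - 1))"
    unfolding z2 using sm2 by (simp only: add_diff_cancel_left') (intro sums_mult summable_sums)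
  have "\<sigma> * (zeta_series \<sigma> - 1) \<le> f 0 - 0"
    by (rule sums_le[OF _ s2 t]) (use powr_diff_bounds(2)[OF s, of "Suc _"] in \<open>auto simp: f_def\<close>)
  then show "\<sigma> * zeta_series \<sigma> \<le> 1 + \<sigma>" by (simp add: f_def algebra_simps)
qed

lemma zeta_series_limit: "((\<lambda>\<sigma>. \<sigma> * zeta_series \<sigma>) \<longlongrightarrow> 1) (at_right 0)"
proof (rule tendsto_sandwich)
  have ev: "\<forall>\<^sub>F \<sigma> in at_right (0::real). \<sigma> > 0" by (simp add: eventually_at_right_less)
  show "\<forall>\<^sub>F \<sigma> in at_right 0. 1 \<le> \<sigma> * zeta_series \<sigma>" using ev by eventually_elim (rule zeta_series_bounds)
  show "\<forall>\<^sub>F \<sigma> in at_right 0. \<sigma> * zeta_series \<sigma> \<le> 1 + \<sigma>" using ev by eventually_elim (rule zeta_series_bounds)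
  show "((\<lambda>\<sigma>::real. 1 + \<sigma>) \<longlongrightarrow> 1) (at_right 0)" by (auto intro!: tendsto_eq_intros)
qed simp

lemma prime_powr_less_1:
  assumes "prime p" "\<sigma> \<ge> 0" shows "0 < real p powr (- (1 + \<sigma>))" "real p powr (- (1 + \<sigma>)) \<le> 1/2"
proof -
  have p: "real p \<ge> 2" using assms prime_ge_2_nat by (simp add: numeral_le_real_of_nat_iff)
  then show "0 < real p powr (- (1 + \<sigma>))" by simp
  have "real p powr (- (1 + \<sigma>)) \<le> real p powr (-1)" using p assms by (intro powr_mono) auto
  also have "\<dots> \<le> 1/2" using p by (simp add: powr_minus field_simps)
  finally show "real p powr (- (1 + \<sigma>)) \<le> 1/2" .
qed

lemma zeta_series_euler:
  assumes s: "\<sigma> > 0"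
  shows "(\<lambda>N. \<Prod>p\<in>primes_upto N. 1 / (1 - real p powr (- (1 + \<sigma>)))) \<longlonglongrightarrow> zeta_series \<sigma>"
proof -
  interpret euler "\<lambda>p j. 1" "- (1 + \<sigma>)"
  proof
    fix p :: nat assume "prime p"
    from prime_powr_less_1[OF this, of \<sigma>] s have "norm (real p powr (- (1 + \<sigma>))) < 1" by auto
    then show "summable (\<lambda>j. 1 * (real p powr (- (1 + \<sigma>))) ^ j)" by simp
  qed auto
  have m: "mult_fun (\<lambda>p j. 1::real) n = 1" for n by (simp add: mult_fun_def)
  have "(\<lambda>N. \<Prod>p\<in>primes_upto N. euler_factor (\<lambda>p j. 1) (- (1 + \<sigma>)) p) \<longlonglongrightarrow> zeta_series \<sigma>"
    using euler_limit zeta_series_summable[OF s] by (simp add: m zeta_series_def)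
  moreover have "euler_factor (\<lambda>p j. 1) (- (1 + \<sigma>)) p = 1 / (1 - real p powr (- (1 + \<sigma>)))" if "p \<in> primes_upto N" for p N
  proof -
    from prime_powr_less_1[OF primes_uptoD[OF that], of \<sigma>] s have "norm (real p powr (- (1 + \<sigma>))) < 1" by auto
    from suminf_geometric[OF this] show ?thesis by (simp add: euler_factor_def)
  qed
  ultimately show ?thesis by simp
qed

section \<open>Euler products comparable to a power of zeta\<close>

lemma ln_abs_le:
  fixes x b :: real
  assumes "b > 0" "b \<le> 1" "x \<ge> b"
  shows "\<bar>ln x\<bar> \<le> \<bar>x - 1\<bar> / b"
proof -
  have x: "x > 0" using assms by simp
  have 1: "\<bar>x - 1\<bar> \<le> \<bar>x - 1\<bar> / b" using assms by (simp add: field_simps mult_left_le_one_le)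
  have 2: "ln x \<le> x - 1" using x by (rule ln_le_minus_one)
  have "ln (1/x) \<le> 1/x - 1" using x by (intro ln_le_minus_one) auto
  then have "- ln x \<le> (1 - x) / x" using x by (simp add: ln_div field_simps)
  also have "\<dots> \<le> \<bar>x - 1\<bar> / b" using assms x by (intro frac_le) auto
  finally show ?thesis using 1 2 by linarith
qed

lemma summable_powr_3_2: "summable (\<lambda>n. K * real n powr (- (3/2)))"
  by (intro summable_mult) (simp add: summable_real_powr_iff)

lemma prod_primes_upto_exp:
  fixes f :: "nat \<Rightarrow> real"
  assumes "\<And>p. prime p \<Longrightarrow> f p > 0"
  shows "(\<Prod>p\<in>primes_upto N. f p) = exp (\<Sum>n\<le>N. if prime n then ln (f n) else 0)"
proof -
  have "exp (\<Sum>n\<le>N. if prime n then ln (f n) else 0) = exp (\<Sum>n\<in>primes_upto N. ln (f n))"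
    by (rule arg_cong[where f = exp], rule sum.mono_neutral_cong_right) (auto simp: primes_upto_def)
  also have "\<dots> = (\<Prod>p\<in>primes_upto N. exp (ln (f p)))"
    by (intro exp_sum) simp
  also have "\<dots> = (\<Prod>p\<in>primes_upto N. f p)"
  proof (intro prod.cong refl)
    fix p assume "p \<in> primes_upto N"
    then have "f p > 0" by (intro assms primes_uptoD)
    then show "exp (ln (f p)) = f p" by simp
  qed
  finally show ?thesis by (rule sym)
qed

text \<open>The number \<open>\<kappa>\<close> is the order of the singularity at
  \<open>\<sigma> = 0\<close>: up to a relative error \<open>O(p powr (-3/2))\<close> the Euler
  factors are those of the \<open>\<kappa>\<close>-th power of zeta. The Dirichlet series thus
  becomes \<open>H \<sigma> * zeta_series \<sigma> powr \<kappa>\<close>, and since the error is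
  uniform for \<open>0 \<le> \<sigma> \<le> 1\<close>, Tannery's theorem gives the limit of
  \<open>H\<close> at 0.\<close>

locale euler_conv =
  fixes w :: "nat \<Rightarrow> nat \<Rightarrow> real" and \<kappa> C :: real
  assumes w_nonneg: "prime p \<Longrightarrow> w p j \<ge> 0" and w_0: "prime p \<Longrightarrow> w p 0 = 1"
    and w_summable: "prime p \<Longrightarrow> summable (\<lambda>j. w p j * (real p powr (-1)) ^ j)"
    and k: "\<kappa> > 0"
    and bound: "prime p \<Longrightarrow> 0 \<le> \<sigma> \<Longrightarrow> \<sigma> \<le> 1 \<Longrightarrow>
       \<bar>(1 - real p powr (- (1 + \<sigma>))) powr \<kappa> * euler_factor w (- (1 + \<sigma>)) p - 1\<bar> \<le> C * real p powr (- (3/2))"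
begin

definition R :: "real \<Rightarrow> nat \<Rightarrow> real" where
  "R \<sigma> p = (1 - real p powr (- (1 + \<sigma>))) powr \<kappa> * euler_factor w (- (1 + \<sigma>)) p"

lemma w_summable': "prime p \<Longrightarrow> \<sigma> \<ge> 0 \<Longrightarrow> summable (\<lambda>j. w p j * (real p powr (- (1 + \<sigma>))) ^ j)"
proof (rule summable_comparison_test')
  assume p: "prime p" and s: "\<sigma> \<ge> 0"
  show "summable (\<lambda>j. w p j * (real p powr (-1)) ^ j)" by (rule w_summable[OF p])
  have "real p powr (- (1 + \<sigma>)) \<le> real p powr (-1)" using p s by (intro powr_mono) (auto simp: prime_ge_1_nat Suc_le_eq prime_gt_0_nat)
  then have "(real p powr (- (1 + \<sigma>))) ^ j \<le> (real p powr (-1)) ^ j" for j by (intro power_mono) auto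
  then show "norm (w p j * (real p powr (- (1 + \<sigma>))) ^ j) \<le> w p j * (real p powr (-1)) ^ j" for j
    using w_nonneg[OF p, of j] by (auto simp: abs_mult intro!: mult_left_mono)
qed

lemma euler_at: "\<sigma> \<ge> 0 \<Longrightarrow> euler w (- (1 + \<sigma>))"
  by unfold_locales (use w_nonneg w_0 w_summable' in auto)

lemma R_ge: "prime p \<Longrightarrow> \<sigma> \<ge> 0 \<Longrightarrow> (1/2) powr \<kappa> \<le> R \<sigma> p"
proof -
  assume p: "prime p" and s: "\<sigma> \<ge> 0"
  interpret euler w "- (1 + \<sigma>)" by (rule euler_at[OF s])
  have "(1/2) powr \<kappa> * 1 \<le> (1 - real p powr (- (1 + \<sigma>))) powr \<kappa> * euler_factor w (- (1 + \<sigma>)) p"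
    using prime_powr_less_1[OF p s] k euler_factor_ge_1[OF p] by (intro mult_mono powr_mono2) auto
  then show ?thesis by (simp add: R_def)
qed

lemma R_pos: "prime p \<Longrightarrow> \<sigma> \<ge> 0 \<Longrightarrow> R \<sigma> p > 0"
  by (rule less_le_trans[OF _ R_ge]) auto

definition r :: "real \<Rightarrow> nat \<Rightarrow> real" where
  "r \<sigma> n = (if prime n then ln (R \<sigma> n) else 0)"

definition K :: real where "K = C / (1/2) powr \<kappa>"

lemma r_bound: "0 \<le> \<sigma> \<Longrightarrow> \<sigma> \<le> 1 \<Longrightarrow> \<bar>r \<sigma> n\<bar> \<le> \<bar>K\<bar> * real n powr (- (3/2))"
proof (cases "prime n")
  case True
  assume s: "0 \<le> \<sigma>" "\<sigma> \<le> 1"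
  have "(1/2) powr \<kappa> \<le> 1 powr \<kappa>" using k by (intro powr_mono2) auto
  then have "\<bar>ln (R \<sigma> n)\<bar> \<le> \<bar>R \<sigma> n - 1\<bar> / (1/2) powr \<kappa>"
    using R_ge[OF True s(1)] by (intro ln_abs_le) auto
  also have "\<dots> \<le> (C * real n powr (- (3/2))) / (1/2) powr \<kappa>"
    using bound[OF True s] by (intro divide_right_mono) (auto simp: R_def)
  also have "\<dots> = K * real n powr (- (3/2))" by (simp add: K_def)
  also have "\<dots> \<le> \<bar>K\<bar> * real n powr (- (3/2))" by (intro mult_right_mono) auto
  finally show ?thesis using True by (simp add: r_def)
qed (simp add: r_def)

lemma r_summable: "0 \<le> \<sigma> \<Longrightarrow> \<sigma> \<le> 1 \<Longrightarrow> summable (r \<sigma>)"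
  using r_bound by (intro summable_comparison_test'[OF summable_powr_3_2[of "\<bar>K\<bar>"]]) auto

definition H :: "real \<Rightarrow> real" where "H \<sigma> = exp (\<Sum>n. r \<sigma> n)"

lemma H_pos: "H \<sigma> > 0" by (simp add: H_def)

lemma prod_R: "0 \<le> \<sigma> \<Longrightarrow> \<sigma> \<le> 1 \<Longrightarrow> (\<lambda>N. \<Prod>p\<in>primes_upto N. R \<sigma> p) \<longlonglongrightarrow> H \<sigma>"
  unfolding H_def
  using prod_primes_upto_exp[of "R \<sigma>"] R_pos tendsto_exp[OF summable_LIMSEQ'[OF r_summable]]
  by (simp add: r_def)

lemma prod_E:
  assumes s: "0 < \<sigma>" "\<sigma> \<le> 1"
  shows "(\<lambda>N. \<Prod>p\<in>primes_upto N. euler_factor w (- (1 + \<sigma>)) p) \<longlonglongrightarrow> H \<sigma> * zeta_series \<sigma> powr \<kappa>"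
proof -
  have zp: "zeta_series \<sigma> > 0" using zeta_series_bounds(1)[OF s(1)] s by (smt (verit) mult_nonneg_nonpos)
  have "(\<lambda>N. (\<Prod>p\<in>primes_upto N. R \<sigma> p) * (\<Prod>p\<in>primes_upto N. 1 / (1 - real p powr (- (1 + \<sigma>)))) powr \<kappa>) \<longlonglongrightarrow> H \<sigma> * zeta_series \<sigma> powr \<kappa>"
    using s zp by (intro tendsto_mult prod_R tendsto_powr zeta_series_euler tendsto_const) auto
  moreover have "(\<Prod>p\<in>primes_upto N. R \<sigma> p) * (\<Prod>p\<in>primes_upto N. 1 / (1 - real p powr (- (1 + \<sigma>)))) powr \<kappa>
     = (\<Prod>p\<in>primes_upto N. euler_factor w (- (1 + \<sigma>)) p)" for N
  proof -
    have "(\<Prod>p\<in>primes_upto N. 1 / (1 - real p powr (- (1 + \<sigma>)))) powr \<kappa> = (\<Prod>p\<in>primes_upto N. (1 / (1 - real p powr (- (1 + \<sigma>)))) powr \<kappa>)"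
      by (rule prod_powr_distrib)
    moreover have "R \<sigma> p * (1 / (1 - real p powr (- (1 + \<sigma>)))) powr \<kappa> = euler_factor w (- (1 + \<sigma>)) p" if "p \<in> primes_upto N" for p
    proof -
      have "1 - real p powr (- (1 + \<sigma>)) > 0" using prime_powr_less_1[OF primes_uptoD[OF that], of \<sigma>] s by simp
      then show ?thesis by (simp add: R_def powr_divide)
    qed
    ultimately show ?thesis by (simp add: prod.distrib[symmetric])
  qed
  ultimately show ?thesis by simp
qed

lemma dirichlet_summable: "0 < \<sigma> \<Longrightarrow> \<sigma> \<le> 1 \<Longrightarrow> summable (\<lambda>n. mult_fun w n * real n powr (- (1 + \<sigma>)))"
proof -
  assume s: "0 < \<sigma>" "\<sigma> \<le> 1"
  interpret euler w "- (1 + \<sigma>)" by (rule euler_at) (use s in simp)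
  obtain B where "\<And>N. norm (\<Prod>p\<in>primes_upto N. euler_factor w (- (1 + \<sigma>)) p) \<le> B"
    using convergent_imp_Bseq[OF convergentI[OF prod_E[OF s]]] by (auto simp: Bseq_def)
  then have "(\<Prod>p\<in>primes_upto N. euler_factor w (- (1 + \<sigma>)) p) \<le> B" for N
    by (metis abs_le_D1 real_norm_def)
  then show ?thesis by (rule euler_summable)
qed

lemma dirichlet_eq:
  assumes s: "0 < \<sigma>" "\<sigma> \<le> 1"
  shows "(\<Sum>n. mult_fun w n * real n powr (- (1 + \<sigma>))) = H \<sigma> * zeta_series \<sigma> powr \<kappa>"
proof -
  interpret euler w "- (1 + \<sigma>)" by (rule euler_at) (use s in simp)
  show ?thesis using LIMSEQ_unique[OF euler_limit[OF dirichlet_summable[OF s]] prod_E[OF s]] .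
qed

lemma ev01: "\<forall>\<^sub>F \<sigma> in at_right (0::real). 0 < \<sigma> \<and> \<sigma> \<le> 1"
  using eventually_at_right_real[of 0 1] by (auto elim: eventually_mono)

lemma R_limit:
  assumes p: "prime p"
  shows "((\<lambda>\<sigma>. R \<sigma> p) \<longlongrightarrow> R 0 p) (at_right 0)"
proof -
  have pp: "real p > 0" using p by (simp add: prime_gt_0_nat)
  have x: "((\<lambda>\<sigma>. real p powr (- (1 + \<sigma>))) \<longlongrightarrow> real p powr (- (1 + 0))) (at_right 0)"
    using pp by (intro tendsto_intros) auto
  have "((\<lambda>\<sigma>. euler_factor w (- (1 + \<sigma>)) p) \<longlongrightarrow> euler_factor w (- (1 + 0)) p) (at_right 0)"
    unfolding euler_factor_def
  proof (rule tannerys_theorem[THEN conjunct2, THEN conjunct2])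
    show "((\<lambda>\<sigma>. w p j * (real p powr (- (1 + \<sigma>))) ^ j) \<longlongrightarrow> w p j * (real p powr (- (1 + 0))) ^ j) (at_right 0)" for j
      by (intro tendsto_intros x)
    have "\<forall>\<^sub>F \<sigma> in at_right (0::real). \<forall>j. norm (w p j * (real p powr (- (1 + \<sigma>))) ^ j) \<le> w p j * (real p powr (-1)) ^ j"
      using ev01
    proof eventually_elim
      case (elim \<sigma>)
      have "real p powr (- (1 + \<sigma>)) \<le> real p powr (-1)" using p elim by (intro powr_mono) (auto simp: prime_ge_1_nat Suc_le_eq prime_gt_0_nat)
      then have "(real p powr (- (1 + \<sigma>))) ^ j \<le> (real p powr (-1)) ^ j" for j by (intro power_mono) auto
      then show ?case using w_nonneg[OF p] by (auto simp: abs_mult intro!: mult_left_mono)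
    qed
    then show "\<forall>\<^sub>F (j, \<sigma>) in sequentially \<times>\<^sub>F at_right 0. norm (w p j * (real p powr (- (1 + \<sigma>))) ^ j) \<le> w p j * (real p powr (-1)) ^ j"
      by (rule eventually_mono[OF eventually_prodI[OF eventually_True]]) auto
    show "summable (\<lambda>j. w p j * (real p powr (-1)) ^ j)" by (rule w_summable[OF p])
  qed simp
  moreover have "((\<lambda>\<sigma>. (1 - real p powr (- (1 + \<sigma>))) powr \<kappa>) \<longlongrightarrow> (1 - real p powr (- (1 + 0))) powr \<kappa>) (at_right 0)"
    using prime_powr_less_1[OF p, of 0] by (intro tendsto_intros x) auto
  ultimately show ?thesis unfolding R_def by (intro tendsto_mult)
qed

lemma H_limit: "(H \<longlongrightarrow> H 0) (at_right 0)"
  unfolding H_def[abs_def]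
proof (intro tendsto_exp tannerys_theorem[THEN conjunct2, THEN conjunct2])
  show "((\<lambda>\<sigma>. r \<sigma> n) \<longlongrightarrow> r 0 n) (at_right 0)" for n
    using R_limit[of n] R_pos[of n 0] by (cases "prime n") (auto simp: r_def intro!: tendsto_ln)
  have "\<forall>\<^sub>F \<sigma> in at_right (0::real). \<forall>n. norm (r \<sigma> n) \<le> \<bar>K\<bar> * real n powr (- (3/2))"
    using ev01 by eventually_elim (use r_bound in auto)
  then show "\<forall>\<^sub>F (n, \<sigma>) in sequentially \<times>\<^sub>F at_right 0. norm (r \<sigma> n) \<le> \<bar>K\<bar> * real n powr (- (3/2))"
    by (rule eventually_mono[OF eventually_prodI[OF eventually_True]]) auto
  show "summable (\<lambda>n. \<bar>K\<bar> * real n powr (- (3/2)))" by (rule summable_powr_3_2)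
qed simp

lemma dirichlet_limit:
  "((\<lambda>\<sigma>. \<sigma> powr \<kappa> * (\<Sum>n. mult_fun w n * real n powr (- (1 + \<sigma>)))) \<longlongrightarrow> H 0) (at_right 0)"
proof (rule Lim_transform_eventually)
  show "((\<lambda>\<sigma>. H \<sigma> * (\<sigma> * zeta_series \<sigma>) powr \<kappa>) \<longlongrightarrow> H 0) (at_right 0)"
    using tendsto_mult[OF H_limit tendsto_powr[OF zeta_series_limit tendsto_const[of \<kappa>]]] by simp
  show "\<forall>\<^sub>F \<sigma> in at_right 0. H \<sigma> * (\<sigma> * zeta_series \<sigma>) powr \<kappa> = \<sigma> powr \<kappa> * (\<Sum>n. mult_fun w n * real n powr (- (1 + \<sigma>)))"
    using ev01
  proof eventually_elim
    case (elim \<sigma>)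
    have "zeta_series \<sigma> \<ge> 0" using zeta_series_bounds(1)[of \<sigma>] elim by (smt (verit) mult_nonneg_nonpos)
    then show ?case using elim unfolding dirichlet_eq[OF conjunct1[OF elim] conjunct2[OF elim]] by (simp add: powr_mult)
  qed
qed

end

subsection \<open>Karamata's Tauberian theorem\<close>

definition gamma_density :: "real \<Rightarrow> real \<Rightarrow> real" where
  "gamma_density \<kappa> t = indicator {0..} t * t powr (\<kappa> - 1) / exp t"

text \<open>The limiting distribution of \<open>\<sigma> * ln n\<close> as \<open>\<sigma>\<close>
  tends to 0, when \<open>n\<close> carries mass proportional to the term
  \<open>a n * n powr (- \<sigma>)\<close> of a series that grows like
  \<open>c * \<sigma> powr (- \<kappa>)\<close> with \<open>c > 0\<close>.\<close>

definition gamma_measure :: "real \<Rightarrow> real measure" where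
  "gamma_measure \<kappa> = density lborel (\<lambda>t. ennreal (gamma_density \<kappa> t / Gamma \<kappa>))"

lemma sets_gamma_measure[simp, measurable_cong]: "sets (gamma_measure \<kappa>) = sets borel"
  by (simp add: gamma_measure_def)

lemma gamma_density_nonneg: "gamma_density \<kappa> t \<ge> 0"
  by (simp add: gamma_density_def)

lemma gamma_density_measurable[measurable]: "gamma_density \<kappa> \<in> borel_measurable borel"
  unfolding gamma_density_def by measurable

lemma gamma_density_integral:
  assumes "\<kappa> > 0"
  shows "integrable lborel (gamma_density \<kappa>)" "(\<integral>t. gamma_density \<kappa> t \<partial>lborel) = Gamma \<kappa>"
proof -
  have "(\<integral>\<^sup>+t. ennreal (gamma_density \<kappa> t) \<partial>lborel) = ennreal (Gamma \<kappa>)"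
    using Gamma_conv_nn_integral_real[OF assms] by (simp add: gamma_density_def)
  then have "has_bochner_integral lborel (gamma_density \<kappa>) (Gamma \<kappa>)"
    using assms by (intro has_bochner_integral_nn_integral) (auto simp: gamma_density_nonneg Gamma_real_nonneg)
  then show "integrable lborel (gamma_density \<kappa>)" "(\<integral>t. gamma_density \<kappa> t \<partial>lborel) = Gamma \<kappa>"
    by (auto simp: has_bochner_integral_iff)
qed

lemma integral_gamma_measure:
  fixes f :: "real \<Rightarrow> real"
  assumes "\<kappa> > 0" "f \<in> borel_measurable borel"
  shows "(\<integral>t. f t \<partial>gamma_measure \<kappa>) = (\<integral>t. gamma_density \<kappa> t * f t \<partial>lborel) / Gamma \<kappa>"
proof -
  have "(\<integral>t. f t \<partial>gamma_measure \<kappa>) = (\<integral>t. (gamma_density \<kappa> t / Gamma \<kappa>) *\<^sub>R f t \<partial>lborel)"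
    unfolding gamma_measure_def using assms
    by (intro integral_density) (auto simp: gamma_density_nonneg Gamma_real_pos intro!: divide_nonneg_pos)
  then show ?thesis by simp
qed

lemma prob_space_gamma_measure:
  assumes "\<kappa> > 0" shows "prob_space (gamma_measure \<kappa>)"
proof
  have "emeasure (gamma_measure \<kappa>) (space (gamma_measure \<kappa>)) = (\<integral>\<^sup>+t. ennreal (gamma_density \<kappa> t / Gamma \<kappa>) \<partial>lborel)"
    unfolding gamma_measure_def by (subst emeasure_density) auto
  also have "\<dots> = ennreal (\<integral>t. gamma_density \<kappa> t / Gamma \<kappa> \<partial>lborel)"
    using assms gamma_density_integral[OF assms]
    by (intro nn_integral_eq_integral) (auto simp: gamma_density_nonneg Gamma_real_pos intro!: divide_nonneg_pos)
  also have "\<dots> = 1" using gamma_density_integral[OF assms] Gamma_real_pos[OF assms] by simp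
  finally show "emeasure (gamma_measure \<kappa>) (space (gamma_measure \<kappa>)) = 1" .
qed

text \<open>Rescale \<open>t\<close> by \<open>j + 1\<close> in the Gamma integral. The measure
  lives on \<open>t \<ge> 0\<close>, so \<open>max 0 t\<close> agrees with \<open>t\<close> almost
  everywhere, and it keeps \<open>exp (- max 0 t)\<close> in the unit interval for every
  \<open>t\<close>.\<close>

lemma gamma_measure_moment:
  assumes k: "\<kappa> > 0"
  shows "(\<integral>t. exp (- max 0 t) ^ j \<partial>gamma_measure \<kappa>) = real (Suc j) powr (- \<kappa>)"
proof -
  define c where "c = real (Suc j)"
  have c: "c > 0" by (simp add: c_def)
  have eq: "gamma_density \<kappa> t * exp (- max 0 t) ^ j = c powr (1 - \<kappa>) * gamma_density \<kappa> (0 + c * t)" for t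
  proof (cases "t \<ge> 0")
    case True
    have "gamma_density \<kappa> (c * t) = c powr (\<kappa> - 1) * t powr (\<kappa> - 1) / exp (c * t)"
      using True c by (simp add: gamma_density_def powr_mult)
    moreover have "c powr (1 - \<kappa>) * c powr (\<kappa> - 1) = 1" using c by (simp flip: powr_add)
    moreover have "exp (c * t) = exp t * exp (real j * t)" by (simp add: c_def algebra_simps flip: exp_add)
    moreover have "exp (- max 0 t) ^ j = 1 / exp (real j * t)" using True
      by (simp add: exp_minus inverse_eq_divide power_one_over flip: exp_of_nat_mult)
    ultimately show ?thesis using True by (simp add: gamma_density_def mult.assoc[symmetric])
  next
    case False
    then have "c * t < 0" using c by (simp add: mult_pos_neg)
    then show ?thesis using False by (simp add: gamma_density_def)
  qed
  have "(\<integral>t. gamma_density \<kappa> (0 + c * t) \<partial>lborel) = Gamma \<kappa> / c"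
    using lborel_integral_real_affine[of c "gamma_density \<kappa>" 0] gamma_density_integral(2)[OF k] c by (simp add: field_simps)
  moreover have "(\<integral>t. exp (- max 0 t) ^ j \<partial>gamma_measure \<kappa>) = (\<integral>t. gamma_density \<kappa> t * exp (- max 0 t) ^ j \<partial>lborel) / Gamma \<kappa>"
    by (intro integral_gamma_measure k) measurable
  ultimately have "(\<integral>t. exp (- max 0 t) ^ j \<partial>gamma_measure \<kappa>) = c powr (1 - \<kappa>) / c"
    using Gamma_real_pos[OF k] by (simp only: eq integral_mult_right_zero) simp
  also have "\<dots> = c powr (1 - \<kappa> - 1)" using c by (subst powr_diff[of c "1 - \<kappa>" 1]) auto
  finally show ?thesis by (simp add: c_def)
qed

text \<open>The exponentials cancel and leave the integral of \<open>t powr (\<kappa> - 1)\<close>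
  over the unit interval, which is \<open>1 / \<kappa>\<close>. This is where
  \<open>Gamma (\<kappa> + 1)\<close> in the final constants comes from.\<close>

lemma gamma_measure_cutoff:
  assumes k: "\<kappa> > 0"
  shows "(\<integral>t. (if t \<le> 1 then exp (max 0 t) else 0) \<partial>gamma_measure \<kappa>) = 1 / Gamma (\<kappa> + 1)"
proof -
  have "gamma_density \<kappa> t * (if t \<le> 1 then exp (max 0 t) else 0) = indicator {0..1} t * t powr (\<kappa> - 1)" for t
    by (auto simp: gamma_density_def indicator_def)
  moreover have "(\<integral>t. indicator {0..1} t * t powr (\<kappa> - 1) \<partial>lborel) = 1 / \<kappa>"
  proof -
    have "((\<lambda>t. t powr (\<kappa> - 1)) has_integral (1 powr (\<kappa> - 1 + 1) / (\<kappa> - 1 + 1))) {0..1}"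
      using k by (intro has_integral_powr_from_0) auto
    from nn_integral_has_integral_lebesgue[OF _ this]
    have "(\<integral>\<^sup>+t. ennreal (indicator {0..1} t * t powr (\<kappa> - 1)) \<partial>lborel) = ennreal (1 / \<kappa>)" by simp
    then have "has_bochner_integral lborel (\<lambda>t. indicator {0..1} t * t powr (\<kappa> - 1)) (1 / \<kappa>)"
      using k by (intro has_bochner_integral_nn_integral) auto
    then show ?thesis by (simp add: has_bochner_integral_iff)
  qed
  ultimately have "(\<integral>t. (if t \<le> 1 then exp (max 0 t) else 0) \<partial>gamma_measure \<kappa>) = 1 / \<kappa> / Gamma \<kappa>"
    using k by (subst integral_gamma_measure) auto
  also have "\<kappa> * Gamma \<kappa> = Gamma (\<kappa> + 1)"
    using Gamma_plus1[of \<kappa>] k by (auto simp: nonpos_Ints_def)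
  then have "1 / \<kappa> / Gamma \<kappa> = 1 / Gamma (\<kappa> + 1)" by simp
  finally show ?thesis .
qed

locale karamata =
  fixes a :: "nat \<Rightarrow> real" and \<kappa> c :: real
  assumes a_nonneg: "a n \<ge> 0" and a_0: "a 0 = 0" and k: "\<kappa> > 0"
    and a_summable: "\<sigma> > 0 \<Longrightarrow> summable (\<lambda>n. a n * real n powr (- \<sigma>))"
    and a_limit: "((\<lambda>\<sigma>. \<sigma> powr \<kappa> * (\<Sum>n. a n * real n powr (- \<sigma>))) \<longlongrightarrow> c) (at_right 0)"
begin

text \<open>For fixed \<open>\<sigma>\<close> a positive linear functional of the test function
  \<open>h\<close>, whose argument \<open>n powr (- \<sigma>)\<close> runs through the unit
  interval. Its expected limit is \<open>c * I h\<close>; positivity is what carries this from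
  polynomials to less regular functions.\<close>

definition T :: "real \<Rightarrow> (real \<Rightarrow> real) \<Rightarrow> real" where
  "T \<sigma> h = \<sigma> powr \<kappa> * (\<Sum>n. a n * real n powr (- \<sigma>) * h (real n powr (- \<sigma>)))"

definition I :: "(real \<Rightarrow> real) \<Rightarrow> real" where
  "I h = (\<integral>t. h (exp (- max 0 t)) \<partial>gamma_measure \<kappa>)"

lemma ev_pos: "\<forall>\<^sub>F \<sigma> in at_right (0::real). \<sigma> > 0"
  by (simp add: eventually_at_right_less)

lemma u_range: "\<sigma> > 0 \<Longrightarrow> real n powr (- \<sigma>) \<in> {0..1}"
proof (cases "n = 0")
  case False
  assume "\<sigma> > 0"
  then have "real n powr (- \<sigma>) \<le> 1 powr (- \<sigma>)" using False by (intro powr_mono2') auto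
  then show ?thesis by simp
qed simp

lemma summ_bounded:
  assumes "\<sigma> > 0" "\<And>u. u \<in> {0..1} \<Longrightarrow> \<bar>h u\<bar> \<le> B"
  shows "summable (\<lambda>n. a n * real n powr (- \<sigma>) * h (real n powr (- \<sigma>)))"
proof (rule summable_comparison_test'[OF summable_mult2[OF a_summable[OF assms(1)], of B]])
  fix n
  have "\<bar>h (real n powr (- \<sigma>))\<bar> \<le> B" using assms u_range by auto
  then show "norm (a n * real n powr (- \<sigma>) * h (real n powr (- \<sigma>))) \<le> a n * real n powr (- \<sigma>) * B"
    using a_nonneg[of n] by (auto simp: abs_mult intro!: mult_left_mono)
qed

lemma T_mono:
  assumes "\<sigma> > 0" "\<And>u. u \<in> {0..1} \<Longrightarrow> h u \<le> g u" "\<And>u. u \<in> {0..1} \<Longrightarrow> \<bar>h u\<bar> \<le> B" "\<And>u. u \<in> {0..1} \<Longrightarrow> \<bar>g u\<bar> \<le> B'"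
  shows "T \<sigma> h \<le> T \<sigma> g"
  unfolding T_def using a_nonneg u_range[OF assms(1)]
  by (intro mult_left_mono suminf_le summ_bounded[OF assms(1,3)] summ_bounded[OF assms(1,4)] assms(2)) auto

lemma T_diff:
  assumes "\<sigma> > 0" "\<And>u. u \<in> {0..1} \<Longrightarrow> \<bar>h u - g u\<bar> \<le> \<epsilon>" "\<And>u. u \<in> {0..1} \<Longrightarrow> \<bar>h u\<bar> \<le> B" "\<And>u. u \<in> {0..1} \<Longrightarrow> \<bar>g u\<bar> \<le> B'"
  shows "\<bar>T \<sigma> h - T \<sigma> g\<bar> \<le> \<epsilon> * T \<sigma> (\<lambda>_. 1)"
proof -
  have s1: "summable (\<lambda>n. a n * real n powr (- \<sigma>) * h (real n powr (- \<sigma>)))" by (rule summ_bounded[OF assms(1,3)])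
  have s2: "summable (\<lambda>n. a n * real n powr (- \<sigma>) * g (real n powr (- \<sigma>)))" by (rule summ_bounded[OF assms(1,4)])
  have le: "\<bar>a n * real n powr (- \<sigma>) * h (real n powr (- \<sigma>)) - a n * real n powr (- \<sigma>) * g (real n powr (- \<sigma>))\<bar> \<le> \<epsilon> * (a n * real n powr (- \<sigma>))" for n
  proof -
    have "\<bar>a n * real n powr (- \<sigma>) * (h (real n powr (- \<sigma>)) - g (real n powr (- \<sigma>)))\<bar> \<le> a n * real n powr (- \<sigma>) * \<epsilon>"
      using assms(2)[OF u_range[OF assms(1)]] a_nonneg[of n] by (auto simp: abs_mult intro!: mult_left_mono)
    then show ?thesis by (simp add: algebra_simps)
  qed
  have s3: "summable (\<lambda>n. \<bar>a n * real n powr (- \<sigma>) * h (real n powr (- \<sigma>)) - a n * real n powr (- \<sigma>) * g (real n powr (- \<sigma>))\<bar>)"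
    by (rule summable_comparison_test'[OF summable_mult[OF a_summable[OF assms(1)], of \<epsilon>]]) (use le in auto)
  have "T \<sigma> h - T \<sigma> g = \<sigma> powr \<kappa> * (\<Sum>n. a n * real n powr (- \<sigma>) * h (real n powr (- \<sigma>)) - a n * real n powr (- \<sigma>) * g (real n powr (- \<sigma>)))"
    unfolding T_def suminf_diff[OF s1 s2, symmetric] by (simp add: algebra_simps)
  then have "\<bar>T \<sigma> h - T \<sigma> g\<bar> = \<sigma> powr \<kappa> * \<bar>\<Sum>n. a n * real n powr (- \<sigma>) * h (real n powr (- \<sigma>)) - a n * real n powr (- \<sigma>) * g (real n powr (- \<sigma>))\<bar>"
    by (simp add: abs_mult)
  also have "\<dots> \<le> \<sigma> powr \<kappa> * (\<Sum>n. \<epsilon> * (a n * real n powr (- \<sigma>)))"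
    by (intro mult_left_mono order_trans[OF summable_rabs[OF s3]] suminf_le s3 le summable_mult a_summable assms(1)) auto
  also have "\<dots> = \<epsilon> * T \<sigma> (\<lambda>_. 1)"
    unfolding T_def by (subst suminf_mult[OF a_summable[OF assms(1)]]) simp
  finally show ?thesis .
qed

text \<open>Inserting \<open>u ^ j\<close> amounts to replacing \<open>\<sigma>\<close> by
  \<open>(j + 1) * \<sigma>\<close> in the series, so \<open>a_limit\<close> already determines the
  limit.\<close>

lemma T_power: "((\<lambda>\<sigma>. T \<sigma> (\<lambda>u. u ^ j)) \<longlongrightarrow> c * real (Suc j) powr (- \<kappa>)) (at_right 0)"
proof -
  define d where "d = real (Suc j)"
  have d: "d > 0" by (simp add: d_def)
  have "filterlim (\<lambda>\<sigma>. d * \<sigma>) (at_right 0) (at_right 0)"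
    unfolding filterlim_at using d ev_pos by (auto intro!: tendsto_eq_intros simp: eventually_mono)
  from tendsto_mult[OF filterlim_compose[OF a_limit this] tendsto_const[of "d powr (- \<kappa>)"]]
  have "((\<lambda>\<sigma>. (d * \<sigma>) powr \<kappa> * (\<Sum>n. a n * real n powr (- (d * \<sigma>))) * d powr (- \<kappa>)) \<longlongrightarrow> c * d powr (- \<kappa>)) (at_right 0)" .
  moreover have "\<forall>\<^sub>F \<sigma> in at_right 0. (d * \<sigma>) powr \<kappa> * (\<Sum>n. a n * real n powr (- (d * \<sigma>))) * d powr (- \<kappa>) = T \<sigma> (\<lambda>u. u ^ j)"
    using ev_pos
  proof eventually_elim
    case (elim \<sigma>)
    have "a n * real n powr (- (d * \<sigma>)) = a n * real n powr (- \<sigma>) * (real n powr (- \<sigma>)) ^ j" for n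
    proof (cases "n = 0")
      case False
      have "(real n powr (- \<sigma>)) ^ j = real n powr (- \<sigma> * real j)" using False by (simp add: powr_powr flip: powr_realpow)
      then have "real n powr (- \<sigma>) * (real n powr (- \<sigma>)) ^ j = real n powr (- \<sigma> + - \<sigma> * real j)" using False by (simp only: powr_add)
      also have "- \<sigma> + - \<sigma> * real j = - (d * \<sigma>)" by (simp add: d_def algebra_simps)
      finally show ?thesis by (simp add: mult.assoc)
    qed (simp add: a_0)
    moreover have "(d * \<sigma>) powr \<kappa> * d powr (- \<kappa>) = \<sigma> powr \<kappa>" using d elim by (simp add: powr_mult powr_minus)
    moreover have "(d * \<sigma>) powr \<kappa> * S * d powr (- \<kappa>) = ((d * \<sigma>) powr \<kappa> * d powr (- \<kappa>)) * S" for S by simp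
    ultimately show ?case unfolding T_def by (simp only:)
  qed
  ultimately show ?thesis unfolding d_def by (rule Lim_transform_eventually)
qed

lemma T_continuous:
  assumes h: "continuous_on {0..1} h" and hm: "h \<in> borel_measurable borel"
  shows "((\<lambda>\<sigma>. T \<sigma> h) \<longlongrightarrow> c * I h) (at_right 0)"
proof -
  interpret g: prob_space "gamma_measure \<kappa>" by (rule prob_space_gamma_measure[OF k])
  have cpt: "compact {0..1::real}" by simp
  obtain B where B: "\<And>u. u \<in> {0..1} \<Longrightarrow> \<bar>h u\<bar> \<le> B"
    using compact_imp_bounded[OF compact_continuous_image[OF h cpt]] unfolding bounded_iff
    by (metis imageI real_norm_def)
  have mI: "(\<lambda>t. f (exp (- max 0 t))) \<in> borel_measurable (gamma_measure \<kappa>)" if "f \<in> borel_measurable borel" for f :: "real \<Rightarrow> real"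
    using that by measurable
  have er: "exp (- max 0 t) \<in> {0..1}" for t :: real by simp
  have c0: "((\<lambda>\<sigma>. T \<sigma> (\<lambda>_. 1)) \<longlongrightarrow> c) (at_right 0)" using T_power[of 0] by simp
  have "c \<ge> 0"
  proof (rule tendsto_lowerbound[OF c0])
    show "\<forall>\<^sub>F \<sigma> in at_right 0. 0 \<le> T \<sigma> (\<lambda>_. 1)"
      using ev_pos by eventually_elim (auto simp: T_def a_nonneg intro!: mult_nonneg_nonneg suminf_nonneg a_summable)
  qed simp
  show ?thesis
  proof (rule tendstoI)
    fix \<epsilon> :: real assume e: "\<epsilon> > 0"
    \<comment> \<open>Three errors arise: \<open>\<delta> * (c + 1)\<close> from the approximation
      inside \<open>T\<close>, \<open>\<delta>\<close> from the limit for the polynomial, and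
      \<open>c * \<delta>\<close> from the approximation inside \<open>I\<close>.\<close>
    define \<delta> where "\<delta> = \<epsilon> / (2 * c + 4)"
    have d: "\<delta> > 0" "\<delta> * (2 * c + 4) = \<epsilon>" using e \<open>c \<ge> 0\<close> by (auto simp: \<delta>_def)
    obtain P where P: "real_polynomial_function P" "\<And>u. u \<in> {0..1} \<Longrightarrow> \<bar>h u - P u\<bar> < \<delta>"
      using Stone_Weierstrass_real_polynomial_function[OF cpt h d(1)] by auto
    obtain b D where bD: "P = (\<lambda>u. \<Sum>i\<le>D. b i * u ^ i)" using P(1) real_polynomial_function_iff_sum by auto
    have Pb: "\<bar>P u\<bar> \<le> B + \<delta>" if "u \<in> {0..1}" for u using P(2)[OF that] B[OF that] by linarith
    have Pc: "continuous_on A P" for A unfolding bD by (intro continuous_intros)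
    have Pm: "P \<in> borel_measurable borel" by (intro borel_measurable_continuous_onI Pc)
    have IP: "I P = (\<Sum>i\<le>D. b i * real (Suc i) powr (- \<kappa>))"
    proof -
      have "integrable (gamma_measure \<kappa>) (\<lambda>t. exp (- max 0 t) ^ i)" for i
        by (rule g.integrable_const_bound[of _ 1]) (auto intro!: mI simp: power_le_one)
      then show ?thesis unfolding I_def bD
        by (subst Bochner_Integration.integral_sum) (auto simp: gamma_measure_moment[OF k])
    qed
    have TP: "\<forall>\<^sub>F \<sigma> in at_right 0. T \<sigma> P = (\<Sum>i\<le>D. b i * T \<sigma> (\<lambda>u. u ^ i))"
      using ev_pos
    proof eventually_elim
      case (elim \<sigma>)
      have s: "summable (\<lambda>n. a n * real n powr (- \<sigma>) * (real n powr (- \<sigma>)) ^ i)" for i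
        by (rule summ_bounded[OF elim, of "\<lambda>u. u ^ i" 1]) (auto simp: power_le_one)
      have "(\<Sum>n. a n * real n powr (- \<sigma>) * P (real n powr (- \<sigma>))) = (\<Sum>n. \<Sum>i\<le>D. b i * (a n * real n powr (- \<sigma>) * (real n powr (- \<sigma>)) ^ i))"
        unfolding bD by (simp add: sum_distrib_left mult_ac)
      also have "\<dots> = (\<Sum>i\<le>D. \<Sum>n. b i * (a n * real n powr (- \<sigma>) * (real n powr (- \<sigma>)) ^ i))"
        by (intro suminf_sum summable_mult s)
      also have "\<dots> = (\<Sum>i\<le>D. b i * (\<Sum>n. (a n * real n powr (- \<sigma>) * (real n powr (- \<sigma>)) ^ i)))"
        by (intro sum.cong refl suminf_mult s)
      finally show ?case by (simp add: T_def sum_distrib_left mult_ac)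
    qed
    have "((\<lambda>\<sigma>. \<Sum>i\<le>D. b i * T \<sigma> (\<lambda>u. u ^ i)) \<longlongrightarrow> (\<Sum>i\<le>D. b i * (c * real (Suc i) powr (- \<kappa>)))) (at_right 0)"
      by (intro tendsto_intros T_power)
    also have "(\<Sum>i\<le>D. b i * (c * real (Suc i) powr (- \<kappa>))) = c * I P" by (simp add: IP sum_distrib_left mult_ac)
    finally have lim: "((\<lambda>\<sigma>. \<Sum>i\<le>D. b i * T \<sigma> (\<lambda>u. u ^ i)) \<longlongrightarrow> c * I P) (at_right 0)" .
    have II: "\<bar>I h - I P\<bar> \<le> \<delta>"
    proof -
      have i1: "integrable (gamma_measure \<kappa>) (\<lambda>t. h (exp (- max 0 t)))"
        by (rule g.integrable_const_bound[of _ B]) (use B er mI[OF hm] in auto)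
      have i2: "integrable (gamma_measure \<kappa>) (\<lambda>t. P (exp (- max 0 t)))"
        by (rule g.integrable_const_bound[of _ "B + \<delta>"]) (use Pb er mI[OF Pm] in auto)
      have "I h - I P = (\<integral>t. h (exp (- max 0 t)) - P (exp (- max 0 t)) \<partial>gamma_measure \<kappa>)"
        unfolding I_def by (rule Bochner_Integration.integral_diff[OF i1 i2, symmetric])
      also have "norm \<dots> \<le> (\<integral>t. norm (h (exp (- max 0 t)) - P (exp (- max 0 t))) \<partial>gamma_measure \<kappa>)" by (rule integral_norm_bound)
      also have "\<dots> \<le> \<delta>"
        using P(2)[OF er] by (intro g.integral_le_const integrable_norm Bochner_Integration.integrable_diff i1 i2) (auto simp: less_imp_le)
      finally show ?thesis by simp
    qed
    have cI: "c * \<bar>I h - I P\<bar> \<le> c * \<delta>" using II \<open>c \<ge> 0\<close> by (intro mult_left_mono)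
    have "\<forall>\<^sub>F \<sigma> in at_right 0. dist (\<Sum>i\<le>D. b i * T \<sigma> (\<lambda>u. u ^ i)) (c * I P) < \<delta>" using lim d(1) by (rule tendstoD)
    moreover have "\<forall>\<^sub>F \<sigma> in at_right 0. dist (T \<sigma> (\<lambda>_. 1)) c < 1" using c0 by (rule tendstoD) simp
    ultimately show "\<forall>\<^sub>F \<sigma> in at_right 0. dist (T \<sigma> h) (c * I h) < \<epsilon>"
      using TP ev_pos
    proof eventually_elim
      case (elim \<sigma>)
      have "\<bar>T \<sigma> h - T \<sigma> P\<bar> \<le> \<delta> * T \<sigma> (\<lambda>_. 1)"
        using P(2) B Pb by (intro T_diff[OF elim(4)]) (auto simp: less_imp_le)
      also have "\<dots> \<le> \<delta> * (c + 1)" using elim(2) d by (intro mult_left_mono) (auto simp: dist_real_def)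
      finally have 1: "\<bar>T \<sigma> h - T \<sigma> P\<bar> \<le> \<delta> * (c + 1)" .
      have 2: "\<bar>T \<sigma> P - c * I P\<bar> < \<delta>" using elim(1,3) by (simp add: dist_real_def)
      have 3: "\<bar>c * I P - c * I h\<bar> \<le> c * \<delta>" using cI \<open>c \<ge> 0\<close> by (simp add: abs_mult abs_minus_commute flip: right_diff_distrib)
      have "\<bar>T \<sigma> h - c * I h\<bar> < \<delta> * (c + 1) + \<delta> + c * \<delta>" using 1 2 3 by linarith
      also have "\<dots> < \<epsilon>" using d by (simp add: algebra_simps)
      finally show ?case by (simp add: dist_real_def)
    qed
  qed
qed

text \<open>For \<open>\<sigma> = 1 / ln N\<close> the condition \<open>exp (-1) \<le> n powr (-\<sigma>)\<close> means \<open>n \<le> N\<close>, so \<open>cut\<close> turns \<open>T\<close> into a partial sum.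
  The continuous functions \<open>ramp\<close> approximate \<open>cut\<close> from below (\<open>b = 0\<close>) and from above (\<open>b = 1\<close>).\<close>

definition cut :: "real \<Rightarrow> real" where
  "cut u = (if exp (-1) \<le> u then 1 / u else 0)"

definition ramp :: "real \<Rightarrow> real \<Rightarrow> nat \<Rightarrow> real \<Rightarrow> real" where
  "ramp e b m u = min 1 (max 0 (b + real m * (u - e))) / max u e"

lemma I_ramp:
  assumes "b = 0 \<or> b = 1"
  shows "(\<lambda>m. I (ramp (exp (-1)) b m)) \<longlonglongrightarrow> 1 / Gamma (\<kappa> + 1)"
proof -
  interpret g: prob_space "gamma_measure \<kappa>" by (rule prob_space_gamma_measure[OF k])
  have "(\<lambda>m. I (ramp (exp (-1)) b m)) \<longlonglongrightarrow> (\<integral>t. (if t \<le> 1 then exp (max 0 t) else 0) \<partial>gamma_measure \<kappa>)"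
    unfolding I_def
  proof (rule integral_dominated_convergence[where w = "\<lambda>_. exp 1"])
    show "(\<lambda>t. if t \<le> 1 then exp (max 0 t) else 0) \<in> borel_measurable (gamma_measure \<kappa>)" by measurable
    show "(\<lambda>t. ramp (exp (- 1)) b m (exp (- max 0 t))) \<in> borel_measurable (gamma_measure \<kappa>)" for m
      unfolding ramp_def by measurable
    show "AE t in gamma_measure \<kappa>. norm (ramp (exp (- 1)) b m (exp (- max 0 t))) \<le> exp 1" for m
    proof (intro AE_I2)
      fix t :: real
      have "norm (ramp (exp (- 1)) b m (exp (- max 0 t))) = min 1 (max 0 (b + real m * (exp (- max 0 t) - exp (-1)))) / max (exp (- max 0 t)) (exp (-1))"
        by (simp add: ramp_def abs_of_nonneg max.coboundedI2)
      also have "\<dots> \<le> 1 / exp (-1)" by (intro frac_le) auto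
      also have "\<dots> = exp (1::real)" by (simp add: exp_minus field_simps)
      finally show "norm (ramp (exp (- 1)) b m (exp (- max 0 t))) \<le> exp 1" .
    qed
    \<comment> \<open>At \<open>t = 1\<close> the ramps keep the value \<open>b * exp 1\<close> for
      all \<open>m\<close>, which is the wrong limit for \<open>b = 0\<close>; this single point has
      measure 0.\<close>
    have "AE t in lborel. t \<noteq> (1::real)" by (rule AE_lborel_singleton)
    then have "AE t in gamma_measure \<kappa>. t \<noteq> 1" unfolding gamma_measure_def by (subst AE_density) auto
    then show "AE t in gamma_measure \<kappa>. (\<lambda>m. ramp (exp (- 1)) b m (exp (- max 0 t))) \<longlonglongrightarrow> (if t \<le> 1 then exp (max 0 t) else 0)"
    proof eventually_elim
      case (elim t)
      define y where "y = exp (- max 0 t) - exp (-1 :: real)"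
      show ?case
      proof (cases "t < 1")
        case True
        then have y: "y > 0" by (simp add: y_def)
        have "filterlim (\<lambda>m. b + real m * y) at_top sequentially"
          using y by real_asymp
        then have "\<forall>\<^sub>F m in sequentially. b + real m * y \<ge> 1" by (simp add: filterlim_at_top)
        then have "\<forall>\<^sub>F m in sequentially. ramp (exp (- 1)) b m (exp (- max 0 t)) = exp (max 0 t)"
        proof eventually_elim
          case (elim m)
          have "max (exp (- max 0 t)) (exp (- 1)) = exp (- max 0 t)" using y by (simp add: y_def)
          moreover have "min 1 (max 0 (b + real m * (exp (- max 0 t) - exp (- 1)))) = 1"
            using elim unfolding y_def by linarith
          ultimately have "ramp (exp (- 1)) b m (exp (- max 0 t)) = 1 / exp (- max 0 t)" by (simp only: ramp_def)
          also have "\<dots> = exp (max 0 t)" by (simp add: exp_minus divide_inverse)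
          finally show ?case .
        qed
        then show ?thesis using True by (simp add: tendsto_eventually)
      next
        case False
        then have t1: "t > 1" using elim by simp
        then have y: "y < 0" by (simp add: y_def)
        have "filterlim (\<lambda>m. b + real m * y) at_bot sequentially"
          using y by real_asymp
        then have "\<forall>\<^sub>F m in sequentially. b + real m * y \<le> 0" by (simp add: filterlim_at_bot)
        then have "\<forall>\<^sub>F m in sequentially. ramp (exp (- 1)) b m (exp (- max 0 t)) = 0"
          by eventually_elim (simp add: ramp_def y_def)
        then show ?thesis using t1 by (simp add: tendsto_eventually)
      qed
    qed
  qed simp
  then show ?thesis by (simp only: gamma_measure_cutoff[OF k])
qed

lemma ramp_bounds:
  assumes "b = 0 \<or> b = 1" "u \<in> {0..1}"
  shows "\<bar>ramp (exp (-1)) b m u\<bar> \<le> exp 1"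
proof -
  have "\<bar>ramp (exp (-1)) b m u\<bar> = min 1 (max 0 (b + real m * (u - exp (-1)))) / max u (exp (-1))"
    by (simp add: ramp_def max.coboundedI2)
  also have "\<dots> \<le> 1 / exp (-1)" by (intro frac_le) auto
  also have "\<dots> = exp (1::real)" by (simp add: exp_minus field_simps)
  finally show ?thesis .
qed

lemma cut_bounds: "u \<in> {0..1} \<Longrightarrow> \<bar>cut u\<bar> \<le> exp 1"
proof -
  assume "u \<in> {0..1}"
  have "\<bar>cut u\<bar> \<le> 1 / exp (-1)" using \<open>u \<in> _\<close> by (auto simp: cut_def intro!: frac_le)
  also have "\<dots> = exp (1::real)" by (simp add: exp_minus field_simps)
  finally show ?thesis .
qed

lemma ramp_ge_cut: "cut u \<le> ramp (exp (-1)) 1 m u"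
  by (cases "exp (-1) \<le> u") (auto simp: cut_def ramp_def max.coboundedI2)

lemma ramp_le_cut: "ramp (exp (-1)) 0 m u \<le> cut u"
proof (cases "exp (-1) \<le> u")
  case True
  then have "u > 0" using exp_gt_zero[of "-1::real"] by linarith
  then show ?thesis using True by (auto simp: cut_def ramp_def intro!: divide_right_mono)
next
  case False
  then have "real m * (u - exp (-1)) \<le> 0" by (intro mult_nonneg_nonpos) auto
  then show ?thesis using False by (simp add: cut_def ramp_def max_def)
qed

lemma T_ramp: "((\<lambda>\<sigma>. T \<sigma> (ramp (exp (-1)) b m)) \<longlongrightarrow> c * I (ramp (exp (-1)) b m)) (at_right 0)"
proof (rule T_continuous)
  show "continuous_on {0..1} (ramp (exp (- 1)) b m)"
    unfolding ramp_def by (intro continuous_intros) (auto simp: max_def)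
  show "ramp (exp (- 1)) b m \<in> borel_measurable borel" unfolding ramp_def by measurable
qed

lemma T_cut: "((\<lambda>\<sigma>. T \<sigma> cut) \<longlongrightarrow> c / Gamma (\<kappa> + 1)) (at_right 0)"
proof (rule tendstoI)
  fix \<epsilon> :: real assume e: "\<epsilon> > 0"
  have R: "\<forall>\<^sub>F m in sequentially. dist (c * I (ramp (exp (-1)) b m)) (c / Gamma (\<kappa> + 1)) < \<epsilon>/2" if "b = 0 \<or> b = 1" for b
    using tendstoD[OF tendsto_mult[OF tendsto_const I_ramp[OF that], of c], of "\<epsilon>/2"] e by simp
  obtain m where m: "dist (c * I (ramp (exp (-1)) 0 m)) (c / Gamma (\<kappa> + 1)) < \<epsilon>/2" "dist (c * I (ramp (exp (-1)) 1 m)) (c / Gamma (\<kappa> + 1)) < \<epsilon>/2"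
    using eventually_happens[OF eventually_conj[OF R[of 0] R[of 1]]] by auto
  have "\<forall>\<^sub>F \<sigma> in at_right 0. dist (T \<sigma> (ramp (exp (-1)) b m)) (c * I (ramp (exp (-1)) b m)) < \<epsilon>/2" for b
    using T_ramp e by (intro tendstoD) auto
  from this[of 0] this[of 1] ev_pos show "\<forall>\<^sub>F \<sigma> in at_right 0. dist (T \<sigma> cut) (c / Gamma (\<kappa> + 1)) < \<epsilon>"
  proof eventually_elim
    case (elim \<sigma>)
    have "T \<sigma> cut \<le> T \<sigma> (ramp (exp (-1)) 1 m)"
      by (rule T_mono[OF elim(3), of _ _ "exp 1" "exp 1"]) (use ramp_ge_cut cut_bounds ramp_bounds in auto)
    moreover have "T \<sigma> (ramp (exp (-1)) 0 m) \<le> T \<sigma> cut"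
      by (rule T_mono[OF elim(3), of _ _ "exp 1" "exp 1"]) (use ramp_le_cut cut_bounds ramp_bounds in auto)
    ultimately show ?case using elim m unfolding dist_real_def by linarith
  qed
qed

theorem karamata: "(\<lambda>N. (\<Sum>n=1..N. a n) / ln (real N) powr \<kappa>) \<longlonglongrightarrow> c / Gamma (\<kappa> + 1)"
proof -
  have "filterlim (\<lambda>N. 1 / ln (real N)) (at_right 0) sequentially" by real_asymp
  from filterlim_compose[OF T_cut this]
  have "(\<lambda>N. T (1 / ln (real N)) cut) \<longlonglongrightarrow> c / Gamma (\<kappa> + 1)" .
  moreover have "\<forall>\<^sub>F N in sequentially. T (1 / ln (real N)) cut = (\<Sum>n=1..N. a n) / ln (real N) powr \<kappa>"
    using eventually_gt_at_top[of 1]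
  proof eventually_elim
    case (elim N)
    define \<sigma> where "\<sigma> = 1 / ln (real N)"
    have L: "ln (real N) > 0" using elim by simp
    have s: "\<sigma> > 0" using L by (simp add: \<sigma>_def)
    have "a n * real n powr (- \<sigma>) * cut (real n powr (- \<sigma>)) = (if n \<in> {1..N} then a n else 0)" for n
    proof (cases "n = 0")
      case False
      then have n: "real n > 0" by simp
      have "exp (-1) \<le> real n powr (- \<sigma>) \<longleftrightarrow> \<sigma> * ln (real n) \<le> 1" using n by (simp add: powr_def)
      also have "\<dots> \<longleftrightarrow> ln (real n) \<le> ln (real N)" using L by (simp add: \<sigma>_def field_simps)
      also have "\<dots> \<longleftrightarrow> n \<le> N" using n elim by simp
      finally show ?thesis using n False by (auto simp: cut_def)
    qed (simp add: a_0)
    then have "(\<Sum>n. a n * real n powr (- \<sigma>) * cut (real n powr (- \<sigma>))) = (\<Sum>n. if n \<in> {1..N} then a n else 0)" by simp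
    also have "\<dots> = (\<Sum>n=1..N. a n)" by (subst suminf_finite[of "{1..N}"]) auto
    finally have "T \<sigma> cut = \<sigma> powr \<kappa> * (\<Sum>n=1..N. a n)" by (simp only: T_def)
    then show ?case using L by (simp add: \<sigma>_def powr_divide)
  qed
  ultimately show ?thesis by (simp add: tendsto_cong)
qed

end

lemma (in euler_conv) partial_sum_asymp:
  "(\<lambda>N. (\<Sum>n=1..N. mult_fun w n / real n) / ln (real N) powr \<kappa>) \<longlonglongrightarrow> H 0 / Gamma (\<kappa> + 1)"
proof -
  have nn: "mult_fun w n \<ge> 0" for n by (intro mult_fun_nonneg w_nonneg)
  have eq: "mult_fun w n / real n * real n powr (- \<sigma>) = mult_fun w n * real n powr (- (1 + \<sigma>))" for n \<sigma>
  proof (cases "n = 0")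
    case False
    have "real n powr (- (1 + \<sigma>)) = real n powr (-1 + - \<sigma>)" by simp
    also have "\<dots> = real n powr (-1) * real n powr (- \<sigma>)" by (rule powr_add)
    also have "real n powr (-1) = 1 / real n" using False by (simp add: powr_minus inverse_eq_divide)
    finally show ?thesis by simp
  qed simp
  interpret K: karamata "\<lambda>n. mult_fun w n / real n" \<kappa> "H 0"
  proof
    show "summable (\<lambda>n. mult_fun w n / real n * real n powr (- \<sigma>))" if "\<sigma> > 0" for \<sigma>
      unfolding eq
    \<comment> \<open>The Tauberian theorem asks for convergence at every
      \<open>\<sigma> > 0\<close>, whereas the Euler product was controlled up to 1; beyond that the
      series is compared with its value at 1.\<close>
    proof (cases "\<sigma> \<le> 1")
      case False
      show "summable (\<lambda>n. mult_fun w n * real n powr (- (1 + \<sigma>)))"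
      proof (rule summable_comparison_test'[OF dirichlet_summable[of 1]])
        fix n :: nat
        show "norm (mult_fun w n * real n powr (- (1 + \<sigma>))) \<le> mult_fun w n * real n powr (- (1 + 1))"
          using nn[of n] False by (cases "n = 0") (auto simp: abs_mult intro!: mult_left_mono powr_mono)
      qed auto
    qed (use that dirichlet_summable in auto)
    show "((\<lambda>\<sigma>. \<sigma> powr \<kappa> * (\<Sum>n. mult_fun w n / real n * real n powr (- \<sigma>))) \<longlongrightarrow> H 0) (at_right 0)"
      unfolding eq by (rule dirichlet_limit)
  qed (use nn k in auto)
  show ?thesis by (rule K.karamata)
qed

text \<open>To first order \<open>(1 - x) powr \<kappa>\<close> cancels
  \<open>1 + \<kappa> * x\<close>. From above one uses
  \<open>(1 - x) powr \<kappa> \<le> exp (- \<kappa> * x)\<close> and the second Taylor polynomial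
  of the exponential, from below Bernoulli's inequality as long as
  \<open>\<kappa> * x \<le> 1\<close>. Otherwise \<open>(\<kappa> * x)\<^sup>2 \<ge> 1\<close>, and
  the lower estimate is trivial.\<close>

lemma euler_factor_bound:
  fixes \<kappa> x e :: real
  assumes k: "\<kappa> \<ge> 1" and x: "0 \<le> x" "x \<le> 1/2" and e: "e \<ge> 0"
  shows "\<bar>(1 - x) powr \<kappa> * (1 + \<kappa> * x + e) - 1\<bar> \<le> e + (\<kappa>\<^sup>2 + \<kappa>^3) * x\<^sup>2"
proof -
  define y where "y = (1 - x) powr \<kappa>"
  have y0: "y \<ge> 0" by (simp add: y_def)
  have y1: "y \<le> 1" unfolding y_def using k x by (intro powr_le1) auto
  have "ln (1 - x) \<le> - x" using x ln_le_minus_one[of "1 - x"] by simp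
  then have "\<kappa> * ln (1 - x) \<le> \<kappa> * (- x)" using k by (intro mult_left_mono) auto
  moreover have "y = exp (\<kappa> * ln (1 - x))" using x by (simp add: y_def powr_def)
  ultimately have "y \<le> exp (- (\<kappa> * x))" by simp
  also have "\<dots> \<le> 1 - \<kappa> * x + (\<kappa> * x)\<^sup>2 / 2"
  proof -
    define v where "v = \<kappa> * x"
    have v: "v \<ge> 0" using k x by (simp add: v_def)
    have "1 - 0 + 0\<^sup>2/2 - exp (- (0::real)) \<le> 1 - v + v\<^sup>2/2 - exp (- v)"
    proof (rule DERIV_nonneg_imp_nondecreasing[OF v])
      fix z :: real assume "0 \<le> z"
      have "((\<lambda>v. 1 - v + v\<^sup>2/2 - exp (- v)) has_real_derivative (- 1 + z + exp (- z))) (at z)"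
        by (auto intro!: derivative_eq_intros)
      moreover have "- 1 + z + exp (- z) \<ge> 0" using exp_ge_add_one_self[of "- z"] by linarith
      ultimately show "\<exists>y. ((\<lambda>v. 1 - v + v\<^sup>2/2 - exp (- v)) has_real_derivative y) (at z) \<and> 0 \<le> y" by blast
    qed
    then show ?thesis by (simp add: v_def)
  qed
  finally have yu: "y \<le> 1 - \<kappa> * x + (\<kappa> * x)\<^sup>2 / 2" .
  have kx: "\<kappa> * x \<ge> 0" using k x by simp
  have "y * (1 + \<kappa> * x + e) - 1 \<le> e + (\<kappa>\<^sup>2 + \<kappa>^3) * x\<^sup>2"
  proof -
    have "y * (1 + \<kappa> * x) \<le> (1 - \<kappa> * x + (\<kappa> * x)\<^sup>2 / 2) * (1 + \<kappa> * x)"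
      using yu kx by (intro mult_right_mono) auto
    also have "\<dots> = 1 - (\<kappa> * x)\<^sup>2 / 2 + (\<kappa>^3 * x\<^sup>2) * (x / 2)"
      by (simp add: power2_eq_square power3_eq_cube field_simps)
    also have "\<dots> \<le> 1 + (\<kappa>^3 * x\<^sup>2) * 1" using x k by (intro add_mono mult_left_mono) auto
    finally have "y * (1 + \<kappa> * x) \<le> 1 + \<kappa>^3 * x\<^sup>2" by simp
    moreover have "y * e \<le> e" using y1 e by (simp add: mult_left_le_one_le y0)
    moreover have "\<kappa>\<^sup>2 * x\<^sup>2 \<ge> 0" by simp
    ultimately show ?thesis
      unfolding distrib_left[of y "1 + \<kappa> * x"] distrib_right[of "\<kappa>\<^sup>2"] by linarith
  qed
  moreover have "- (e + (\<kappa>\<^sup>2 + \<kappa>^3) * x\<^sup>2) \<le> y * (1 + \<kappa> * x + e) - 1"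
  proof (cases "\<kappa> * x \<le> 1")
    case True
    have "1 + \<kappa> * (- x) \<le> y"
    proof -
      have "1 - x > 0" using x by simp
      have "\<kappa> * x \<le> 1" by (rule True)
      have "(1 - \<kappa> * x) powr (1/\<kappa>) * 1 powr (1 - 1/\<kappa>) \<le> (1/\<kappa>) * (1 - \<kappa> * x) + (1 - 1/\<kappa>) * 1" if "\<kappa> * x < 1"
        using k that by (intro Youngs_inequality_0) auto
      moreover have "(1/\<kappa>) * (1 - \<kappa> * x) + (1 - 1/\<kappa>) * 1 = 1 - x" using k by (simp add: field_simps)
      ultimately have "(1 - \<kappa> * x) powr (1/\<kappa>) \<le> 1 - x" using x True by (cases "\<kappa> * x < 1") auto
      then have "((1 - \<kappa> * x) powr (1/\<kappa>)) powr \<kappa> \<le> y" unfolding y_def using k by (intro powr_mono2) auto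
      then show ?thesis using k True by (simp add: powr_powr)
    qed
    then have "(1 - \<kappa> * x) * (1 + \<kappa> * x) \<le> y * (1 + \<kappa> * x)" using kx by (intro mult_right_mono) auto
    moreover have "(1 - \<kappa> * x) * (1 + \<kappa> * x) = 1 - \<kappa>\<^sup>2 * x\<^sup>2" by (simp add: power2_eq_square algebra_simps)
    moreover have "y * e \<ge> 0" "\<kappa>^3 * x\<^sup>2 \<ge> 0" using y0 e k by auto
    ultimately show ?thesis using e by (simp add: algebra_simps)
  next
    case False
    then have "1 \<le> (\<kappa> * x)\<^sup>2" by (intro one_le_power) auto
    moreover have "y * (1 + \<kappa> * x + e) \<ge> 0" using y0 k x e by (intro mult_nonneg_nonneg add_nonneg_nonneg) auto
    moreover have "\<kappa>^3 * x\<^sup>2 \<ge> 0" using k by auto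
    ultimately show ?thesis using e by (simp add: algebra_simps power_mult_distrib)
  qed
  ultimately show ?thesis unfolding y_def by linarith
qed

subsection \<open>The upper bound\<close>

text \<open>Splitting weights of total mass at most 1. Since \<open>splitting_weight p 1\<close> tends to 1, the weight of a prime
  \<open>p\<close> in \<open>upper_weight\<close> is \<open>k + O(1 / sqrt p)\<close>, so the weighted sums have logarithmic exponent exactly \<open>k\<close>;
  the wasteful constants only affect small primes, and those are collected in \<open>A\<close>.\<close>

definition splitting_weight :: "nat \<Rightarrow> nat \<Rightarrow> real" where
  "splitting_weight p j = (if j = 1 then 1 - 1 / sqrt p else (3/4) ^ (j - 2) / (4 * sqrt p))"

definition upper_weight :: "nat set \<Rightarrow> real \<Rightarrow> nat \<Rightarrow> nat \<Rightarrow> real" where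
  "upper_weight A k p j = (if j = 0 then 1 else if p \<in> A then 0 else k / splitting_weight p j)"

lemma sqrt_prime_gt_1: "prime p \<Longrightarrow> sqrt (real p) > 1"
  using prime_gt_1_nat[of p] by simp

lemma splitting_weight_pos: "prime p \<Longrightarrow> splitting_weight p j > 0"
  using sqrt_prime_gt_1[of p] by (simp add: splitting_weight_def field_simps)

text \<open>The geometric series of ratio \<open>3/4\<close> sums to 4, so the exponents
  \<open>j \<ge> 2\<close> together use exactly the mass \<open>1 / sqrt p\<close> withheld from
  \<open>j = 1\<close>.\<close>

lemma splitting_weight_sum:
  assumes p: "prime p" shows "(\<Sum>j=1..J. splitting_weight p j) \<le> 1"
proof -
  have s: "sqrt (real p) > 1" by (rule sqrt_prime_gt_1[OF p])
  have "(\<Sum>j=1..J. splitting_weight p j) \<le> (\<Sum>j\<in>insert 1 {2..<J + 2}. splitting_weight p j)"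
    by (intro sum_mono2) (auto simp: less_imp_le splitting_weight_pos[OF p])
  also have "\<dots> = (1 - 1 / sqrt p) + (\<Sum>j\<in>{2..<J + 2}. splitting_weight p j)" by (simp add: splitting_weight_def)
  also have "(\<Sum>j\<in>{2..<J + 2}. splitting_weight p j) = (\<Sum>i<J. (3/4) ^ i / (4 * sqrt p))"
    by (rule sum.reindex_bij_witness[of _ "\<lambda>i. i + 2" "\<lambda>j. j - 2"]) (auto simp: splitting_weight_def)
  also have "\<dots> = (\<Sum>i<J. (3/4) ^ i) / (4 * sqrt p)" by (simp add: sum_divide_distrib)
  also have "\<dots> \<le> 4 / (4 * sqrt p)"
  proof (rule divide_right_mono)
    have "(\<Sum>i<J. (3/4) ^ i) = (1 - (3/4)^J) / (1 - 3/4 :: real)" by (subst sum_gp_strict) auto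
    also have "\<dots> \<le> 4" by simp
    finally show "(\<Sum>i<J. (3/4) ^ i) \<le> (4::real)" .
  qed simp
  finally show ?thesis by simp
qed

lemma upper_weight_norm_le:
  assumes k: "k \<ge> 1" and p: "prime p" "p \<notin> A"
  shows "(Lnorm circle (2 * k) (\<lambda>y. \<Sum>j\<le>J. a j * e1 y ^ j))\<^sup>2 \<le> (\<Sum>j\<le>J. upper_weight A k p j * (cmod (a j))\<^sup>2)"
proof -
  have "(Lnorm circle (2 * k) (\<lambda>y. \<Sum>j\<le>J. a j * e1 y ^ j))\<^sup>2 \<le> (cmod (a 0))\<^sup>2 + (\<Sum>j=1..J. k / splitting_weight p j * (cmod (a j))\<^sup>2)"
    by (rule circle.polynomial_norm_le[OF k]) (use splitting_weight_pos[OF p(1)] splitting_weight_sum[OF p(1)] in auto)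
  also have "\<dots> = (\<Sum>j\<le>J. upper_weight A k p j * (cmod (a j))\<^sup>2)"
  proof -
    have "{..J} = insert 0 {1..J}" by auto
    then show ?thesis using p by (simp add: upper_weight_def)
  qed
  finally show ?thesis .
qed

text \<open>The reciprocals of the splitting weights grow like \<open>(4/3) ^ j\<close>. For
  \<open>x \<le> 1/2\<close> the tail is therefore geometric with ratio at most \<open>2/3\<close>,
  even at the prime 2; this is why the splitting weights decay with a ratio above
  \<open>1/2\<close>.\<close>

lemma euler_factor_upper_weight:
  assumes p: "prime p" "p \<notin> A" and x: "0 \<le> real p powr t" "real p powr t \<le> 1/2"
  defines "x \<equiv> real p powr t"
  shows "(\<lambda>j. upper_weight A k p j * x ^ j) sums (1 + k / (1 - 1 / sqrt p) * x + 4 * k * sqrt p * x\<^sup>2 / (1 - 4/3 * x))"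
proof -
  have "norm (4/3 * x) < 1" using x by (simp add: x_def)
  from sums_mult[OF geometric_sums[OF this], of "4 * k * sqrt p * x\<^sup>2"]
  have "(\<lambda>j. 4 * k * sqrt p * x\<^sup>2 * (4/3 * x) ^ j) sums (4 * k * sqrt p * x\<^sup>2 / (1 - 4/3 * x))" by simp
  also have "(\<lambda>j. 4 * k * sqrt p * x\<^sup>2 * (4/3 * x) ^ j) = (\<lambda>j. upper_weight A k p (Suc (Suc j)) * x ^ Suc (Suc j))"
  proof
    fix j
    have "k / ((3/4) ^ j / (4 * sqrt p)) = 4 * k * sqrt p * (4/3) ^ j"
      by (simp add: power_divide field_simps)
    then have W: "upper_weight A k p (Suc (Suc j)) = 4 * k * sqrt p * (4/3) ^ j"
      using p by (simp add: upper_weight_def splitting_weight_def)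
    show "4 * k * sqrt p * x\<^sup>2 * (4/3 * x) ^ j = upper_weight A k p (Suc (Suc j)) * x ^ Suc (Suc j)"
      unfolding W power_mult_distrib[of "4/3" x] by (simp add: power2_eq_square)
  qed
  finally have "(\<lambda>j. upper_weight A k p (Suc (Suc j)) * x ^ Suc (Suc j)) sums (4 * k * sqrt p * x\<^sup>2 / (1 - 4/3 * x))" .
  from sums_Suc[OF sums_Suc[OF this]] show ?thesis using p by (simp add: upper_weight_def splitting_weight_def algebra_simps)
qed

lemma euler_conv_upper_weight:
  assumes k: "k \<ge> 1" and A: "finite A"
  shows "\<exists>C. euler_conv (upper_weight A k) k C"
proof -
  \<comment> \<open>The \<open>26 * k\<close> is made of \<open>14 * k\<close> from the weight at
    \<open>j = 1\<close> and \<open>12 * k\<close> from the higher exponents;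
    \<open>k\<^sup>2 + k^3\<close> comes from \<open>euler_factor_bound\<close>. The sum over
    \<open>A\<close> pays for the deleted primes, whose normalised Euler factor is merely within
    distance 1 of 1.\<close>
  define C where "C = 26 * k + (k\<^sup>2 + k^3) + (\<Sum>p\<in>A. real p powr (3/2))"
  have Cn: "26 * k + (k\<^sup>2 + k^3) \<le> C" using k by (auto simp: C_def intro!: sum_nonneg)
  have "euler_conv (upper_weight A k) k C"
  proof
    fix p j :: nat assume p: "prime p"
    show "upper_weight A k p j \<ge> 0" using k splitting_weight_pos[OF p, of j] by (simp add: upper_weight_def)
    show "upper_weight A k p 0 = 1" by (simp add: upper_weight_def)
    have x: "0 \<le> real p powr (-1)" "real p powr (-1) \<le> 1/2" using prime_powr_less_1[OF p, of 0] by auto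
    show "summable (\<lambda>j. upper_weight A k p j * (real p powr (- 1)) ^ j)"
    proof (cases "p \<in> A")
      case True
      show ?thesis by (rule summable_finite[of "{0}"]) (use True in \<open>auto simp: upper_weight_def\<close>)
    next
      case False
      show ?thesis using euler_factor_upper_weight[OF p False x, of k] by (rule sums_summable)
    qed
    fix \<sigma> :: real assume s: "0 \<le> \<sigma>" "\<sigma> \<le> 1"
    define x where "x = real p powr (- (1 + \<sigma>))"
    have x: "0 < x" "x \<le> 1/2" unfolding x_def using prime_powr_less_1[OF p s(1)] by auto
    have p2: "real p \<ge> 2" using prime_ge_2_nat[OF p] by simp
    have xp: "x \<le> 1 / real p"
    proof -
      have "x \<le> real p powr (-1)" unfolding x_def using p2 s by (intro powr_mono) auto
      then show ?thesis using p2 by (simp add: powr_minus inverse_eq_divide)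
    qed
    have p32: "real p powr (- (3/2)) = 1 / (real p * sqrt p)"
    proof -
      have "real p powr (3/2) = real p powr (1 + 1/2)" by simp
      also have "\<dots> = real p * sqrt p" using p2 by (subst powr_add) (simp add: powr_half_sqrt)
      finally show ?thesis by (simp add: powr_minus inverse_eq_divide)
    qed
    have sq: "sqrt (real p) * sqrt (real p) = real p" by simp
    have sp: "sqrt (real p) > 1" by (rule sqrt_prime_gt_1[OF p])
    have spp: "sqrt (real p) \<le> real p" using p2 sq sp by (metis less_imp_le mult_le_cancel_left1 real_sqrt_gt_zero order_less_le_trans zero_less_one)
    have x2: "x\<^sup>2 \<le> real p powr (- (3/2))"
    proof -
      have "x\<^sup>2 \<le> (1 / real p)\<^sup>2" using xp x by (intro power_mono) auto
      also have "\<dots> = 1 / (real p * real p)" by (simp add: power2_eq_square)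
      also have "\<dots> \<le> 1 / (real p * sqrt p)" using p2 spp by (intro divide_left_mono mult_left_mono) auto
      finally show ?thesis by (simp add: p32)
    qed
    show "\<bar>(1 - real p powr (- (1 + \<sigma>))) powr k * euler_factor (upper_weight A k) (- (1 + \<sigma>)) p - 1\<bar> \<le> C * real p powr (- (3/2))"
    proof (cases "p \<in> A")
      case True
      have "euler_factor (upper_weight A k) (- (1 + \<sigma>)) p = 1"
        unfolding euler_factor_def by (subst suminf_finite[of "{0}"]) (use True in \<open>auto simp: upper_weight_def\<close>)
      moreover have "\<bar>(1 - x) powr k * 1 - 1\<bar> \<le> 1" using x k powr_le1[of k "1 - x"] powr_ge_zero[of "1 - x" k] by linarith
      moreover have "1 \<le> C * real p powr (- (3/2))"
      proof -
        have "real p powr (3/2) \<le> (\<Sum>p\<in>A. real p powr (3/2))" using True A by (intro member_le_sum) auto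
        also have "\<dots> \<le> C" using k by (simp add: C_def)
        finally have "real p powr (3/2) * real p powr (- (3/2)) \<le> C * real p powr (- (3/2))" by (intro mult_right_mono) auto
        then show ?thesis using p2 by (simp flip: powr_add)
      qed
      ultimately show ?thesis unfolding x_def[symmetric] by (simp only:)
    next
      case False
      define e where "e = k * x * (1 / (1 - 1 / sqrt p) - 1) + 4 * k * sqrt p * x\<^sup>2 / (1 - 4/3 * x)"
      have E: "euler_factor (upper_weight A k) (- (1 + \<sigma>)) p = 1 + k * x + e"
        using euler_factor_upper_weight[OF p False, of "- (1 + \<sigma>)" k] x
        unfolding euler_factor_def e_def x_def by (simp add: sums_iff algebra_simps)
      have q1: "1 / (1 - 1 / sqrt p) - 1 = 1 / (sqrt p - 1)" using sp by (simp add: field_simps)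
      have s14: "sqrt (real p) \<ge> 14/10" using p2 by (intro real_le_rsqrt) (auto simp: power2_eq_square)
      have q2: "1 / (sqrt (real p) - 1) \<le> 14 / sqrt p"
    proof -
      have "1 / (s - 1) \<le> 14 / s" if "s \<ge> 14/10" for s :: real using that by (simp add: divide_simps)
      then show ?thesis using s14 by blast
    qed
      have e0: "e \<ge> 0" unfolding e_def q1 using k x sp by (intro add_nonneg_nonneg mult_nonneg_nonneg divide_nonneg_nonneg) auto
      have "k * x * (1 / (1 - 1 / sqrt p) - 1) \<le> k * (1 / real p) * (14 / sqrt p)"
        unfolding q1 using k x xp q2 sp by (intro mult_mono) auto
      also have "\<dots> = 14 * k * real p powr (- (3/2))" by (simp add: p32)
      finally have e1: "k * x * (1 / (1 - 1 / sqrt p) - 1) \<le> 14 * k * real p powr (- (3/2))" .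
      have "4 * k * sqrt p * x\<^sup>2 / (1 - 4/3 * x) \<le> 4 * k * sqrt p * (1 / real p)\<^sup>2 / (1/3)"
        using k x xp by (intro frac_le mult_left_mono power_mono mult_nonneg_nonneg) auto
      also have "\<dots> = 12 * k * (sqrt p / (sqrt p * sqrt p) / real p)" unfolding sq by (simp add: power2_eq_square)
      also have "\<dots> = 12 * k * real p powr (- (3/2))" unfolding p32 using sp by (simp add: field_simps)
      finally have e2: "e \<le> 26 * k * real p powr (- (3/2))" using e1 by (simp add: e_def)
      have "\<bar>(1 - x) powr k * (1 + k * x + e) - 1\<bar> \<le> e + (k\<^sup>2 + k^3) * x\<^sup>2"
        by (rule euler_factor_bound) (use k x e0 in auto)
      also have "\<dots> \<le> 26 * k * real p powr (- (3/2)) + (k\<^sup>2 + k^3) * real p powr (- (3/2))"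
        using e2 x2 k by (intro add_mono mult_left_mono) auto
      also have "\<dots> = (26 * k + (k\<^sup>2 + k^3)) * real p powr (- (3/2))" by (simp add: algebra_simps)
      also have "\<dots> \<le> C * real p powr (- (3/2))" using Cn by (intro mult_right_mono) auto
      finally show ?thesis by (simp only: E x_def)
    qed
  qed (use k in auto)
  then show ?thesis by blast
qed

section \<open>Deleting finitely many primes and restoring them\<close>

definition rough :: "nat set \<Rightarrow> nat \<Rightarrow> nat set" where
  "rough A N = {n \<in> {1..N}. \<forall>p\<in>A. \<not> p dvd n}"

lemma finite_rough[simp]: "finite (rough A N)"
  by (simp add: rough_def)

lemma rough_empty[simp]: "rough {} N = {1..N}"
  by (auto simp: rough_def)

lemma rough_subset_smooth: "rough A N \<subseteq> smooth (primes_upto N - A) N"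
proof
  fix n assume n: "n \<in> rough A N"
  then have "n \<in> smooth (primes_upto N) N" using atLeastAtMost_subset_smooth[of N] by (auto simp: rough_def primes_upto_def)
  then show "n \<in> smooth (primes_upto N - A) N"
    using n by (auto simp: smooth_def rough_def prime_factors_dvd)
qed

lemma cmod_zcoef: "(cmod (zcoef n))\<^sup>2 = 1 / real n"
proof (cases "n = 0")
  case False
  have "(cmod (zcoef n))\<^sup>2 = real n powr (- 1/2) * real n powr (- 1/2)" by (simp add: zcoef_def power2_eq_square)
  also have "\<dots> = real n powr (-1)" by (simp flip: powr_add)
  finally show ?thesis using False by (simp add: powr_minus inverse_eq_divide)
qed (simp add: zcoef_def)

text \<open>An arbitrary subset \<open>T\<close> is reached by setting the other coefficients to 0.
  This generality covers the difference of two truncations, which is needed when a prime is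
  restored.\<close>

lemma rough_norm_le:
  assumes k: "k \<ge> 1" and T: "T \<subseteq> rough A N"
  shows "(Lnorm torus (2 * k) (dirichlet_poly zcoef T))\<^sup>2 \<le> (\<Sum>n\<in>T. mult_fun (upper_weight A k) n / real n)"
proof -
  define P where "P = primes_upto N - A"
  define c where "c n = (if n \<in> T then zcoef n else 0)" for n
  have P: "finite P" "\<And>q. q \<in> P \<Longrightarrow> prime q" by (auto simp: P_def primes_uptoD)
  have fin: "finite (smooth P N)" by (rule finite_smooth[OF P])
  have sub: "T \<subseteq> smooth P N" using T rough_subset_smooth[of A N] by (auto simp: P_def)
  have "dirichlet_poly zcoef T = dirichlet_poly c (smooth P N)"
    unfolding dirichlet_poly_def using sub fin by (intro ext sum.mono_neutral_cong_left) (auto simp: c_def)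
  then have "(Lnorm torus (2 * k) (dirichlet_poly zcoef T))\<^sup>2 \<le> (\<Sum>n\<in>smooth P N. mult_fun (upper_weight A k) n * (cmod (c n))\<^sup>2)"
  proof (simp only:, intro tensor_upper k P)
    fix q assume "q \<in> P"
    then have q: "prime q" "q \<notin> A" by (auto simp: P_def primes_uptoD)
    show "upper_weight A k q 0 = 1" by (simp add: upper_weight_def)
    show "upper_weight A k q j \<ge> 0" for j using k splitting_weight_pos[OF q(1), of j] by (simp add: upper_weight_def)
    show "(Lnorm circle (2 * k) (\<lambda>y. \<Sum>j\<le>N. a j * e1 y ^ j))\<^sup>2 \<le> (\<Sum>j\<le>N. upper_weight A k q j * (cmod (a j))\<^sup>2)" for a
      by (rule upper_weight_norm_le[OF k q])
  qed
  also have "\<dots> = (\<Sum>n\<in>T. mult_fun (upper_weight A k) n / real n)"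
    using sub fin by (intro sum.mono_neutral_cong_right) (auto simp: c_def cmod_zcoef)
  finally show ?thesis .
qed

lemma rough_decompose_bij:
  assumes p: "prime p" "p \<notin> A" and A: "\<And>q. q \<in> A \<Longrightarrow> prime q"
  shows "bij_betw (\<lambda>(j,m). p ^ j * m) (SIGMA j:{..N}. rough (insert p A) (N div p ^ j)) (rough A N)"
proof (rule bij_betwI[where g = "\<lambda>n. (multiplicity p n, n div p ^ multiplicity p n)"])
  have pj: "p ^ j > 0" for j using p by (simp add: prime_gt_0_nat)
  have dv: "q dvd p ^ j * m \<longleftrightarrow> q dvd m" if "q \<in> A" for q j m
  proof
    assume "q dvd p ^ j * m"
    then have "q dvd p ^ j \<or> q dvd m" using A[OF that] by (simp add: prime_dvd_mult_iff)
    moreover have "\<not> q dvd p ^ j" using A[OF that] p that by (metis prime_dvd_power primes_dvd_imp_eq)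
    ultimately show "q dvd m" by blast
  qed simp
  show "(\<lambda>(j, m). p ^ j * m) \<in> (SIGMA j:{..N}. rough (insert p A) (N div p ^ j)) \<rightarrow> rough A N"
  proof safe
    fix j m assume jm: "j \<le> N" "m \<in> rough (insert p A) (N div p ^ j)"
    have "p ^ j * m \<le> p ^ j * (N div p ^ j)" using jm by (intro mult_le_mono2) (simp add: rough_def)
    also have "\<dots> \<le> N" by (rule times_div_less_eq_dividend)
    finally show "p ^ j * m \<in> rough A N" using jm pj[of j] dv by (auto simp: rough_def)
  qed
  show "(\<lambda>n. (multiplicity p n, n div p ^ multiplicity p n)) \<in> rough A N \<rightarrow> (SIGMA j:{..N}. rough (insert p A) (N div p ^ j))"
  proof
    fix n assume n: "n \<in> rough A N"
    then have n0: "n > 0" "n \<le> N" by (auto simp: rough_def)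
    obtain y where y: "n = p ^ multiplicity p n * y" "\<not> p dvd y" "y > 0"
      by (rule prime_power_decompose[OF n0(1) p(1)])
    define j where "j = multiplicity p n"
    have n': "n = p ^ j * y" using y by (simp add: j_def)
    have nd: "n div p ^ j = y" using n' pj by simp
    have "j \<le> N" using multiplicity_less[OF p(1) n0(1)] n0 by (simp add: j_def)
    moreover have "y \<le> N div p ^ j" using n0 nd by (metis div_le_mono)
    moreover have "\<not> q dvd y" if "q \<in> A" for q using n that dv[OF that, of j y] by (auto simp: rough_def n'[symmetric])
    ultimately have "(j, n div p ^ j) \<in> (SIGMA j:{..N}. rough (insert p A) (N div p ^ j))"
      using y nd by (auto simp: rough_def)
    then show "(multiplicity p n, n div p ^ multiplicity p n) \<in> (SIGMA j:{..N}. rough (insert p A) (N div p ^ j))"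
      by (simp add: j_def)
  qed
  fix jm assume "jm \<in> (SIGMA j:{..N}. rough (insert p A) (N div p ^ j))"
  then obtain j m where jm: "jm = (j, m)" "m \<in> rough (insert p A) (N div p ^ j)" by auto
  then have m: "\<not> p dvd m" "m > 0" by (auto simp: rough_def)
  show "(\<lambda>n. (multiplicity p n, n div p ^ multiplicity p n)) ((\<lambda>(j, m). p ^ j * m) jm) = jm"
    using prime_power_mult(1)[OF p(1) m, of j] p by (simp add: jm prime_gt_0_nat)
next
  fix n assume "n \<in> rough A N"
  show "(\<lambda>(j, m). p ^ j * m) ((\<lambda>n. (multiplicity p n, n div p ^ multiplicity p n)) n) = n"
    by (simp add: multiplicity_dvd)
qed

lemma zcoef_mult: "zcoef (m * n) = zcoef m * zcoef n"
  by (simp add: zcoef_def powr_mult)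

lemma zcoef_power: "zcoef (p ^ j) = zcoef p ^ j"
  by (induction j) (auto simp: zcoef_mult, simp add: zcoef_def)

lemma dirichlet_poly_rough_decompose:
  assumes p: "prime p" "p \<notin> A" and A: "\<And>q. q \<in> A \<Longrightarrow> prime q"
  shows "dirichlet_poly zcoef (rough A N) x = (\<Sum>j\<le>N. (zcoef p * e1 (x p)) ^ j * dirichlet_poly zcoef (rough (insert p A) (N div p ^ j)) x)"
proof -
  have "dirichlet_poly zcoef (rough A N) x = (\<Sum>(j,m)\<in>(SIGMA j:{..N}. rough (insert p A) (N div p ^ j)). zcoef (p ^ j * m) * cx x (p ^ j * m))"
    unfolding dirichlet_poly_def
    using sum.reindex_bij_betw[OF rough_decompose_bij[OF assms, of N], of "\<lambda>n. zcoef n * cx x n"]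
    by (simp add: case_prod_unfold)
  also have "\<dots> = (\<Sum>j\<le>N. \<Sum>m\<in>rough (insert p A) (N div p ^ j). zcoef (p ^ j * m) * cx x (p ^ j * m))"
    by (rule sum.Sigma[symmetric]) auto
  also have "\<dots> = (\<Sum>j\<le>N. (zcoef p * e1 (x p)) ^ j * dirichlet_poly zcoef (rough (insert p A) (N div p ^ j)) x)"
    unfolding dirichlet_poly_def sum_distrib_left
  proof (intro sum.cong refl)
    fix j m assume "m \<in> rough (insert p A) (N div p ^ j)"
    then have "m > 0" by (auto simp: rough_def)
    then have "cx x (p ^ j * m) = e1 (x p) ^ j * cx x m" using p by (simp add: cx_def chi_prime_power_mult)
    then show "zcoef (p ^ j * m) * cx x (p ^ j * m) = (zcoef p * e1 (x p)) ^ j * (zcoef m * cx x m)"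
      by (simp add: zcoef_mult zcoef_power power_mult_distrib)
  qed
  finally show ?thesis .
qed

text \<open>The polynomial does not depend on the coordinate \<open>p\<close>, so the integral
  factors once that coordinate is redrawn.\<close>

lemma Lnorm_independent:
  assumes p: "prime p" and r: "r > 0" and g: "bdd_measurable circle g" and T: "\<And>n. n \<in> T \<Longrightarrow> \<not> p dvd n"
  shows "Lnorm torus r (\<lambda>x. g (x p) * dirichlet_poly c T x) = Lnorm circle r g * Lnorm torus r (dirichlet_poly c T)"
    and "bdd_measurable torus (\<lambda>x. g (x p))"
proof -
  obtain B where B: "\<And>y. norm (g y) \<le> B" using g by (auto simp: bdd_measurable_def)
  have "g \<in> borel_measurable borel" using g by (simp add: bdd_measurable_def measurable_cong_sets[OF sets_circle refl])
  then have "(\<lambda>x. g (x p)) \<in> borel_measurable torus" using torus_component by (rule measurable_compose[rotated])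
  then show bg: "bdd_measurable torus (\<lambda>x. g (x p))" using B by (intro bdd_measurableI) auto
  have "dirichlet_poly c T (x(p := y)) = dirichlet_poly c T x" for x y
    unfolding dirichlet_poly_def using p T by (intro sum.cong refl) (simp add: cx_upd_other)
  then have "(\<integral>x. cmod (g (x p) * dirichlet_poly c T x) powr r \<partial>torus) = (\<integral>x. (\<integral>y. cmod (g y) powr r * cmod (dirichlet_poly c T x) powr r \<partial>circle) \<partial>torus)"
    using r by (subst torus_resample(1)[of _ p]) (auto intro!: bdd_measurable_powr bdd_measurable_mult bg simp: norm_mult powr_mult)
  also have "\<dots> = (\<integral>y. cmod (g y) powr r \<partial>circle) * (\<integral>x. cmod (dirichlet_poly c T x) powr r \<partial>torus)" by simp
  finally show "Lnorm torus r (\<lambda>x. g (x p) * dirichlet_poly c T x) = Lnorm circle r g * Lnorm torus r (dirichlet_poly c T)"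
    by (simp add: Lnorm_def powr_mult)
qed

definition upper_weight_sum :: "nat set \<Rightarrow> real \<Rightarrow> nat \<Rightarrow> real" where
  "upper_weight_sum A k N = (\<Sum>n=1..N. mult_fun (upper_weight A k) n / real n)"

lemma mult_fun_upper_weight_nonneg: "k \<ge> 1 \<Longrightarrow> mult_fun (upper_weight A k) n \<ge> 0"
proof (rule mult_fun_nonneg)
  fix p j assume "k \<ge> 1" "prime (p::nat)"
  then show "upper_weight A k p j \<ge> 0" using splitting_weight_pos[of p j] by (simp add: upper_weight_def)
qed

lemma rough_norm_le': "k \<ge> 1 \<Longrightarrow> Lnorm torus (2 * k) (dirichlet_poly zcoef (rough A N)) \<le> sqrt (upper_weight_sum A k N)"
proof (rule real_le_rsqrt)
  assume k: "k \<ge> 1"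
  have "(Lnorm torus (2 * k) (dirichlet_poly zcoef (rough A N)))\<^sup>2 \<le> (\<Sum>n\<in>rough A N. mult_fun (upper_weight A k) n / real n)"
    by (rule rough_norm_le[OF k subset_refl])
  also have "\<dots> \<le> upper_weight_sum A k N"
    unfolding upper_weight_sum_def using mult_fun_upper_weight_nonneg[OF k] by (intro sum_mono2) (auto simp: rough_def)
  finally show "(Lnorm torus (2 * k) (dirichlet_poly zcoef (rough A N)))\<^sup>2 \<le> upper_weight_sum A k N" .
qed

lemma rough_diff_norm_le:
  assumes k: "k \<ge> 1" and x: "x \<le> N"
  shows "Lnorm torus (2 * k) (\<lambda>y. dirichlet_poly zcoef (rough A N) y - dirichlet_poly zcoef (rough A x) y) \<le> sqrt (upper_weight_sum A k N - upper_weight_sum A k x)"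
proof (rule real_le_rsqrt)
  have sub: "rough A x \<subseteq> rough A N" using x by (auto simp: rough_def)
  have "(\<lambda>y. dirichlet_poly zcoef (rough A N) y - dirichlet_poly zcoef (rough A x) y) = dirichlet_poly zcoef (rough A N - rough A x)"
    unfolding dirichlet_poly_def using sub by (intro ext) (simp add: sum_diff)
  then have "(Lnorm torus (2 * k) (\<lambda>y. dirichlet_poly zcoef (rough A N) y - dirichlet_poly zcoef (rough A x) y))\<^sup>2 \<le> (\<Sum>n\<in>rough A N - rough A x. mult_fun (upper_weight A k) n / real n)"
    by (simp only:) (rule rough_norm_le[OF k], auto)
  also have "\<dots> \<le> (\<Sum>n\<in>{1..N} - {1..x}. mult_fun (upper_weight A k) n / real n)"
    using mult_fun_upper_weight_nonneg[OF k] by (intro sum_mono2) (auto simp: rough_def)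
  also have "\<dots> = upper_weight_sum A k N - upper_weight_sum A k x"
    unfolding upper_weight_sum_def using x by (intro sum_diff) auto
  finally show "(Lnorm torus (2 * k) (\<lambda>y. dirichlet_poly zcoef (rough A N) y - dirichlet_poly zcoef (rough A x) y))\<^sup>2 \<le> upper_weight_sum A k N - upper_weight_sum A k x" .
qed

text \<open>In other words, the limsup of the norm divided by \<open>ln N powr (k / 2)\<close> is at
  most \<open>\<beta>\<close>. Raising to the power \<open>2 * k\<close> turns this normalisation
  into the one of the pseudomoment, with exponent \<open>k\<^sup>2\<close>.\<close>

definition norm_bounded :: "nat set \<Rightarrow> real \<Rightarrow> real \<Rightarrow> bool" where
  "norm_bounded A k \<beta> \<longleftrightarrow> (\<forall>\<epsilon>>0. \<forall>\<^sub>F N in sequentially.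
     Lnorm torus (2 * k) (dirichlet_poly zcoef (rough A N)) \<le> (\<beta> + \<epsilon>) * ln (real N) powr (k / 2))"

lemma norm_boundedI_upper_weight_sum:
  assumes k: "k \<ge> 1" and lim: "(\<lambda>N. upper_weight_sum A k N / ln (real N) powr k) \<longlonglongrightarrow> s"
  shows "norm_bounded A k (sqrt s)"
  unfolding norm_bounded_def
proof (intro allI impI)
  fix \<epsilon> :: real assume e: "\<epsilon> > 0"
  have "(\<lambda>N. sqrt (upper_weight_sum A k N / ln (real N) powr k)) \<longlonglongrightarrow> sqrt s" by (intro tendsto_intros lim)
  then have "\<forall>\<^sub>F N in sequentially. sqrt (upper_weight_sum A k N / ln (real N) powr k) < sqrt s + \<epsilon>"
    using e by (intro order_tendstoD) auto
  then show "\<forall>\<^sub>F N in sequentially. Lnorm torus (2 * k) (dirichlet_poly zcoef (rough A N)) \<le> (sqrt s + \<epsilon>) * ln (real N) powr (k / 2)"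
    using eventually_gt_at_top[of 1]
  proof eventually_elim
    case (elim N)
    have L: "ln (real N) > 0" using elim by simp
    have sq: "sqrt (ln (real N) powr k) = ln (real N) powr (k / 2)"
      using L by (simp add: powr_half_sqrt[symmetric] powr_powr)
    have "sqrt (upper_weight_sum A k N) = sqrt (upper_weight_sum A k N / ln (real N) powr k) * ln (real N) powr (k / 2)"
      using L by (simp add: real_sqrt_divide sq)
    also have "\<dots> \<le> (sqrt s + \<epsilon>) * ln (real N) powr (k / 2)" using elim by (intro mult_right_mono) auto
    finally show ?case using rough_norm_le'[OF k, of A N] by linarith
  qed
qed

lemma ln_div_ratio:
  assumes "q \<ge> 1" shows "(\<lambda>N. ln (real (N div q)) / ln (real N)) \<longlonglongrightarrow> 1"
proof (rule tendsto_sandwich)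
  have q: "real q > 0" using assms by simp
  show "(\<lambda>N. ln (real N / real q - 1) / ln (real N)) \<longlonglongrightarrow> 1" using q by real_asymp
  show "(\<lambda>N. ln (real N) / ln (real N)) \<longlonglongrightarrow> 1" by real_asymp
  have ge: "real N / real q - 1 \<le> real (N div q)" for N
  proof -
    have "N < q + q * (N div q)" using assms by (intro dividend_less_times_div) simp
    then have "real N < real q * (1 + real (N div q))" by (metis distrib_left mult.right_neutral of_nat_1 of_nat_add of_nat_less_iff of_nat_mult)
    then show ?thesis using q by (simp add: field_simps)
  qed
  show "\<forall>\<^sub>F N in sequentially. ln (real N / real q - 1) / ln (real N) \<le> ln (real (N div q)) / ln (real N)"
    using eventually_gt_at_top[of "q + 1"]
  proof eventually_elim
    case (elim N)
    then have "real N / real q > 1" using q by (simp add: field_simps)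
    then show ?case using ge[of N] elim assms by (intro divide_right_mono ln_mono) auto
  qed
  show "\<forall>\<^sub>F N in sequentially. ln (real (N div q)) / ln (real N) \<le> ln (real N) / ln (real N)"
    using eventually_gt_at_top[of "q + 1"]
  proof eventually_elim
    case (elim N)
    then have "N div q > 0" using assms by (simp add: div_greater_zero_iff)
    then show ?case using elim by (intro divide_right_mono ln_mono) auto
  qed
qed

text \<open>Since \<open>ln (N div q)\<close> and \<open>ln N\<close> are asymptotically equal, the
  sums up to \<open>N div q\<close> and up to \<open>N\<close> have the same leading term. Their
  difference bounds the cost of replacing one range by the other.\<close>

lemma upper_weight_sum_div_limit:
  assumes lim: "(\<lambda>N. upper_weight_sum A k N / ln (real N) powr k) \<longlonglongrightarrow> s" and q: "q \<ge> 1"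
  shows "(\<lambda>N. (upper_weight_sum A k N - upper_weight_sum A k (N div q)) / ln (real N) powr k) \<longlonglongrightarrow> 0"
proof -
  have fl: "filterlim (\<lambda>N. N div q) at_top sequentially"
    unfolding filterlim_at_top
  proof
    fix Z :: nat
    show "\<forall>\<^sub>F N in sequentially. Z \<le> N div q"
      using eventually_ge_at_top[of "Z * q"]
    proof eventually_elim
      case (elim N)
      then have "Z * q div q \<le> N div q" by (rule div_le_mono)
      then show ?case using q by simp
    qed
  qed
  have "(\<lambda>N. upper_weight_sum A k (N div q) / ln (real (N div q)) powr k * (ln (real (N div q)) / ln (real N)) powr k) \<longlonglongrightarrow> s * 1 powr k"
    using filterlim_compose[OF lim fl] by (intro tendsto_mult tendsto_powr ln_div_ratio q tendsto_const) auto
  moreover have "\<forall>\<^sub>F N in sequentially. upper_weight_sum A k (N div q) / ln (real (N div q)) powr k * (ln (real (N div q)) / ln (real N)) powr k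
     = upper_weight_sum A k (N div q) / ln (real N) powr k"
    using eventually_compose_filterlim[OF eventually_gt_at_top[of 1] fl] eventually_gt_at_top[of 1]
  proof eventually_elim
    case (elim N)
    then have "ln (real (N div q)) > 0" "ln (real N) > 0" by auto
    then show ?case by (simp add: powr_divide)
  qed
  ultimately have "(\<lambda>N. upper_weight_sum A k (N div q) / ln (real N) powr k) \<longlonglongrightarrow> s"
    using Lim_transform_eventually by force
  from tendsto_diff[OF lim this] show ?thesis by (simp add: diff_divide_distrib)
qed

definition euler_factor_norm :: "real \<Rightarrow> nat \<Rightarrow> real" where
  "euler_factor_norm k p = Lnorm circle (2 * k) (\<lambda>y. 1 / (1 - zcoef p * e1 y))"

lemma zcoef_prime:
  assumes "prime p" shows "cmod (zcoef p) = real p powr (- 1/2)" "0 < cmod (zcoef p)" "cmod (zcoef p) < 1"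
proof -
  have p: "real p > 1" using prime_gt_1_nat[OF assms] by simp
  show 1: "cmod (zcoef p) = real p powr (- 1/2)" by (simp add: zcoef_def)
  show "0 < cmod (zcoef p)" unfolding 1 using p by simp
  have "real p powr (- 1/2) < real p powr 0" using p by (intro powr_less_mono) auto
  then show "cmod (zcoef p) < 1" unfolding 1 using p by simp
qed

text \<open>Writing \<open>n = p ^ j * m\<close> with \<open>p\<close> not dividing \<open>m\<close>, the sums over \<open>m \<le> N div p ^ j\<close> and over \<open>m \<le> N\<close> are
  asymptotically equal in norm, so the factor \<open>1 / (1 - zcoef p * w)\<close> splits off with its exact norm.\<close>

lemma norm_bounded_step:
  assumes k: "k \<ge> 1" and p: "prime p" "p \<notin> A" and A: "\<And>q. q \<in> A \<Longrightarrow> prime q"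
    and nb: "norm_bounded (insert p A) k \<beta>" and b0: "\<beta> \<ge> 0"
    and lim: "(\<lambda>N. upper_weight_sum (insert p A) k N / ln (real N) powr k) \<longlonglongrightarrow> s"
  shows "norm_bounded A k (euler_factor_norm k p * \<beta>)"
  unfolding norm_bounded_def
proof (intro allI impI)
  fix \<epsilon> :: real assume e: "\<epsilon> > 0"
  define \<theta> where "\<theta> = cmod (zcoef p)"
  have th: "0 < \<theta>" "\<theta> < 1" using zcoef_prime[OF p(1)] by (auto simp: \<theta>_def)
  define D where "D N = dirichlet_poly zcoef (rough (insert p A) N)" for N
  define g where "g N y = (\<Sum>j\<le>N. (zcoef p * e1 y) ^ j)" for N y
  define L where "L N = ln (real N) powr (k / 2)" for N
  define S where "S = upper_weight_sum (insert p A) k"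
  define \<eta> where "\<eta> j N = sqrt ((S N - S (N div p ^ j)) / ln (real N) powr k)" for j N
  have bD: "bdd_measurable torus (D N)" for N by (simp add: D_def)
  have bg: "bdd_measurable circle (g N)" for N unfolding g_def by (intro bdd_measurable_intros circle.bdd_measurable_w)
  have S_mono: "S x \<le> S N" if "x \<le> N" for x N
    unfolding S_def upper_weight_sum_def using that mult_fun_upper_weight_nonneg[OF k] by (intro sum_mono2) auto
  have S_nonneg: "S x \<ge> 0" for x
    unfolding S_def upper_weight_sum_def using mult_fun_upper_weight_nonneg[OF k] by (intro sum_nonneg) auto
  have bgp: "bdd_measurable torus (\<lambda>x. g N (x p))" for N
    by (rule Lnorm_independent(2)[OF p(1), of 1 _ "{}"]) (use bg in auto)
  have bep: "bdd_measurable torus (\<lambda>x. e1 (x p))"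
    by (rule Lnorm_independent(2)[OF p(1), of 1 _ "{}"]) auto
  \<comment> \<open>The truncated geometric series is the full one times
    \<open>1 - (zcoef p * e1 y) ^ Suc N\<close>, whose modulus is at most
    \<open>1 + \<theta> ^ Suc N\<close>, and this bound tends to 1.\<close>
  have g_le: "Lnorm circle (2 * k) (g N) \<le> (1 + \<theta> ^ Suc N) * euler_factor_norm k p" for N
  proof -
    have nz: "1 - zcoef p * e1 y \<noteq> 0" for y
    proof
      assume "1 - zcoef p * e1 y = 0"
      then have "cmod (zcoef p * e1 y) = 1" by simp
      then show False using th by (simp add: norm_mult \<theta>_def)
    qed
    have geo: "g N y = (1 - (zcoef p * e1 y) ^ Suc N) * (1 / (1 - zcoef p * e1 y))" for y
      unfolding g_def using nz[of y] by (subst sum_gp0) auto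
    have cb: "cmod (1 / (1 - zcoef p * e1 y)) \<le> 1 / (1 - \<theta>)" for y
    proof -
      have "1 - \<theta> \<le> cmod (1 - zcoef p * e1 y)" using norm_triangle_ineq2[of 1 "zcoef p * e1 y"] by (simp add: norm_mult \<theta>_def)
      then show ?thesis using th by (simp add: norm_divide frac_le)
    qed
    have m1: "(\<lambda>y. 1 / (1 - zcoef p * e1 y)) \<in> borel_measurable circle"
      using circle.w_measurable by measurable
    have b1: "bdd_measurable circle (\<lambda>y. 1 / (1 - zcoef p * e1 y))" by (rule bdd_measurableI[OF m1 cb])
    have "Lnorm circle (2 * k) (g N) \<le> Lnorm circle (2 * k) (\<lambda>y. complex_of_real (1 + \<theta> ^ Suc N) * (1 / (1 - zcoef p * e1 y)))"
    proof (rule circle.Lnorm_mono[OF _ bg])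
      show "bdd_measurable circle (\<lambda>y. complex_of_real (1 + \<theta> ^ Suc N) * (1 / (1 - zcoef p * e1 y)))" by (intro bdd_measurable_mult bdd_measurable_const b1)
      fix y
      have "cmod (1 - (zcoef p * e1 y) ^ Suc N) \<le> 1 + \<theta> ^ Suc N"
        using norm_triangle_ineq4[of 1 "(zcoef p * e1 y) ^ Suc N"] by (simp add: norm_mult norm_power \<theta>_def)
      also have "\<dots> = cmod (complex_of_real (1 + \<theta> ^ Suc N))" using th by (subst norm_of_real) auto
      finally show "cmod (g N y) \<le> cmod (complex_of_real (1 + \<theta> ^ Suc N) * (1 / (1 - zcoef p * e1 y)))"
        unfolding geo norm_mult by (intro mult_right_mono) auto
    qed (use k in auto)
    also have "\<dots> = (1 + \<theta> ^ Suc N) * euler_factor_norm k p"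
      unfolding euler_factor_norm_def using k th by (subst circle.Lnorm_cmult) (auto simp del: of_real_add simp: abs_of_nonneg)
    finally show ?thesis .
  qed
  \<comment> \<open>Every \<open>D (N div p ^ j)\<close> is replaced by \<open>D N\<close>. The sum
    over \<open>j\<close> becomes a product of independent factors plus an error whose
    \<open>j\<close>-th term is damped by \<open>\<theta> ^ j\<close>.\<close>
  have main: "Lnorm torus (2 * k) (dirichlet_poly zcoef (rough A N)) \<le>
      (1 + \<theta> ^ Suc N) * euler_factor_norm k p * Lnorm torus (2 * k) (D N) + (\<Sum>j\<le>N. \<theta> ^ j * sqrt (S N - S (N div p ^ j)))" for N
  proof -
    have "dirichlet_poly zcoef (rough A N) = (\<lambda>x. g N (x p) * D N x + (\<Sum>j\<le>N. (zcoef p * e1 (x p)) ^ j * (D (N div p ^ j) x - D N x)))"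
    proof
      fix x
      have "g N (x p) * D N x + (\<Sum>j\<le>N. (zcoef p * e1 (x p)) ^ j * (D (N div p ^ j) x - D N x))
         = (\<Sum>j\<le>N. (zcoef p * e1 (x p)) ^ j * D (N div p ^ j) x)"
        unfolding g_def sum_distrib_right sum.distrib[symmetric] by (intro sum.cong refl) (simp add: algebra_simps)
      then show "dirichlet_poly zcoef (rough A N) x = g N (x p) * D N x + (\<Sum>j\<le>N. (zcoef p * e1 (x p)) ^ j * (D (N div p ^ j) x - D N x))"
        by (simp add: dirichlet_poly_rough_decompose[OF p A] D_def)
    qed
    then have "Lnorm torus (2 * k) (dirichlet_poly zcoef (rough A N)) \<le> Lnorm torus (2 * k) (\<lambda>x. g N (x p) * D N x)
       + Lnorm torus (2 * k) (\<lambda>x. \<Sum>j\<le>N. (zcoef p * e1 (x p)) ^ j * (D (N div p ^ j) x - D N x))"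
      using k by (simp only:) (intro torus.Minkowski_ineq bdd_measurable_intros bgp bD bep, auto)
    also have "Lnorm torus (2 * k) (\<lambda>x. g N (x p) * D N x) = Lnorm circle (2 * k) (g N) * Lnorm torus (2 * k) (D N)"
      unfolding D_def using k by (intro Lnorm_independent[OF p(1)] bg) (auto simp: rough_def)
    also have "\<dots> \<le> (1 + \<theta> ^ Suc N) * euler_factor_norm k p * Lnorm torus (2 * k) (D N)"
      by (intro mult_right_mono g_le) auto
    also have "Lnorm torus (2 * k) (\<lambda>x. \<Sum>j\<le>N. (zcoef p * e1 (x p)) ^ j * (D (N div p ^ j) x - D N x))
       \<le> (\<Sum>j\<le>N. Lnorm torus (2 * k) (\<lambda>x. (zcoef p * e1 (x p)) ^ j * (D (N div p ^ j) x - D N x)))"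
      using k by (intro torus.Minkowski_sum bdd_measurable_intros bD bep) auto
    also have "\<dots> \<le> (\<Sum>j\<le>N. \<theta> ^ j * sqrt (S N - S (N div p ^ j)))"
    proof (intro sum_mono)
      fix j
      have "Lnorm torus (2 * k) (\<lambda>x. (zcoef p * e1 (x p)) ^ j * (D (N div p ^ j) x - D N x))
         = Lnorm torus (2 * k) (\<lambda>x. complex_of_real (\<theta> ^ j) * (D N x - D (N div p ^ j) x))"
        by (simp add: Lnorm_def norm_mult norm_power \<theta>_def norm_minus_commute)
      also have "\<dots> = \<theta> ^ j * Lnorm torus (2 * k) (\<lambda>x. D N x - D (N div p ^ j) x)"
        using k th by (subst torus.Lnorm_cmult) (auto simp: norm_power)
      also have "\<dots> \<le> \<theta> ^ j * sqrt (S N - S (N div p ^ j))"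
        unfolding D_def S_def using th by (intro mult_left_mono rough_diff_norm_le k) auto
      finally show "Lnorm torus (2 * k) (\<lambda>x. (zcoef p * e1 (x p)) ^ j * (D (N div p ^ j) x - D N x)) \<le> \<theta> ^ j * sqrt (S N - S (N div p ^ j))" .
    qed
    finally show ?thesis by simp
  qed
  obtain B where B: "\<And>N. norm (S N / ln (real N) powr k) \<le> B"
    using convergent_imp_Bseq[OF convergentI[OF lim]] by (auto simp: Bseq_def S_def)
  have \<eta>_le: "\<bar>\<eta> j N\<bar> \<le> sqrt B" for j N
  proof -
    have "(S N - S (N div p ^ j)) / ln (real N) powr k \<le> S N / ln (real N) powr k"
      using S_nonneg by (intro divide_right_mono) auto
    also have "\<dots> \<le> B" using B[of N] S_nonneg[of N] by simp
    finally have "\<eta> j N \<le> sqrt B" by (simp add: \<eta>_def)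
    moreover have "\<eta> j N \<ge> 0" unfolding \<eta>_def using S_mono[of "N div p ^ j" N] by simp
    ultimately show ?thesis by simp
  qed
  \<comment> \<open>Extension by 0 makes the sum of growing length an infinite series. For fixed
    \<open>j\<close> the terms tend to 0, and \<open>\<theta> ^ j * sqrt B\<close> is a summable
    majorant uniform in \<open>N\<close>, so Tannery's theorem applies.\<close>
  define a where "a j N = (if j \<le> N then \<theta> ^ j * \<eta> j N else 0)" for j N
  have "(\<lambda>N. \<Sum>j. a j N) \<longlonglongrightarrow> (\<Sum>j. 0)"
  proof (rule tannerys_theorem[THEN conjunct2, THEN conjunct2])
    fix j
    have "(\<lambda>N. \<theta> ^ j * \<eta> j N) \<longlonglongrightarrow> \<theta> ^ j * sqrt 0"
      unfolding \<eta>_def S_def using prime_gt_0_nat[OF p(1)] by (intro tendsto_intros upper_weight_sum_div_limit[OF lim]) (simp add: Suc_le_eq)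
    then have "(\<lambda>N. \<theta> ^ j * \<eta> j N) \<longlonglongrightarrow> 0" by simp
    then show "a j \<longlonglongrightarrow> 0"
      by (rule Lim_transform_eventually) (use eventually_ge_at_top[of j] in \<open>eventually_elim, simp add: a_def\<close>)
  next
    have "norm (a j N) \<le> \<theta> ^ j * sqrt B" for j N
      using \<eta>_le[of j N] th order_trans[OF abs_ge_zero \<eta>_le[of j N]] by (auto simp: a_def abs_mult intro!: mult_left_mono)
    then show "\<forall>\<^sub>F (j, N) in sequentially \<times>\<^sub>F sequentially. norm (a j N) \<le> \<theta> ^ j * sqrt B" by (simp add: case_prod_unfold)
    show "summable (\<lambda>j. \<theta> ^ j * sqrt B)" using th by (intro summable_mult2 summable_geometric) auto
  qed simp
  then have "(\<lambda>N. \<Sum>j\<le>N. \<theta> ^ j * \<eta> j N) \<longlonglongrightarrow> 0"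
  proof -
    have "(\<Sum>j. a j N) = (\<Sum>j\<le>N. \<theta> ^ j * \<eta> j N)" for N
      by (subst suminf_finite[of "{..N}"]) (auto simp: a_def)
    then show ?thesis using \<open>(\<lambda>N. \<Sum>j. a j N) \<longlonglongrightarrow> (\<Sum>j. 0)\<close> by simp
  qed
  then have t: "\<forall>\<^sub>F N in sequentially. (\<Sum>j\<le>N. \<theta> ^ j * \<eta> j N) < \<epsilon>/2" using e by (intro order_tendstoD) auto
  \<comment> \<open>Half of \<open>\<epsilon>\<close> is spent on the error sum. With this choice
    the loss in the bound for \<open>D N\<close> stays within a quarter, which leaves a quarter for
    the factor \<open>1 + \<theta> ^ Suc N\<close>.\<close>
  define \<epsilon>' where "\<epsilon>' = \<epsilon> / (4 * (euler_factor_norm k p + 1))"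
  have I0: "euler_factor_norm k p \<ge> 0" by (simp add: euler_factor_norm_def)
  have e': "\<epsilon>' > 0" "euler_factor_norm k p * \<epsilon>' \<le> \<epsilon>/4" using e I0 by (auto simp: \<epsilon>'_def field_simps)
  have "(\<lambda>N. (1 + \<theta> ^ Suc N) * (euler_factor_norm k p * (\<beta> + \<epsilon>'))) \<longlonglongrightarrow> (1 + 0) * (euler_factor_norm k p * (\<beta> + \<epsilon>'))"
    using th by (intro tendsto_intros LIMSEQ_Suc LIMSEQ_power_zero) auto
  moreover have "(1 + 0) * (euler_factor_norm k p * (\<beta> + \<epsilon>')) < euler_factor_norm k p * \<beta> + \<epsilon>/2" using e' e by (simp add: algebra_simps)
  ultimately have g2: "\<forall>\<^sub>F N in sequentially. (1 + \<theta> ^ Suc N) * (euler_factor_norm k p * (\<beta> + \<epsilon>')) < euler_factor_norm k p * \<beta> + \<epsilon>/2"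
    by (intro order_tendstoD)
  have nbe: "\<forall>\<^sub>F N in sequentially. Lnorm torus (2 * k) (D N) \<le> (\<beta> + \<epsilon>') * L N"
    using nb e'(1) by (auto simp: norm_bounded_def D_def L_def)
  show "\<forall>\<^sub>F N in sequentially. Lnorm torus (2 * k) (dirichlet_poly zcoef (rough A N)) \<le> (euler_factor_norm k p * \<beta> + \<epsilon>) * ln (real N) powr (k / 2)"
    using t g2 nbe eventually_gt_at_top[of 1]
  proof eventually_elim
    case (elim N)
    have lnN: "ln (real N) > 0" using elim by simp
    have L0: "L N > 0" using lnN by (simp add: L_def)
    have Lsq: "sqrt (ln (real N) powr k) = L N" using lnN by (simp add: L_def powr_half_sqrt[symmetric] powr_powr)
    have "sqrt (S N - S (N div p ^ j)) = \<eta> j N * L N" for j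
      using L0 by (simp add: \<eta>_def real_sqrt_divide Lsq)
    then have "(\<Sum>j\<le>N. \<theta> ^ j * sqrt (S N - S (N div p ^ j))) = (\<Sum>j\<le>N. \<theta> ^ j * \<eta> j N) * L N"
      by (simp add: sum_distrib_right mult.assoc)
    also have "\<dots> \<le> \<epsilon>/2 * L N" using elim L0 by (intro mult_right_mono) auto
    finally have 1: "(\<Sum>j\<le>N. \<theta> ^ j * sqrt (S N - S (N div p ^ j))) \<le> \<epsilon>/2 * L N" .
    have "(1 + \<theta> ^ Suc N) * euler_factor_norm k p * Lnorm torus (2 * k) (D N) \<le> (1 + \<theta> ^ Suc N) * euler_factor_norm k p * ((\<beta> + \<epsilon>') * L N)"
      using elim I0 th by (intro mult_left_mono mult_nonneg_nonneg) auto
    also have "\<dots> = (1 + \<theta> ^ Suc N) * (euler_factor_norm k p * (\<beta> + \<epsilon>')) * L N" by simp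
    also have "\<dots> \<le> (euler_factor_norm k p * \<beta> + \<epsilon>/2) * L N" using elim L0 by (intro mult_right_mono) auto
    finally have "Lnorm torus (2 * k) (dirichlet_poly zcoef (rough A N)) \<le> (euler_factor_norm k p * \<beta> + \<epsilon>/2) * L N + \<epsilon>/2 * L N"
      using main[of N] 1 by linarith
    also have "\<dots> = (euler_factor_norm k p * \<beta> + \<epsilon>) * L N" by (simp add: algebra_simps)
    finally show ?case by (simp add: L_def)
  qed
qed

section \<open>Convergence of the products over the primes\<close>

lemma summable_powr_m2: "summable (\<lambda>n. C * real n powr (- 2))"
  by (intro summable_mult) (simp add: summable_real_powr_iff)

text \<open>Absolutely summable logarithms give a nonzero limit, as the convergence of an infinite
  product in \<open>prime_prod\<close> requires. The exponential form is recorded because it lets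
  the product be estimated for large \<open>k\<close>.\<close>

lemma prime_prod_limit:
  assumes pos: "\<And>p. prime p \<Longrightarrow> f (real p) > 0"
    and bound: "\<And>p. prime p \<Longrightarrow> \<bar>ln (f (real p))\<bar> \<le> C * real p powr (- 2)"
  shows "(\<lambda>N. \<Prod>p\<in>primes_upto N. f (real p)) \<longlonglongrightarrow> prime_prod f"
    and "prime_prod f = exp (\<Sum>n. if prime n then ln (f (real n)) else 0)"
    and "summable (\<lambda>n. if prime n then ln (f (real n)) else 0)"
proof -
  define l where "l n = (if prime n then ln (f (real n)) else 0)" for n
  have "norm (l n) \<le> \<bar>C\<bar> * real n powr (- 2)" for n
  proof (cases "prime n")
    case True
    then have "\<bar>ln (f (real n))\<bar> \<le> C * real n powr (- 2)" by (rule bound)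
    also have "\<dots> \<le> \<bar>C\<bar> * real n powr (- 2)" by (intro mult_right_mono) auto
    finally show ?thesis using True by (simp add: l_def)
  qed (simp add: l_def)
  then have s: "summable l" by (intro summable_comparison_test'[OF summable_powr_m2[of "\<bar>C\<bar>"]])
  then show "summable (\<lambda>n. if prime n then ln (f (real n)) else 0)" by (simp add: l_def[abs_def])
  have lim: "(\<lambda>N. exp (\<Sum>n\<le>N. l n)) \<longlonglongrightarrow> exp (\<Sum>n. l n)"
    by (intro tendsto_exp summable_LIMSEQ' s)
  have "(\<Prod>n\<le>N. if prime n then f (real n) else 1) = (\<Prod>p\<in>primes_upto N. f (real p))" for N
    by (rule prod.mono_neutral_cong_right) (auto simp: primes_upto_def)
  also have pe: "(\<Prod>p\<in>primes_upto N. f (real p)) = exp (\<Sum>n\<le>N. l n)" for N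
    using prod_primes_upto_exp[of "\<lambda>p. f (real p)" N] pos by (simp add: l_def)
  finally have eq: "(\<Prod>n\<le>N. if prime n then f (real n) else 1) = exp (\<Sum>n\<le>N. l n)" for N .
  have "raw_has_prod (\<lambda>n. if prime n then f (real n) else 1) 0 (exp (\<Sum>n. l n))"
    unfolding raw_has_prod_def add_0_right eq using lim by simp
  then have "(\<lambda>n. if prime n then f (real n) else 1) has_prod exp (\<Sum>n. l n)"
    by (simp add: has_prod_def)
  then have e: "prime_prod f = exp (\<Sum>n. l n)"
    unfolding prime_prod_def by (rule has_prod_unique[symmetric])
  then show "prime_prod f = exp (\<Sum>n. if prime n then ln (f (real n)) else 0)" by (simp add: l_def)
  show "(\<lambda>N. \<Prod>p\<in>primes_upto N. f (real p)) \<longlonglongrightarrow> prime_prod f"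
    unfolding e pe by (rule lim)
qed

lemma ln_one_minus_bounds:
  fixes x :: real
  assumes "0 \<le> x" "x < 1"
  shows "- x - x\<^sup>2 / (1 - x) \<le> ln (1 - x)" "ln (1 - x) \<le> - x"
proof -
  show "ln (1 - x) \<le> - x" using assms ln_le_minus_one[of "1 - x"] by simp
  have "ln (1 / (1 - x)) \<le> 1 / (1 - x) - 1" using assms by (intro ln_le_minus_one) auto
  then have "1 - 1 / (1 - x) \<le> ln (1 - x)" using assms by (simp add: ln_div)
  moreover have "1 - 1 / (1 - x) = - x - x\<^sup>2 / (1 - x)" using assms by (simp add: field_simps power2_eq_square)
  ultimately show "- x - x\<^sup>2 / (1 - x) \<le> ln (1 - x)" by simp
qed

definition upper_factor :: "real \<Rightarrow> real \<Rightarrow> real" where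
  "upper_factor k p = (1 - 1 / p) powr (k\<^sup>2) * (1 - k / of_int \<lfloor>k\<rfloor> * (1 / p)) powr (- (k * of_int \<lfloor>k\<rfloor>))"

lemma floor_ratio:
  assumes "k \<ge> (1::real)"
  shows "of_int \<lfloor>k\<rfloor> \<ge> (1::real)" "1 \<le> k / of_int \<lfloor>k\<rfloor>" "k / of_int \<lfloor>k\<rfloor> < 2" "k * of_int \<lfloor>k\<rfloor> * (k / of_int \<lfloor>k\<rfloor>) = k\<^sup>2"
proof -
  define m where "m = (of_int \<lfloor>k\<rfloor> :: real)"
  have m: "m \<ge> 1" using assms by (simp add: m_def)
  then show "of_int \<lfloor>k\<rfloor> \<ge> (1::real)" by (simp add: m_def)
  have "k < m + 1" "m \<le> k" unfolding m_def by linarith+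
  with m show "1 \<le> k / of_int \<lfloor>k\<rfloor>" "k / of_int \<lfloor>k\<rfloor> < 2" "k * of_int \<lfloor>k\<rfloor> * (k / of_int \<lfloor>k\<rfloor>) = k\<^sup>2"
    unfolding m_def[symmetric] by (auto simp: field_simps power2_eq_square)
qed

text \<open>The terms of order \<open>1/p\<close> cancel because
  \<open>k * \<lfloor>k\<rfloor> * s = k\<^sup>2\<close>. The remainders are kept explicit in
  \<open>k\<close>; the denominator \<open>1 - s / 2\<close> bounds \<open>1 - s / p\<close> from
  below, the worst case being \<open>p = 2\<close>, and is positive because
  \<open>s < 2\<close>.\<close>

lemma upper_factor_ln:
  assumes k: "k \<ge> 1" and p: "prime p"
  defines "s \<equiv> k / of_int \<lfloor>k\<rfloor>"
  shows "upper_factor k (real p) > 0"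
    and "- (2 * k\<^sup>2 * real p powr (- 2)) \<le> ln (upper_factor k (real p))"
    and "ln (upper_factor k (real p)) \<le> k\<^sup>2 * s / (1 - s / 2) * real p powr (- 2)"
proof -
  define m where "m = (of_int \<lfloor>k\<rfloor> :: real)"
  define x where "x = 1 / real p"
  have p2: "real p \<ge> 2" using prime_ge_2_nat[OF p] by simp
  have s: "1 \<le> s" "s < 2" "k * m * s = k\<^sup>2" "m \<ge> 1" using floor_ratio[OF k] by (auto simp: s_def m_def)
  have x: "0 < x" "x \<le> 1/2" using p2 by (auto simp: x_def field_simps)
  have sx: "s * x \<le> s / 2" using x s by simp
  have sx1: "s * x < 1" using sx s by linarith
  have sx0: "0 \<le> s * x" using x s by simp
  have xx: "real p powr (- 2) = x\<^sup>2"
    using p2 by (simp add: x_def powr_minus inverse_eq_divide power_divide)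
  have uf: "upper_factor k (real p) = (1 - x) powr (k\<^sup>2) * (1 - s * x) powr (- (k * m))"
    by (simp add: upper_factor_def x_def s_def m_def)
  show "upper_factor k (real p) > 0" unfolding uf using x sx1 by simp
  have lnu: "ln (upper_factor k (real p)) = k\<^sup>2 * ln (1 - x) + k * m * (- ln (1 - s * x))"
    unfolding uf using x sx1 by (simp add: ln_mult ln_powr)
  have km: "k * m \<ge> 0" using k s by simp
  have "k\<^sup>2 * (- x - 2 * x\<^sup>2) \<le> k\<^sup>2 * ln (1 - x)"
  proof (intro mult_left_mono)
    have "x\<^sup>2 / (1 - x) \<le> x\<^sup>2 / (1/2)" using x by (intro divide_left_mono) auto
    then show "- x - 2 * x\<^sup>2 \<le> ln (1 - x)" using ln_one_minus_bounds(1)[of x] x by simp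
  qed auto
  moreover have "k * m * (s * x) \<le> k * m * (- ln (1 - s * x))"
    using ln_one_minus_bounds(2)[OF sx0 sx1] km by (intro mult_left_mono) auto
  moreover have "k * m * (s * x) = k\<^sup>2 * x" using s(3) by (metis mult.assoc)
  ultimately have "k\<^sup>2 * (- x - 2 * x\<^sup>2) + k\<^sup>2 * x \<le> ln (upper_factor k (real p))"
    unfolding lnu by linarith
  then show "- (2 * k\<^sup>2 * real p powr (- 2)) \<le> ln (upper_factor k (real p))"
    by (simp add: xx algebra_simps)
  have "k\<^sup>2 * ln (1 - x) \<le> k\<^sup>2 * (- x)" using ln_one_minus_bounds(2)[of x] x by (intro mult_left_mono) auto
  moreover have "k * m * (- ln (1 - s * x)) \<le> k * m * (s * x + (s * x)\<^sup>2 / (1 - s / 2))"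
  proof (intro mult_left_mono km)
    have "(s * x)\<^sup>2 / (1 - s * x) \<le> (s * x)\<^sup>2 / (1 - s / 2)" using s sx sx1 by (intro divide_left_mono) auto
    then show "- ln (1 - s * x) \<le> s * x + (s * x)\<^sup>2 / (1 - s / 2)"
      using ln_one_minus_bounds(1)[OF sx0 sx1] by linarith
  qed
  moreover have "k * m * (s * x + (s * x)\<^sup>2 / (1 - s / 2)) = (k * m * s) * x + (k * m * s) * s * x\<^sup>2 / (1 - s / 2)"
    by (simp add: power2_eq_square distrib_left mult_ac)
  ultimately have "ln (upper_factor k (real p)) \<le> k\<^sup>2 * s * x\<^sup>2 / (1 - s / 2)"
    unfolding lnu s(3) by linarith
  then show "ln (upper_factor k (real p)) \<le> k\<^sup>2 * s / (1 - s / 2) * real p powr (- 2)"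
    by (simp add: xx)
qed

lemma upper_factor_ln_abs:
  assumes k: "k \<ge> 1"
  shows "\<exists>C. \<forall>p. prime p \<longrightarrow> \<bar>ln (upper_factor k (real p))\<bar> \<le> C * real p powr (- 2)"
proof -
  define s where "s = k / of_int \<lfloor>k\<rfloor>"
  define C where "C = max (2 * k\<^sup>2) (k\<^sup>2 * s / (1 - s / 2))"
  have "\<bar>ln (upper_factor k (real p))\<bar> \<le> C * real p powr (- 2)" if p: "prime p" for p
  proof -
    have "2 * k\<^sup>2 * real p powr (- 2) \<le> C * real p powr (- 2)" "k\<^sup>2 * s / (1 - s / 2) * real p powr (- 2) \<le> C * real p powr (- 2)"
      by (intro mult_right_mono; simp add: C_def)+
    then show ?thesis using upper_factor_ln[OF k p] unfolding s_def by linarith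
  qed
  then show ?thesis by blast
qed

lemma upper_factor_limit:
  assumes "k \<ge> 1"
  shows "(\<lambda>N. \<Prod>p\<in>primes_upto N. upper_factor k (real p)) \<longlonglongrightarrow> prime_prod (upper_factor k)"
proof -
  obtain C where "\<And>p. prime p \<Longrightarrow> \<bar>ln (upper_factor k (real p))\<bar> \<le> C * real p powr (- 2)"
    using upper_factor_ln_abs[OF assms] by blast
  then show ?thesis using upper_factor_ln(1)[OF assms] by (intro prime_prod_limit(1))
qed

lemma euler_factor_norm_le:
  assumes k: "k \<ge> 1" and p: "prime p"
  shows "euler_factor_norm k p powr (2 * k) \<le> (1 - k / of_int \<lfloor>k\<rfloor> * (1 / real p)) powr (- (k * of_int \<lfloor>k\<rfloor>))"
proof -
  define m where "m = nat \<lfloor>k\<rfloor>"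
  have m: "real m = of_int \<lfloor>k\<rfloor>" using k by (simp add: m_def)
  have c2: "(cmod (zcoef p))\<^sup>2 = 1 / real p" by (rule cmod_zcoef)
  have p2: "real p \<ge> 2" using prime_ge_2_nat[OF p] by simp
  have "euler_factor_norm k p powr (2 * k) = (\<integral>y. cmod (1 / (1 - zcoef p * e1 y)) powr (2 * k) \<partial>circle)"
    unfolding euler_factor_norm_def using k by (subst circle.Lnorm_powr) auto
  also have "\<dots> = (\<integral>y. cmod (1 - zcoef p * e1 y) powr (- (2 * k)) \<partial>circle)"
    by (simp add: norm_divide powr_divide powr_minus inverse_eq_divide)
  also have "\<dots> \<le> (1 - k / m * (cmod (zcoef p))\<^sup>2) powr (- (k * m))"
  proof (rule circle.geometric_norm_le[OF k])
    show "real m \<le> k" "k < real m + 1" unfolding m by linarith+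
    have "1 / real p * (k / m) \<le> 1/2 * (k / m)" using p2 k by (intro mult_right_mono) (auto simp: field_simps)
    also have "\<dots> < 1" using floor_ratio(3)[OF k] by (simp add: m)
    finally show "(cmod (zcoef p))\<^sup>2 * (k / m) < 1" by (simp add: c2)
  qed
  finally show ?thesis by (simp add: c2 m)
qed

section \<open>Letting the set of deleted primes exhaust all primes\<close>

lemma upper_weight_sum_limit:
  assumes k: "k \<ge> 1" and A: "finite A"
  shows "(\<lambda>N. upper_weight_sum A k N / ln (real N) powr k) \<longlonglongrightarrow> euler_conv.H (upper_weight A k) k 0 / Gamma (k + 1)"
proof -
  obtain C where "euler_conv (upper_weight A k) k C" using euler_conv_upper_weight[OF k A] by blast
  then interpret euler_conv "upper_weight A k" k C .
  show ?thesis using partial_sum_asymp by (simp add: upper_weight_sum_def)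
qed

lemma H_upper_weight_pos:
  assumes k: "k \<ge> 1" and A: "finite A" shows "euler_conv.H (upper_weight A k) k 0 > 0"
proof -
  obtain C where "euler_conv (upper_weight A k) k C" using euler_conv_upper_weight[OF k A] by blast
  then interpret euler_conv "upper_weight A k" k C .
  show ?thesis by (rule H_pos)
qed

lemma norm_bounded_empty:
  assumes k: "k \<ge> 1" and A: "finite A" "\<And>q. q \<in> A \<Longrightarrow> prime q"
    and nb: "norm_bounded A k \<beta>" and b0: "\<beta> \<ge> 0"
  shows "norm_bounded {} k ((\<Prod>p\<in>A. euler_factor_norm k p) * \<beta>)"
  using A nb b0
proof (induction A arbitrary: \<beta>)
  case (insert p A)
  have "norm_bounded A k (euler_factor_norm k p * \<beta>)"
    using insert by (intro norm_bounded_step[OF k _ _ _ _ _ upper_weight_sum_limit[OF k]]) auto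
  then have "norm_bounded {} k ((\<Prod>p\<in>A. euler_factor_norm k p) * (euler_factor_norm k p * \<beta>))"
    using insert by (intro insert.IH) (auto simp: euler_factor_norm_def)
  then show ?case using insert by (simp add: mult_ac)
qed simp

text \<open>Deleting the primes up to \<open>y\<close> changes finitely many normalised Euler
  factors, from \<open>R p\<close> to \<open>(1 - 1 / p) powr k\<close>. The product of
  \<open>R\<close> over all primes is the constant without deletion, so in the quotient the
  contribution of the splitting weights tends to 1 as \<open>y\<close> grows.\<close>

lemma H_upper_weight_relation:
  assumes k: "k \<ge> 1"
  defines "R \<equiv> euler_conv.R (upper_weight {} k) k 0"
  shows "euler_conv.H (upper_weight (primes_upto y) k) k 0 =
    euler_conv.H (upper_weight {} k) k 0 * (\<Prod>p\<in>primes_upto y. (1 - 1 / real p) powr k) / (\<Prod>p\<in>primes_upto y. R p)"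
    and "(\<lambda>y. \<Prod>p\<in>primes_upto y. R p) \<longlonglongrightarrow> euler_conv.H (upper_weight {} k) k 0"
    and "prime p \<Longrightarrow> R p > 0"
proof -
  obtain C where "euler_conv (upper_weight (primes_upto y) k) k C" using euler_conv_upper_weight[OF k, of "primes_upto y"] by auto
  then interpret A: euler_conv "upper_weight (primes_upto y) k" k C .
  obtain C' where "euler_conv (upper_weight {} k) k C'" using euler_conv_upper_weight[OF k, of "{}"] by auto
  then interpret O: euler_conv "upper_weight {} k" k C' .
  have Rpos: "R p > 0" if "prime p" for p unfolding R_def using O.R_pos[OF that] by simp
  then show "prime p \<Longrightarrow> R p > 0" .
  show Rlim: "(\<lambda>y. \<Prod>p\<in>primes_upto y. R p) \<longlonglongrightarrow> O.H 0" unfolding R_def by (rule O.prod_R) auto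
  have in1: "A.R 0 p = (1 - 1 / real p) powr k" if "p \<in> primes_upto y" for p
  proof -
    have "euler_factor (upper_weight (primes_upto y) k) (- (1 + 0)) p = 1"
      unfolding euler_factor_def by (subst suminf_finite[of "{0}"]) (use that in \<open>auto simp: upper_weight_def\<close>)
    moreover have "real p powr (- (1 + 0)) = 1 / real p" using that by (simp add: powr_minus inverse_eq_divide primes_upto_def prime_gt_0_nat)
    ultimately show ?thesis by (simp add: A.R_def)
  qed
  have out1: "A.R 0 p = R p" if "p \<notin> primes_upto y" for p
  proof -
    have "upper_weight (primes_upto y) k p = upper_weight {} k p" using that by (auto simp: upper_weight_def)
    then show ?thesis by (simp add: R_def A.R_def O.R_def euler_factor_def)
  qed
  have ev: "\<forall>\<^sub>F N in sequentially. (\<Prod>p\<in>primes_upto N. R p) * (\<Prod>p\<in>primes_upto y. (1 - 1 / real p) powr k) / (\<Prod>p\<in>primes_upto y. R p) = (\<Prod>p\<in>primes_upto N. A.R 0 p)"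
    using eventually_ge_at_top[of y]
  proof eventually_elim
    case (elim N)
    have sub: "primes_upto y \<subseteq> primes_upto N" using elim by (auto simp: primes_upto_def)
    have nz: "(\<Prod>p\<in>primes_upto y. R p) \<noteq> 0" using Rpos by (auto simp: prod_zero_iff dest!: primes_uptoD) (metis less_irrefl)
    have "(\<Prod>p\<in>primes_upto N. A.R 0 p) = (\<Prod>p\<in>primes_upto N - primes_upto y. A.R 0 p) * (\<Prod>p\<in>primes_upto y. A.R 0 p)"
      by (rule prod.subset_diff[OF sub]) simp
    also have "\<dots> = (\<Prod>p\<in>primes_upto N - primes_upto y. R p) * (\<Prod>p\<in>primes_upto y. (1 - 1 / real p) powr k)"
      by (simp add: in1 out1)
    also have "(\<Prod>p\<in>primes_upto N - primes_upto y. R p) = (\<Prod>p\<in>primes_upto N. R p) / (\<Prod>p\<in>primes_upto y. R p)"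
      using prod.subset_diff[OF sub, of R] nz by simp
    finally show ?case by simp
  qed
  have "(\<lambda>N. (\<Prod>p\<in>primes_upto N. R p) * (\<Prod>p\<in>primes_upto y. (1 - 1 / real p) powr k) / (\<Prod>p\<in>primes_upto y. R p)) \<longlonglongrightarrow>
     O.H 0 * (\<Prod>p\<in>primes_upto y. (1 - 1 / real p) powr k) / (\<Prod>p\<in>primes_upto y. R p)"
    using Rpos by (intro tendsto_intros Rlim) (auto simp: prod_zero_iff dest!: primes_uptoD, metis less_irrefl)
  from Lim_transform_eventually[OF this ev]
  have "(\<lambda>N. \<Prod>p\<in>primes_upto N. A.R 0 p) \<longlonglongrightarrow> O.H 0 * (\<Prod>p\<in>primes_upto y. (1 - 1 / real p) powr k) / (\<Prod>p\<in>primes_upto y. R p)" .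
  moreover have "(\<lambda>N. \<Prod>p\<in>primes_upto N. A.R 0 p) \<longlonglongrightarrow> A.H 0" by (rule A.prod_R) auto
  ultimately show "A.H 0 = O.H 0 * (\<Prod>p\<in>primes_upto y. (1 - 1 / real p) powr k) / (\<Prod>p\<in>primes_upto y. R p)"
    by (rule LIMSEQ_unique[rotated])
qed

lemma limsup_le_of_norm_bounded:
  assumes k: "k \<ge> 1" and nb: "norm_bounded {} k \<beta>" and b0: "\<beta> \<ge> 0"
  shows "limsup (\<lambda>N. ereal (normalized_pseudomoment k N)) \<le> ereal (\<beta> powr (2 * k))"
proof (rule tendsto_lowerbound)
  show "((\<lambda>\<epsilon>. ereal ((\<beta> + \<epsilon>) powr (2 * k))) \<longlongrightarrow> ereal (\<beta> powr (2 * k))) (at_right 0)"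
  proof (intro tendsto_ereal)
    have "((\<lambda>\<epsilon>. (\<beta> + \<epsilon>) powr (2 * k)) \<longlongrightarrow> (\<beta> + 0) powr (2 * k)) (at_right 0)"
      using k b0 by (intro tendsto_powr' tendsto_intros) (auto simp: eventually_at_right_less eventually_at_filter)
    then show "((\<lambda>\<epsilon>. (\<beta> + \<epsilon>) powr (2 * k)) \<longlongrightarrow> \<beta> powr (2 * k)) (at_right 0)" by simp
  qed
  have "limsup (\<lambda>N. ereal (normalized_pseudomoment k N)) \<le> ereal ((\<beta> + \<epsilon>) powr (2 * k))" if e: "\<epsilon> > 0" for \<epsilon>
  proof (rule Limsup_bounded)
    have "\<forall>\<^sub>F N in sequentially. Lnorm torus (2 * k) (dirichlet_poly zcoef (rough {} N)) \<le> (\<beta> + \<epsilon>) * ln (real N) powr (k / 2)"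
      using nb e by (simp add: norm_bounded_def)
    then show "\<forall>\<^sub>F N in sequentially. ereal (normalized_pseudomoment k N) \<le> ereal ((\<beta> + \<epsilon>) powr (2 * k))"
      using eventually_gt_at_top[of 1]
    proof eventually_elim
      case (elim N)
      have L: "ln (real N) > 0" using elim by simp
      have "pseudomoment k N \<le> ((\<beta> + \<epsilon>) * ln (real N) powr (k / 2)) powr (2 * k)"
        using pseudomoment_eq[of k N] k elim by (auto intro!: powr_mono2)
      also have "\<dots> = (\<beta> + \<epsilon>) powr (2 * k) * ln (real N) powr (k\<^sup>2)"
        using b0 e by (simp add: powr_mult powr_powr power2_eq_square)
      finally show ?case using L by (simp add: normalized_pseudomoment_def divide_le_eq)
    qed
  qed
  then show "\<forall>\<^sub>F \<epsilon> in at_right 0. limsup (\<lambda>N. ereal (normalized_pseudomoment k N)) \<le> ereal ((\<beta> + \<epsilon>) powr (2 * k))"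
    by (auto simp: eventually_at_right_less eventually_at_filter)
qed simp

text \<open>The left-hand side does not depend on \<open>y\<close>. The bound for given
  \<open>y\<close> consists of the upper factors of the primes up to \<open>y\<close> and of
  \<open>(H0 / \<Prod>R / G) powr k\<close>, where \<open>\<Prod>R\<close> runs over the same
  primes; only the second part involves the splitting weights. It tends to
  \<open>1 / Gamma (k + 1) powr k\<close>, and the first part to the infinite product.\<close>

theorem limsup_upper:
  assumes k: "k \<ge> 1"
  shows "limsup (\<lambda>N. ereal (normalized_pseudomoment k N)) \<le> ereal (upper_const k)"
proof -
  define R where "R = euler_conv.R (upper_weight {} k) k 0"
  define H0 where "H0 = euler_conv.H (upper_weight {} k) k 0"
  define G where "G = Gamma (k + 1)"
  have G: "G > 0" unfolding G_def using k by (intro Gamma_real_pos) auto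
  have H0: "H0 > 0" unfolding H0_def by (rule H_upper_weight_pos[OF k]) simp
  have Rpos: "R p > 0" if "prime p" for p unfolding R_def by (rule H_upper_weight_relation(3)[OF k that])
  have step: "limsup (\<lambda>N. ereal (normalized_pseudomoment k N)) \<le>
     ereal ((\<Prod>p\<in>primes_upto y. upper_factor k (real p)) * (H0 / (\<Prod>p\<in>primes_upto y. R p) / G) powr k)" for y
  proof -
    define A where "A = primes_upto y"
    define HA where "HA = euler_conv.H (upper_weight A k) k 0"
    define \<beta> where "\<beta> = (\<Prod>p\<in>A. euler_factor_norm k p) * sqrt (HA / G)"
    have fA: "finite A" by (simp add: A_def)
    have HA: "HA > 0" unfolding HA_def by (rule H_upper_weight_pos[OF k fA])
    have I0: "euler_factor_norm k p \<ge> 0" for p by (simp add: euler_factor_norm_def)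
    have "norm_bounded A k (sqrt (HA / G))"
      unfolding HA_def G_def by (rule norm_boundedI_upper_weight_sum[OF k upper_weight_sum_limit[OF k fA]])
    then have "norm_bounded {} k \<beta>"
      unfolding \<beta>_def using HA G by (intro norm_bounded_empty[OF k fA]) (auto simp: A_def primes_uptoD)
    moreover have b0: "\<beta> \<ge> 0" unfolding \<beta>_def using I0 HA G by (intro mult_nonneg_nonneg prod_nonneg) auto
    ultimately have "limsup (\<lambda>N. ereal (normalized_pseudomoment k N)) \<le> ereal (\<beta> powr (2 * k))"
      by (rule limsup_le_of_norm_bounded[OF k])
    also have "\<beta> powr (2 * k) \<le> (\<Prod>p\<in>A. upper_factor k (real p)) * (H0 / (\<Prod>p\<in>A. R p) / G) powr k"
    proof -
      have HAe: "HA = H0 * (\<Prod>p\<in>A. (1 - 1 / real p) powr k) / (\<Prod>p\<in>A. R p)"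
        unfolding HA_def H0_def R_def A_def by (rule H_upper_weight_relation(1)[OF k])
      have "\<beta> powr (2 * k) = (\<Prod>p\<in>A. euler_factor_norm k p) powr (2 * k) * sqrt (HA / G) powr (2 * k)"
        unfolding \<beta>_def by (rule powr_mult)
      also have "sqrt (HA / G) powr (2 * k) = (HA / G) powr k"
        using HA G by (simp add: powr_half_sqrt[symmetric] powr_powr)
      also have "(\<Prod>p\<in>A. euler_factor_norm k p) powr (2 * k) = (\<Prod>p\<in>A. euler_factor_norm k p powr (2 * k))" by (rule prod_powr_distrib)
      also have "HA / G = (\<Prod>p\<in>A. (1 - 1 / real p) powr k) * (H0 / (\<Prod>p\<in>A. R p) / G)" unfolding HAe by simp
      also have "((\<Prod>p\<in>A. (1 - 1 / real p) powr k) * (H0 / (\<Prod>p\<in>A. R p) / G)) powr k = (\<Prod>p\<in>A. (1 - 1 / real p) powr k) powr k * (H0 / (\<Prod>p\<in>A. R p) / G) powr k"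
        by (rule powr_mult)
      also have "(\<Prod>p\<in>A. (1 - 1 / real p) powr k) powr k = (\<Prod>p\<in>A. (1 - 1 / real p) powr (k\<^sup>2))"
        by (simp add: prod_powr_distrib powr_powr power2_eq_square)
      also have "(\<Prod>p\<in>A. euler_factor_norm k p powr (2 * k)) * ((\<Prod>p\<in>A. (1 - 1 / real p) powr (k\<^sup>2)) * (H0 / (\<Prod>p\<in>A. R p) / G) powr k)
         = (\<Prod>p\<in>A. (1 - 1 / real p) powr (k\<^sup>2) * euler_factor_norm k p powr (2 * k)) * (H0 / (\<Prod>p\<in>A. R p) / G) powr k"
        by (simp add: prod.distrib)
      also have "\<dots> \<le> (\<Prod>p\<in>A. upper_factor k (real p)) * (H0 / (\<Prod>p\<in>A. R p) / G) powr k"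
        unfolding upper_factor_def
        by (intro mult_right_mono prod_mono conjI mult_left_mono euler_factor_norm_le k) (auto simp: A_def primes_uptoD)
      finally show ?thesis .
    qed
    finally show ?thesis by (simp add: A_def)
  qed
  have "(\<lambda>y. (\<Prod>p\<in>primes_upto y. upper_factor k (real p)) * (H0 / (\<Prod>p\<in>primes_upto y. R p) / G) powr k) \<longlonglongrightarrow>
     prime_prod (upper_factor k) * (H0 / H0 / G) powr k"
    using H0 G H_upper_weight_relation(2)[OF k] unfolding R_def H0_def
    by (intro tendsto_mult upper_factor_limit[OF k] tendsto_powr tendsto_divide tendsto_const) auto
  also have "prime_prod (upper_factor k) * (H0 / H0 / G) powr k = upper_const k"
    using H0 G by (simp add: upper_const_def upper_factor_def[abs_def] G_def powr_divide)
  finally have "(\<lambda>y. ereal ((\<Prod>p\<in>primes_upto y. upper_factor k (real p)) * (H0 / (\<Prod>p\<in>primes_upto y. R p) / G) powr k)) \<longlonglongrightarrow> ereal (upper_const k)"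
    by (rule tendsto_ereal)
  then show ?thesis by (rule tendsto_lowerbound) (use step in auto)
qed

subsection \<open>The lower bound\<close>

text \<open>\<open>factorization_count N j l\<close> counts the factorizations of \<open>l\<close> into \<open>j\<close> ordered factors that are at most \<open>N\<close>.\<close>

fun factorization_count :: "nat \<Rightarrow> nat \<Rightarrow> nat \<Rightarrow> real" where
  "factorization_count N 0 l = (if l = 1 then 1 else 0)"
| "factorization_count N (Suc j) l = (\<Sum>d\<in>{d. d dvd l \<and> 0 < d \<and> d \<le> N}. factorization_count N j (l div d))"

lemma factorization_count_eq_0: "l > N ^ j \<Longrightarrow> factorization_count N j l = 0"
proof (induction j arbitrary: l)
  case (Suc j)
  have "factorization_count N j (l div d) = 0" if d: "d dvd l" "0 < d" "d \<le> N" for d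
  proof (rule Suc.IH)
    obtain m where m: "l = d * m" using d by auto
    have "N ^ j * d \<le> N ^ j * N" using d by simp
    also have "\<dots> < l" using Suc.prems by (simp add: mult.commute)
    finally show "N ^ j < l div d" using m d by (simp add: mult.commute)
  qed
  then show ?case by (auto intro!: sum.neutral)
qed auto

lemma zcoef_1: "zcoef (Suc 0) = 1"
  by (simp add: zcoef_def)

lemma dirichlet_poly_power:
  assumes N: "N > 0"
  shows "dirichlet_poly zcoef {1..N} x ^ j = dirichlet_poly (\<lambda>l. complex_of_real (factorization_count N j l) * zcoef l) {1..N ^ j} x"
proof (induction j)
  case 0
  show ?case by (simp add: dirichlet_poly_def zcoef_1 cx_def)
next
  case (Suc j)
  define f where "f d m = zcoef d * cx x d * (complex_of_real (factorization_count N j m) * zcoef m * cx x m)" for d m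
  have fl: "f d m = complex_of_real (factorization_count N j m) * (zcoef (d * m) * cx x (d * m))" if "d > 0" "m > 0" for d m
    using that by (simp add: f_def zcoef_mult cx_mult mult_ac)
  have "dirichlet_poly zcoef {1..N} x ^ Suc j = (\<Sum>(d,m)\<in>{1..N} \<times> {1..N ^ j}. f d m)"
    unfolding power_Suc Suc unfolding dirichlet_poly_def sum_product sum.cartesian_product f_def by (rule refl)
  also have "\<dots> = (\<Sum>(l,d)\<in>(SIGMA l:{1..N ^ Suc j}. {d. d dvd l \<and> 0 < d \<and> d \<le> N \<and> l div d \<le> N ^ j}). complex_of_real (factorization_count N j (l div d)) * (zcoef l * cx x l))"
  proof (rule sum.reindex_bij_witness[of _ "\<lambda>(l,d). (d, l div d)" "\<lambda>(d,m). (d * m, d)"], goal_cases)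
    case (1 a)
    then show ?case by auto
  next
    case (2 a)
    then obtain d m where a: "a = (d, m)" "0 < d" "d \<le> N" "0 < m" "m \<le> N ^ j" by auto
    then have "d * m \<le> N * N ^ j" by (intro mult_le_mono)
    then show ?case using a by auto
  next
    case (3 b)
    then show ?case by auto
  next
    case (4 b)
    then obtain l d where b: "b = (l, d)" "0 < l" "d dvd l" "0 < d" "d \<le> N" "l div d \<le> N ^ j" by auto
    then have "l div d > 0" by (simp add: dvd_imp_le div_greater_zero_iff)
    then show ?case using b by auto
  next
    case (5 a)
    then obtain d m where a: "a = (d, m)" "0 < d" "0 < m" by auto
    then show ?case using fl by simp
  qed
  also have "\<dots> = (\<Sum>l=1..N ^ Suc j. \<Sum>d\<in>{d. d dvd l \<and> 0 < d \<and> d \<le> N \<and> l div d \<le> N ^ j}. complex_of_real (factorization_count N j (l div d)) * (zcoef l * cx x l))"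
    by (rule sum.Sigma[symmetric]) auto
  also have "\<dots> = (\<Sum>l=1..N ^ Suc j. complex_of_real (factorization_count N (Suc j) l) * zcoef l * cx x l)"
  proof (intro sum.cong refl)
    fix l
    \<comment> \<open>The constraint \<open>l div d \<le> N ^ j\<close> may be dropped because the
      count vanishes beyond \<open>N ^ j\<close>.\<close>
    have "factorization_count N (Suc j) l = (\<Sum>d\<in>{d. d dvd l \<and> 0 < d \<and> d \<le> N \<and> l div d \<le> N ^ j}. factorization_count N j (l div d))"
      unfolding factorization_count.simps by (rule sum.mono_neutral_right) (auto intro: factorization_count_eq_0)
    then show "(\<Sum>d\<in>{d. d dvd l \<and> 0 < d \<and> d \<le> N \<and> l div d \<le> N ^ j}. complex_of_real (factorization_count N j (l div d)) * (zcoef l * cx x l)) = complex_of_real (factorization_count N (Suc j) l) * zcoef l * cx x l"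
      by (simp add: sum_distrib_right mult.assoc)
  qed
  finally show ?case by (simp add: dirichlet_poly_def)
qed

lemma divisors_squarefree:
  assumes l: "l \<in> smooth P 1" "P = prime_factors l"
  shows "{d. d dvd l} = smooth P 1"
proof (intro equalityI subsetI CollectI)
  have l0: "l > 0" using l by (simp add: smooth_pos)
  fix d
  {
    assume "d \<in> {d. d dvd l}"
    then have d: "d dvd l" by simp
    have "d > 0" using d l0 by (auto intro: Nat.gr0I)
    moreover have "prime_factors d \<subseteq> P" using d l0 l by (simp add: dvd_prime_factors)
    moreover have "multiplicity p d \<le> 1" if "p \<in> P" for p
      using dvd_imp_multiplicity_le[OF d, of p] l0 l that by (force simp: smooth_def)
    ultimately show "d \<in> smooth P 1" by (simp add: smooth_def)
  next
    assume d: "d \<in> smooth P 1"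
    then have d0: "d \<noteq> 0" using smooth_pos by blast
    show "d dvd l"
    proof (rule multiplicity_le_imp_dvd[OF d0])
      fix p :: nat assume p: "prime p"
      show "multiplicity p d \<le> multiplicity p l"
      proof (cases "p \<in> P")
        case True
        then have "multiplicity p l > 0" using l p by (simp add: prime_factors_multiplicity)
        moreover have "multiplicity p d \<le> 1" using d True by (simp add: smooth_def)
        ultimately show ?thesis by simp
      next
        case False
        then have "p \<notin> prime_factors d" using d by (auto simp: smooth_def)
        then show ?thesis using p by (simp add: prime_factors_multiplicity)
      qed
    qed
  }
qed

lemma mult_fun_power_smooth_1:
  fixes c :: real
  assumes "l \<in> smooth P 1"
  shows "mult_fun (\<lambda>p i. c ^ i) l = c ^ card (prime_factors l)"
proof -
  have "multiplicity p l = 1" if "p \<in> prime_factors l" for p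
  proof -
    have "multiplicity p l \<le> 1" using assms that by (auto simp: smooth_def)
    moreover have "multiplicity p l > 0" using that by (simp add: prime_factors_multiplicity)
    ultimately show ?thesis by simp
  qed
  then show ?thesis by (simp add: mult_fun_def)
qed

text \<open>For \<open>l \<le> N\<close> the size restriction on the factors is void, and a
  factorization of a squarefree number assigns each of its primes to one of the \<open>j\<close>
  factors. In the induction, the sum of \<open>j ^ \<omega>(d)\<close> over the divisors
  \<open>d\<close> of \<open>l\<close> is evaluated as the product of \<open>1 + j\<close> over the
  primes of \<open>l\<close>.\<close>

lemma factorization_count_squarefree:
  assumes "l \<le> N" "l \<in> smooth (prime_factors l) 1"
  shows "factorization_count N j l = real j ^ card (prime_factors l)"
  using assms
proof (induction j arbitrary: l)
  case 0
  then have l0: "l > 0" by (simp add: smooth_pos)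
  show ?case
  proof (cases "l = 1")
    case False
    then have "prime_factors l \<noteq> {}" using l0 by (simp add: prime_factorization_empty_iff)
    then have "card (prime_factors l) > 0" by (simp add: card_gt_0_iff)
    then show ?thesis using False by simp
  qed simp
next
  case (Suc j)
  define P where "P = prime_factors l"
  have l0: "l > 0" using Suc.prems by (simp add: smooth_pos)
  have div: "{d. d dvd l} = smooth P 1" using Suc.prems by (intro divisors_squarefree) (auto simp: P_def)
  have fin: "finite P" "\<And>q. q \<in> P \<Longrightarrow> prime q" by (auto simp: P_def)
  have sub: "d \<in> smooth (prime_factors d) 1" if "d \<in> smooth P 1" for d using that by (auto simp: smooth_def)
  have "factorization_count N (Suc j) l = (\<Sum>d\<in>{d. d dvd l}. factorization_count N j (l div d))"
    unfolding factorization_count.simps using Suc.prems l0 by (intro sum.cong) (auto dest: dvd_imp_le intro: Nat.gr0I)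
  also have "\<dots> = (\<Sum>d\<in>{d. d dvd l}. factorization_count N j d)"
    using l0 by (intro sum.reindex_bij_witness[of _ "\<lambda>d. l div d" "\<lambda>d. l div d"]) (auto simp: div_dvd_div elim!: dvdE)
  also have "\<dots> = (\<Sum>d\<in>smooth P 1. mult_fun (\<lambda>p i. real j ^ i) d * real d powr 0)"
    unfolding div
  proof (intro sum.cong refl)
    fix d assume d: "d \<in> smooth P 1"
    then have "d dvd l" using div by auto
    then have "d \<le> N" using dvd_imp_le[OF _ l0] Suc.prems by (meson order_trans)
    then have "factorization_count N j d = real j ^ card (prime_factors d)" using sub[OF d] by (rule Suc.IH)
    also have "\<dots> = mult_fun (\<lambda>p i. real j ^ i) d" by (rule mult_fun_power_smooth_1[OF d, symmetric])
    finally show "factorization_count N j d = mult_fun (\<lambda>p i. real j ^ i) d * real d powr 0" using smooth_pos[OF d] by simp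
  qed
  also have "\<dots> = (\<Prod>p\<in>P. \<Sum>i\<le>1. real j ^ i * (real p powr 0) ^ i)"
    using fin by (intro sum_mult_fun_smooth) auto
  also have "\<dots> = (\<Prod>p\<in>P. real (Suc j))"
  proof (intro prod.cong refl)
    fix p assume "p \<in> P"
    then have "real p > 0" using fin(2) prime_gt_0_nat by simp
    then show "(\<Sum>i\<le>1. real j ^ i * (real p powr 0) ^ i) = real (Suc j)" by simp
  qed
  also have "\<dots> = real (Suc j) ^ card P" by simp
  finally show ?case by (simp add: P_def)
qed

text \<open>The associated multiplicative function is
  \<open>\<mu>(n)\<^sup>2 * L ^ \<omega>(n)\<close> for \<open>n > 0\<close>, with
  \<open>\<mu>\<close> the Moebius function.\<close>

definition lower_weight :: "real \<Rightarrow> nat \<Rightarrow> nat \<Rightarrow> real" where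
  "lower_weight L p i = (if i \<le> 1 then L ^ i else 0)"

lemma lower_weight_euler_factor: "(\<lambda>j. lower_weight L p j * x ^ j) sums (1 + L * x)"
proof -
  have "(\<lambda>j. lower_weight L p j * x ^ j) sums (\<Sum>j\<in>{..1}. lower_weight L p j * x ^ j)"
    by (rule sums_finite) (auto simp: lower_weight_def)
  then show ?thesis by (simp add: lower_weight_def)
qed

lemma euler_conv_lower_weight:
  assumes L: "L \<ge> 1"
  shows "euler_conv (lower_weight L) L (L\<^sup>2 + L^3)"
proof
  fix p :: nat assume p: "prime p"
  have p2: "real p \<ge> 2" using prime_ge_2_nat[OF p] by simp
  show "lower_weight L p 0 = 1" by (simp add: lower_weight_def)
  show "lower_weight L p j \<ge> 0" for j using L by (simp add: lower_weight_def)
  show "summable (\<lambda>j. lower_weight L p j * (real p powr (- 1)) ^ j)" by (rule sums_summable[OF lower_weight_euler_factor])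
  fix \<sigma> :: real assume s: "0 \<le> \<sigma>" "\<sigma> \<le> 1"
  define x where "x = real p powr (- (1 + \<sigma>))"
  have x: "0 < x" "x \<le> 1/2" unfolding x_def using prime_powr_less_1[OF p s(1)] by auto
  have E: "euler_factor (lower_weight L) (- (1 + \<sigma>)) p = 1 + L * x + 0"
    unfolding euler_factor_def x_def using lower_weight_euler_factor by (simp add: sums_iff)
  have "x\<^sup>2 = real p powr (2 * - (1 + \<sigma>))"
    using p2 by (simp add: x_def power2_eq_square flip: powr_add)
  also have "\<dots> \<le> real p powr (- (3/2))" using p2 s by (intro powr_mono) auto
  finally have x2: "x\<^sup>2 \<le> real p powr (- (3/2))" .
  have "\<bar>(1 - x) powr L * (1 + L * x + 0) - 1\<bar> \<le> 0 + (L\<^sup>2 + L^3) * x\<^sup>2"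
    by (rule euler_factor_bound) (use L x in auto)
  also have "\<dots> \<le> (L\<^sup>2 + L^3) * real p powr (- (3/2))" using x2 L by (simp add: mult_left_mono)
  finally show "\<bar>(1 - real p powr (- (1 + \<sigma>))) powr L * euler_factor (lower_weight L) (- (1 + \<sigma>)) p - 1\<bar> \<le> (L\<^sup>2 + L^3) * real p powr (- (3/2))"
    by (simp only: E x_def)
qed (use L in auto)

lemma mult_fun_lower_weight_not_squarefree:
  assumes "n > 0" "n \<notin> smooth (prime_factors n) 1"
  shows "mult_fun (lower_weight L) n = 0"
proof -
  obtain p where p: "p \<in> prime_factors n" "multiplicity p n > 1"
    using assms by (auto simp: smooth_def not_le)
  then show ?thesis unfolding mult_fun_def by (intro prod_zero) (auto simp: lower_weight_def intro!: bexI[of _ p])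
qed

text \<open>For \<open>Z\<close> the Dirichlet polynomial,
  \<open>\<bar>Z ^ M\<bar> powr q = \<bar>Z\<bar> powr (2 * k)\<close>, and the bounds on
  \<open>M\<close> say that \<open>1 \<le> q \<le> 2\<close>. At squarefree \<open>n \<le> N\<close>
  the squared coefficient of \<open>Z ^ M\<close> is \<open>(M ^ \<omega>(n))\<^sup>2 / n\<close>,
  and the tensor weight \<open>(q/2) ^ \<omega>(n)\<close> turns it into
  \<open>(M * k) ^ \<omega>(n) / n\<close>. The terms with \<open>n > N\<close>, where the
  truncation distorts the coefficients, are nonnegative and are discarded.\<close>

theorem pseudomoment_ge:
  assumes k: "k \<ge> 1" and N: "N > 0" and M: "M > 0" "real M \<le> 2 * k" "k \<le> real M"
  shows "(\<Sum>n=1..N. mult_fun (lower_weight (M * k)) n / real n) powr (k / M) \<le> pseudomoment k N"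
proof -
  define q where "q = 2 * k / M"
  have q: "1 \<le> q" "q \<le> 2" using M by (auto simp: q_def field_simps)
  define Q where "Q = N ^ M"
  define P where "P = primes_upto Q"
  define c where "c l = complex_of_real (factorization_count N M l) * zcoef l" for l
  define Z where "Z = dirichlet_poly zcoef {1..N}"
  have Q1: "Q \<ge> 1" using N by (simp add: Q_def Suc_le_eq)
  have NQ: "N \<le> Q" using N M by (simp add: Q_def self_le_power Suc_le_eq)
  have P: "finite P" "\<And>p. p \<in> P \<Longrightarrow> prime p" by (auto simp: P_def primes_uptoD)
  have fin: "finite (smooth P J)" for J by (rule finite_smooth[OF P])
  have sub: "{1..Q} \<subseteq> smooth P Q" using atLeastAtMost_subset_smooth[of Q] by (simp add: P_def primes_upto_def)
  have ZM: "Z x ^ M = dirichlet_poly c (smooth P Q) x" for x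
  proof -
    have "Z x ^ M = dirichlet_poly c {1..Q} x" using dirichlet_poly_power[OF N] by (simp add: Z_def c_def[abs_def] Q_def)
    also have "\<dots> = dirichlet_poly c (smooth P Q) x"
      unfolding dirichlet_poly_def
    proof (rule sum.mono_neutral_left[OF fin sub], intro ballI)
      fix l assume l: "l \<in> smooth P Q - {1..Q}"
      then have "l > N ^ M" using smooth_pos[of l P Q] by (auto simp: Q_def)
      then show "c l * cx x l = 0" by (simp add: c_def factorization_count_eq_0)
    qed
    finally show ?thesis .
  qed
  have sq: "mult_fun (lower_weight (M * k)) n / real n = mult_fun (\<lambda>p j. (q/2) ^ j) n * (cmod (c n))\<^sup>2"
    if n: "n \<in> smooth P 1" "n \<le> N" for n
  proof -
    have n': "n \<in> smooth (prime_factors n) 1" using n by (auto simp: smooth_def)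
    define r where "r = card (prime_factors n)"
    have "real M * k = q/2 * (real M * real M)" using M by (simp add: q_def)
    then have Mk: "(real M * k) ^ r = (q/2) ^ r * ((real M) ^ r)\<^sup>2"
      by (simp only: power_mult_distrib power2_eq_square)
    have "mult_fun (lower_weight (M * k)) n = mult_fun (\<lambda>p j. (M * k) ^ j) n"
      unfolding mult_fun_def using n' by (intro prod.cong refl) (auto simp: lower_weight_def smooth_def)
    also have "\<dots> = (M * k) ^ r" unfolding r_def by (rule mult_fun_power_smooth_1[OF n(1)])
    also note Mk
    finally have 1: "mult_fun (lower_weight (M * k)) n = (q/2) ^ r * ((real M) ^ r)\<^sup>2" .
    have 2: "mult_fun (\<lambda>p j. (q/2) ^ j) n = (q/2) ^ r" unfolding r_def by (rule mult_fun_power_smooth_1[OF n(1)])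
    have "factorization_count N M n = real M ^ r" unfolding r_def by (rule factorization_count_squarefree[OF n(2) n'])
    then have "(cmod (c n))\<^sup>2 = ((real M) ^ r)\<^sup>2 * (1 / real n)"
      by (simp add: c_def norm_mult norm_power power_mult_distrib cmod_zcoef)
    then show ?thesis by (simp add: 1 2)
  qed
  have "(\<Sum>n=1..N. mult_fun (lower_weight (M * k)) n / real n) = (\<Sum>n\<in>{n\<in>smooth P 1. n \<le> N}. mult_fun (lower_weight (M * k)) n / real n)"
  proof (rule sum.mono_neutral_right)
    show "{n \<in> smooth P 1. n \<le> N} \<subseteq> {1..N}" using smooth_pos by (auto simp: Suc_le_eq)
    show "\<forall>n\<in>{1..N} - {n \<in> smooth P 1. n \<le> N}. mult_fun (lower_weight (M * k)) n / real n = 0"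
    proof
      fix n assume n: "n \<in> {1..N} - {n \<in> smooth P 1. n \<le> N}"
      then have "n \<in> smooth P Q" using sub NQ by auto
      then have "prime_factors n \<subseteq> P" by (simp add: smooth_def)
      moreover have "\<forall>p\<in>P. p \<notin> prime_factors n \<longrightarrow> multiplicity p n = 0"
        using P by (auto simp: prime_factors_multiplicity)
      ultimately have "n \<notin> smooth (prime_factors n) 1" using n by (force simp: smooth_def)
      then show "mult_fun (lower_weight (M * k)) n / real n = 0" using n by (simp add: mult_fun_lower_weight_not_squarefree)
    qed
  qed simp
  also have "\<dots> = (\<Sum>n\<in>{n\<in>smooth P 1. n \<le> N}. mult_fun (\<lambda>p j. (q/2) ^ j) n * (cmod (c n))\<^sup>2)"
    by (intro sum.cong refl) (auto simp: sq)
  also have "\<dots> \<le> (\<Sum>n\<in>smooth P 1. mult_fun (\<lambda>p j. (q/2) ^ j) n * (cmod (c n))\<^sup>2)"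
    using q fin by (intro sum_mono2) (auto intro!: mult_nonneg_nonneg mult_fun_nonneg)
  also have "\<dots> \<le> (Lnorm torus q (dirichlet_poly c (smooth P Q)))\<^sup>2"
    by (rule tensor_lower[OF q Q1 P])
  finally have le: "(\<Sum>n=1..N. mult_fun (lower_weight (M * k)) n / real n) \<le> (Lnorm torus q (dirichlet_poly c (smooth P Q)))\<^sup>2" .
  have nn: "(\<Sum>n=1..N. mult_fun (lower_weight (M * k)) n / real n) \<ge> 0"
    using k by (intro sum_nonneg divide_nonneg_nonneg mult_fun_nonneg) (auto simp: lower_weight_def)
  have "(\<Sum>n=1..N. mult_fun (lower_weight (M * k)) n / real n) powr (k / M) \<le> ((Lnorm torus q (dirichlet_poly c (smooth P Q)))\<^sup>2) powr (q / 2)"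
    using le nn k by (simp add: q_def powr_mono2)
  also have "\<dots> = Lnorm torus q (dirichlet_poly c (smooth P Q)) powr q"
    by (simp add: powr_powr flip: powr_numeral)
  also have "\<dots> = (\<integral>x. cmod (dirichlet_poly c (smooth P Q) x) powr q \<partial>torus)" using q by (simp add: torus.Lnorm_powr)
  also have "\<dots> = (\<integral>x. cmod (Z x) powr (2 * k) \<partial>torus)"
  proof (intro Bochner_Integration.integral_cong refl)
    fix x
    have "cmod (dirichlet_poly c (smooth P Q) x) powr q = (cmod (Z x) ^ M) powr q" by (simp add: ZM[symmetric] norm_power)
    also have "\<dots> = cmod (Z x) powr (2 * k)"
    proof (cases "Z x = 0")
      case True
      then show ?thesis using M by (simp add: power_0_left)
    next
      case False
      then show ?thesis using M by (simp add: powr_powr q_def flip: powr_realpow)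
    qed
    finally show "cmod (dirichlet_poly c (smooth P Q) x) powr q = cmod (Z x) powr (2 * k)" .
  qed
  also have "\<dots> = pseudomoment k N" using k by (simp add: pseudomoment_eq Z_def torus.Lnorm_powr)
  finally show ?thesis .
qed

definition lower_factor :: "real \<Rightarrow> real \<Rightarrow> real" where
  "lower_factor k p = (1 - 1 / p) powr (k\<^sup>2) * (1 + of_int \<lfloor>2 * k\<rfloor> * k / p) powr (k / of_int \<lfloor>2 * k\<rfloor>)"

text \<open>Again the terms of order \<open>1/p\<close> cancel, leaving an error
  \<open>k\<^sup>2 * (2 + L) / p\<^sup>2\<close>. As \<open>L\<close> grows like
  \<open>k\<^sup>2\<close>, this is too weak for primes much smaller than \<open>k\<^sup>2\<close>;
  for these the last bound, which discards the nonnegative logarithm of \<open>1 + L / p\<close>, is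
  better.\<close>

lemma lower_factor_ln:
  assumes k: "k \<ge> 1" and p: "prime p"
  defines "L \<equiv> of_int \<lfloor>2 * k\<rfloor> * k"
  shows "lower_factor k (real p) > 0"
    and "ln (lower_factor k (real p)) = k\<^sup>2 * ln (1 - 1 / real p) + k\<^sup>2 / L * ln (1 + L / real p)"
    and "\<bar>ln (lower_factor k (real p))\<bar> \<le> k\<^sup>2 * (2 + L) * real p powr (- 2)"
    and "- (k\<^sup>2 * (2 + L) * real p powr (- 2)) \<le> ln (lower_factor k (real p))"
    and "- (2 * k\<^sup>2 / real p) \<le> ln (lower_factor k (real p))"
proof -
  define M where "M = (of_int \<lfloor>2 * k\<rfloor> :: real)"
  have M: "M \<ge> 2" using k by (simp add: M_def le_floor_iff)
  have L: "L = M * k" "L > 0" using M k by (auto simp: L_def M_def)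
  have kM: "k / M = k\<^sup>2 / L" using M k by (simp add: L power2_eq_square)
  define x where "x = 1 / real p"
  have p2: "real p \<ge> 2" using prime_ge_2_nat[OF p] by simp
  have x: "0 < x" "x \<le> 1/2" using p2 by (auto simp: x_def field_simps)
  have xx: "real p powr (- 2) = x\<^sup>2"
    using p2 by (simp add: x_def powr_minus inverse_eq_divide power_divide)
  have Lx: "1 + L * x > 0" using L x by (simp add: add_pos_pos)
  have lf: "lower_factor k (real p) = (1 - x) powr (k\<^sup>2) * (1 + L * x) powr (k\<^sup>2 / L)"
    using kM unfolding M_def lower_factor_def x_def L_def[symmetric] by simp
  show "lower_factor k (real p) > 0" unfolding lf using x Lx by simp
  have ln1: "ln (lower_factor k (real p)) = k\<^sup>2 * ln (1 - x) + k\<^sup>2 / L * ln (1 + L * x)"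
    unfolding lf using x Lx by (simp add: ln_mult ln_powr)
  then show "ln (lower_factor k (real p)) = k\<^sup>2 * ln (1 - 1 / real p) + k\<^sup>2 / L * ln (1 + L / real p)"
    by (simp add: x_def)
  have kL: "k\<^sup>2 / L \<ge> 0" using L by simp
  have A: "k\<^sup>2 * (- x - 2 * x\<^sup>2) \<le> k\<^sup>2 * ln (1 - x)"
  proof (intro mult_left_mono)
    have "x\<^sup>2 / (1 - x) \<le> x\<^sup>2 / (1/2)" using x by (intro divide_left_mono) auto
    then show "- x - 2 * x\<^sup>2 \<le> ln (1 - x)" using ln_one_minus_bounds(1)[of x] x by simp
  qed auto
  have A': "k\<^sup>2 * ln (1 - x) \<le> k\<^sup>2 * (- x)" using ln_one_minus_bounds(2)[of x] x by (intro mult_left_mono) auto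
  have B: "k\<^sup>2 / L * (L * x - (L * x)\<^sup>2) \<le> k\<^sup>2 / L * ln (1 + L * x)"
  proof (intro mult_left_mono kL)
    have "ln (1 / (1 + L * x)) \<le> 1 / (1 + L * x) - 1" using Lx by (intro ln_le_minus_one) auto
    then have "1 - 1 / (1 + L * x) \<le> ln (1 + L * x)" using Lx by (simp add: ln_div)
    moreover have "L * x - (L * x)\<^sup>2 \<le> 1 - 1 / (1 + L * x)"
    proof -
      define v where "v = L * x"
      have v: "v \<ge> 0" using L x by (simp add: v_def)
      have "(v - v\<^sup>2) * (1 + v) \<le> v" using v by (simp add: power2_eq_square algebra_simps)
      then have "v - v\<^sup>2 \<le> v / (1 + v)" using v by (simp add: pos_le_divide_eq)
      also have "\<dots> = 1 - 1 / (1 + v)" using v by (simp add: field_simps)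
      finally show ?thesis by (simp add: v_def)
    qed
    ultimately show "L * x - (L * x)\<^sup>2 \<le> ln (1 + L * x)" by linarith
  qed
  have B': "k\<^sup>2 / L * ln (1 + L * x) \<le> k\<^sup>2 / L * (L * x)"
    using ln_add_one_self_le_self[of "L * x"] L x kL by (intro mult_left_mono) auto
  have e1: "k\<^sup>2 / L * (L * x) = k\<^sup>2 * x" using L(2) by simp
  have e2: "k\<^sup>2 / L * (L * x - (L * x)\<^sup>2) = k\<^sup>2 * x - k\<^sup>2 * L * x\<^sup>2" using L(2) by (simp add: field_simps power2_eq_square)
  have lo: "- (k\<^sup>2 * (2 + L) * x\<^sup>2) \<le> ln (lower_factor k (real p))"
    unfolding ln1 using A B unfolding e2 by (simp add: algebra_simps)
  then show "- (k\<^sup>2 * (2 + L) * real p powr (- 2)) \<le> ln (lower_factor k (real p))" by (simp add: xx)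
  have "ln (lower_factor k (real p)) \<le> 0"
    unfolding ln1 using A' B' unfolding e1 by linarith
  moreover have "k\<^sup>2 * (2 + L) * x\<^sup>2 \<ge> 0" using L by auto
  ultimately show "\<bar>ln (lower_factor k (real p))\<bar> \<le> k\<^sup>2 * (2 + L) * real p powr (- 2)" using lo by (simp add: xx)
  have "k\<^sup>2 * (- 2 * x) \<le> k\<^sup>2 * ln (1 - x)"
  proof (intro mult_left_mono)
    have "x\<^sup>2 / (1 - x) \<le> x\<^sup>2 / x" using x by (intro divide_left_mono) auto
    also have "\<dots> = x" using x by (simp add: power2_eq_square)
    finally show "- 2 * x \<le> ln (1 - x)" using ln_one_minus_bounds(1)[of x] x by simp
  qed auto
  moreover have "k\<^sup>2 / L * ln (1 + L * x) \<ge> 0" using kL L x by (intro mult_nonneg_nonneg ln_ge_zero) auto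
  moreover have "k\<^sup>2 * (- 2 * x) = - (2 * k\<^sup>2 / real p)" by (simp add: x_def)
  ultimately show "- (2 * k\<^sup>2 / real p) \<le> ln (lower_factor k (real p))" unfolding ln1 by linarith
qed

text \<open>The squarefree sum has logarithmic exponent \<open>L = M * k\<close>. Raising it to the
  power \<open>k / M\<close> produces the exponent \<open>k\<^sup>2\<close> and turns the normalised
  Euler factors \<open>E.R 0 p\<close> into the lower factors.\<close>

theorem liminf_lower:
  assumes k: "k \<ge> 1"
  shows "liminf (\<lambda>N. ereal (normalized_pseudomoment k N)) \<ge> ereal (lower_const k)"
proof -
  define M where "M = nat \<lfloor>2 * k\<rfloor>"
  have Mi: "real M = of_int \<lfloor>2 * k\<rfloor>" using k by (simp add: M_def)
  have M: "M > 0" "real M \<le> 2 * k" "k \<le> real M" unfolding Mi using k by (simp add: M_def, linarith, linarith)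
  define L where "L = M * k"
  have M1: "real M \<ge> 1" using M by (simp add: Suc_le_eq)
  have L: "L \<ge> 1" using mult_mono[of 1 "real M" 1 k] M1 k by (simp add: L_def)
  interpret E: euler_conv "lower_weight L" L "L\<^sup>2 + L^3" by (rule euler_conv_lower_weight[OF L])
  define G where "G = Gamma (L + 1)"
  have G: "G > 0" unfolding G_def using L by (intro Gamma_real_pos) auto
  have R: "E.R 0 p = (1 - 1 / real p) powr L * (1 + L / real p)" if "prime p" for p
  proof -
    have "euler_factor (lower_weight L) (- (1 + 0)) p = 1 + L * real p powr (- (1 + 0))"
      unfolding euler_factor_def using lower_weight_euler_factor by (simp add: sums_iff)
    moreover have "real p powr (- (1 + 0)) = 1 / real p" using that by (simp add: powr_minus inverse_eq_divide prime_gt_0_nat)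
    ultimately show ?thesis by (simp add: E.R_def)
  qed
  have lf: "lower_factor k (real p) = E.R 0 p powr (k / M)" if p: "prime p" for p
  proof -
    have p2: "real p \<ge> 2" using prime_ge_2_nat[OF p] by simp
    have "E.R 0 p powr (k / M) = (1 - 1 / real p) powr (L * (k / M)) * (1 + L / real p) powr (k / M)"
      unfolding R[OF p] by (simp add: powr_mult powr_powr)
    also have "L * (k / M) = k\<^sup>2" using M by (simp add: L_def power2_eq_square)
    finally show ?thesis by (simp add: lower_factor_def L_def Mi)
  qed
  have "(\<lambda>N. \<Prod>p\<in>primes_upto N. lower_factor k (real p)) \<longlonglongrightarrow> prime_prod (lower_factor k)"
    using lower_factor_ln[OF k] by (intro prime_prod_limit(1)) auto
  moreover have "(\<lambda>N. \<Prod>p\<in>primes_upto N. lower_factor k (real p)) \<longlonglongrightarrow> E.H 0 powr (k / M)"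
  proof -
    have "(\<Prod>p\<in>primes_upto N. lower_factor k (real p)) = (\<Prod>p\<in>primes_upto N. E.R 0 p) powr (k / M)" for N
      unfolding prod_powr_distrib by (intro prod.cong refl lf primes_uptoD)
    then show ?thesis using E.H_pos[of 0] by (simp only:) (intro tendsto_powr E.prod_R tendsto_const, auto)
  qed
  ultimately have PP: "prime_prod (lower_factor k) = E.H 0 powr (k / M)" by (rule LIMSEQ_unique)
  have lc: "lower_const k = (E.H 0 / G) powr (k / M)"
    using PP G by (simp add: lower_const_def lower_factor_def[abs_def] powr_divide G_def L_def Mi)
  have "(\<lambda>N. ((\<Sum>n=1..N. mult_fun (lower_weight L) n / real n) / ln (real N) powr L) powr (k / M)) \<longlonglongrightarrow> lower_const k"
    unfolding lc G_def using E.H_pos[of 0] G by (intro tendsto_powr E.partial_sum_asymp tendsto_const) (auto simp: G_def)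
  then have "(\<lambda>N. ereal (((\<Sum>n=1..N. mult_fun (lower_weight L) n / real n) / ln (real N) powr L) powr (k / M))) \<longlonglongrightarrow> ereal (lower_const k)"
    by (rule tendsto_ereal)
  then have "ereal (lower_const k) = liminf (\<lambda>N. ereal (((\<Sum>n=1..N. mult_fun (lower_weight L) n / real n) / ln (real N) powr L) powr (k / M)))"
    by (rule lim_imp_Liminf[OF sequentially_bot, symmetric])
  also have "\<dots> \<le> liminf (\<lambda>N. ereal (normalized_pseudomoment k N))"
  proof (rule Liminf_mono)
    show "\<forall>\<^sub>F N in sequentially. ereal (((\<Sum>n=1..N. mult_fun (lower_weight L) n / real n) / ln (real N) powr L) powr (k / M)) \<le> ereal (normalized_pseudomoment k N)"
      using eventually_gt_at_top[of 1]
    proof eventually_elim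
      case (elim N)
      have "((\<Sum>n=1..N. mult_fun (lower_weight L) n / real n) / ln (real N) powr L) powr (k / M) = (\<Sum>n=1..N. mult_fun (lower_weight L) n / real n) powr (k / M) / ln (real N) powr (L * (k / M))"
        by (simp add: powr_divide powr_powr)
      also have "L * (k / M) = k\<^sup>2" using M by (simp add: L_def power2_eq_square)
      also have "(\<Sum>n=1..N. mult_fun (lower_weight L) n / real n) powr (k / M) / ln (real N) powr k\<^sup>2 \<le> normalized_pseudomoment k N"
        unfolding normalized_pseudomoment_def using pseudomoment_ge[OF k _ M, of N] elim
        by (intro divide_right_mono) (auto simp: L_def)
      finally show ?case by simp
    qed
  qed
  finally show ?thesis .
qed

subsection \<open>Large exponents\<close>

text \<open>On \<open>[x, \<infinity>)\<close> the integrand of the Gamma integral is at least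
  \<open>x powr x * exp (- t)\<close>.\<close>

lemma Gamma_lower:
  fixes x :: real
  assumes x: "x > 0"
  shows "exp (x * ln x - x) \<le> Gamma (x + 1)"
proof (rule has_integral_le)
  show "((\<lambda>t. t powr ((x + 1) - 1) / exp t) has_integral Gamma (x + 1)) {0..}"
    using x by (intro Gamma_integral_real) auto
  have "((\<lambda>t. exp (- 1 * t)) has_integral exp (- 1 * x) / 1) {x..}"
    by (rule has_integral_exp_minus_to_infinity) simp
  then have "((\<lambda>t. x powr x * exp (- 1 * t)) has_integral x powr x * (exp (- 1 * x) / 1)) {x..}"
    by (rule has_integral_mult_right)
  also have "x powr x * (exp (- 1 * x) / 1) = exp (x * ln x - x)"
    using x by (simp add: powr_def flip: exp_add)
  finally show "((\<lambda>t. if t \<in> {x..} then x powr x * exp (- 1 * t) else 0) has_integral exp (x * ln x - x)) {0..}"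
    using x by (subst has_integral_restrict) auto
  fix t :: real assume "t \<in> {0..}"
  then show "(if t \<in> {x..} then x powr x * exp (- 1 * t) else 0) \<le> t powr ((x + 1) - 1) / exp t"
    using x by (auto simp: exp_minus field_simps intro!: powr_mono2)
qed

text \<open>By \<open>ln y \<le> y - 1\<close> at \<open>y = t / (2 * x)\<close>, the integrand is
  at most \<open>(2 * x) powr x * exp (- t / 2)\<close>. The remaining integral is 2, which is
  absorbed into \<open>2 powr x\<close>.\<close>

lemma Gamma_upper:
  fixes x :: real
  assumes x: "x \<ge> 1"
  shows "Gamma (x + 1) \<le> (4 * x) powr x"
proof -
  have "Gamma (x + 1) \<le> (2 * x) powr x * (exp (- (1/2) * 0) / (1/2))"
  proof (rule has_integral_le)
    show "((\<lambda>t. t powr ((x + 1) - 1) / exp t) has_integral Gamma (x + 1)) {0..}"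
      using x by (intro Gamma_integral_real) auto
    show "((\<lambda>t. (2 * x) powr x * exp (- (1/2) * t)) has_integral (2 * x) powr x * (exp (- (1/2) * 0) / (1/2))) {0..}"
      by (intro has_integral_mult_right has_integral_exp_minus_to_infinity) simp
    fix t :: real assume "t \<in> {0..}"
    show "t powr ((x + 1) - 1) / exp t \<le> (2 * x) powr x * exp (- (1/2) * t)"
    proof (cases "t = 0")
      case False
      then have t: "t > 0" using \<open>t \<in> {0..}\<close> by simp
      have "ln (t / (2 * x)) \<le> t / (2 * x) - 1" using t x by (intro ln_le_minus_one) auto
      then have "x * ln (t / (2 * x)) \<le> x * (t / (2 * x))" using x by (intro mult_left_mono) auto
      moreover have "x * (t / (2 * x)) = t / 2" using x by simp
      moreover have "ln (t / (2 * x)) = ln t - ln (2 * x)" using t x by (intro ln_divide_pos) auto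
      ultimately have le: "x * ln t - t \<le> x * ln (2 * x) + - (1/2) * t" by (simp add: right_diff_distrib)
      have "t powr ((x + 1) - 1) / exp t = exp (x * ln t - t)" using t by (simp add: powr_def exp_diff)
      also have "\<dots> \<le> exp (x * ln (2 * x) + - (1/2) * t)" using le by (simp only: exp_le_cancel_iff)
      also have "\<dots> = (2 * x) powr x * exp (- (1/2) * t)" using x by (simp only: exp_add) (simp add: powr_def)
      finally show ?thesis .
    qed (use x in simp)
  qed
  also have "\<dots> = (2 * x) powr x * 2 powr 1" by simp
  also have "\<dots> \<le> (2 * x) powr x * 2 powr x" using x by (intro mult_left_mono powr_mono) auto
  also have "\<dots> = (2 * x * 2) powr x" by (rule powr_mult[symmetric])
  also have "2 * x * 2 = 4 * x" by simp
  finally show ?thesis .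
qed

text \<open>With \<open>\<sigma> = 1 / ln N\<close> every prime \<open>p \<le> N\<close> satisfies
  \<open>p powr \<sigma> \<le> exp 1\<close>, so moving the exponent from 1 to
  \<open>1 + \<sigma>\<close> costs at most this factor, and the new sum is at most the logarithm of
  zeta at \<open>1 + \<sigma>\<close>. A constant factor is affordable: for \<open>N\<close> of size
  \<open>k\<^sup>2\<close> the bound is \<open>O(ln (ln k))\<close>, against an allowance of
  \<open>o(ln k)\<close>.\<close>

lemma sum_prime_reciprocals_le:
  assumes N: "N \<ge> 2"
  shows "(\<Sum>p\<in>primes_upto N. 1 / real p) \<le> exp 1 * ln (1 + ln (real N))"
proof -
  define \<sigma> where "\<sigma> = 1 / ln (real N)"
  have lN: "ln (real N) > 0" using N by simp
  have s: "\<sigma> > 0" using lN by (simp add: \<sigma>_def)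
  define x where "x p = real p powr (- (1 + \<sigma>))" for p
  have x: "0 < x p" "x p \<le> 1/2" if "prime p" for p
    unfolding x_def using prime_powr_less_1[OF that, of \<sigma>] s by auto
  define a where "a M = (\<Prod>p\<in>primes_upto M. 1 / (1 - x p))" for M
  have "incseq a"
  proof (rule incseq_SucI)
    fix M
    have ge1: "1 \<le> 1 / (1 - x p)" if "prime p" for p using x[OF that] by simp
    show "a M \<le> a (Suc M)" unfolding a_def
    proof (rule prod_mono2)
      show "0 \<le> 1 / (1 - x p)" if "p \<in> primes_upto M" for p
        using ge1[OF primes_uptoD[OF that]] by linarith
    qed (auto simp: primes_upto_def intro: ge1)
  qed
  then have "a N \<le> zeta_series \<sigma>" using zeta_series_euler[OF s] by (intro incseq_le) (auto simp: a_def[abs_def] x_def)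
  also have "\<dots> \<le> 1 + ln (real N)"
    using zeta_series_bounds(2)[OF s] lN by (simp add: \<sigma>_def field_simps)
  finally have aN: "a N \<le> 1 + ln (real N)" .
  have "(\<Sum>p\<in>primes_upto N. 1 / real p) \<le> (\<Sum>p\<in>primes_upto N. exp 1 * ln (1 / (1 - x p)))"
  proof (rule sum_mono)
    fix p assume "p \<in> primes_upto N"
    then have p: "prime p" "p \<le> N" by (auto simp: primes_upto_def)
    have p0: "real p > 0" using prime_gt_0_nat[OF p(1)] by simp
    have "real p powr \<sigma> \<le> real N powr \<sigma>" using p s by (intro powr_mono2) auto
    also have "\<dots> = exp 1" using lN N by (simp add: powr_def \<sigma>_def)
    finally have "real p powr \<sigma> \<le> exp 1" .
    then have "real p powr \<sigma> * x p \<le> exp 1 * x p" using x(1)[OF p(1)] by simp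
    moreover have "real p powr \<sigma> * x p = 1 / real p"
      using p0 by (simp add: x_def powr_minus_divide flip: powr_add)
    ultimately have "1 / real p \<le> exp 1 * x p" by simp
    also have "x p \<le> ln (1 / (1 - x p))"
      using ln_one_minus_bounds(2)[of "x p"] x[OF p(1)] by (simp add: ln_div)
    finally show "1 / real p \<le> exp 1 * ln (1 / (1 - x p))" by simp
  qed
  also have "\<dots> = exp 1 * ln (a N)"
  proof -
    have "1 / (1 - x p) \<noteq> 0" if "p \<in> primes_upto N" for p using x[OF primes_uptoD[OF that]] by simp
    then have "ln (a N) = (\<Sum>p\<in>primes_upto N. ln (1 / (1 - x p)))" unfolding a_def by (rule ln_prod[OF finite_primes_upto])
    then show ?thesis by (simp only: sum_distrib_left)
  qed
  also have "\<dots> \<le> exp 1 * ln (1 + ln (real N))"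
  proof -
    have "1 / (1 - x p) > 0" if "p \<in> primes_upto N" for p using x[OF primes_uptoD[OF that]] by simp
    then have "a N > 0" unfolding a_def by (intro prod_pos) auto
    then show ?thesis using aN by simp
  qed
  finally show ?thesis .
qed

lemma sum_inverse_squares_tail:
  assumes K: "K > 0" "K \<le> N"
  shows "(\<Sum>n\<in>{K<..N}. real n powr (- 2)) \<le> 1 / real K"
proof -
  have "(\<Sum>n\<in>{K<..N}. real n powr (- 2)) \<le> 1 / real K - 1 / real N"
    using K(2)
  proof (induction N rule: dec_induct)
    case (step N)
    have N: "real N > 0" using K step by simp
    have "real (Suc N) powr (- 2) = 1 / (real (Suc N))\<^sup>2"
      by (simp add: powr_minus inverse_eq_divide)
    also have "\<dots> \<le> 1 / (real N * real (Suc N))"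
      using N by (intro divide_left_mono) (auto simp: power2_eq_square)
    also have "\<dots> = 1 / real N - 1 / real (Suc N)" using N by (simp add: field_simps)
    finally have "real (Suc N) powr (- 2) \<le> 1 / real N - 1 / real (Suc N)" .
    moreover have "{K<..Suc N} = insert (Suc N) {K<..N}" using step by auto
    ultimately show ?case using step.IH by simp
  qed simp
  then show ?thesis using K by (smt (verit) divide_nonneg_nonneg of_nat_0_le_iff)
qed

text \<open>The main term is \<open>Gamma (k + 1) powr k\<close>, with logarithm at least
  \<open>k\<^sup>2 * ln k - k\<^sup>2\<close>. The product over the primes is only
  \<open>exp (O(k\<^sup>2))\<close>; the two contributions of order \<open>k\<^sup>2\<close> are the
  1 and the \<open>6 * C\<close> in the numerator of \<open>e\<close>.\<close>

lemma upper_const_asymp: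
  "\<exists>e::real \<Rightarrow> real. (e \<longlongrightarrow> 0) at_top \<and>
     (\<forall>\<^sub>F k in at_top. upper_const k \<le> exp ((- 1 + e k) * k\<^sup>2 * ln k))"
proof (intro exI conjI)
  define C where "C = (\<Sum>n. real n powr (- 2))"
  define e where "e = (\<lambda>k::real. (1 + 6 * C) / ln k)"
  show "(e \<longlongrightarrow> 0) at_top" unfolding e_def by real_asymp
  show "\<forall>\<^sub>F k in at_top. upper_const k \<le> exp ((- 1 + e k) * k\<^sup>2 * ln k)"
    using eventually_ge_at_top[of 2]
  proof eventually_elim
    case (elim k)
    then have k: "k \<ge> 1" "k > 0" "ln k > 0" by auto
    define m where "m = (of_int \<lfloor>k\<rfloor> :: real)"
    define s where "s = k / m"
    have m: "m \<ge> 2" using elim by (simp add: m_def le_floor_iff)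
    have "k < m + 1" unfolding m_def by linarith
    \<comment> \<open>Restricting to \<open>k \<ge> 2\<close> keeps \<open>s\<close> away from 2,
      where the bound for the upper factors blows up.\<close>
    then have s: "s \<le> 3/2" "s \<ge> 0" using m k by (auto simp: s_def divide_le_eq)
    have "s / (1 - s / 2) \<le> (3/2) / (1/4)" using s by (intro frac_le) auto
    then have c: "s / (1 - s / 2) \<le> 6" by simp
    define l where "l n = (if prime n then ln (upper_factor k (real n)) else 0)" for n :: nat
    obtain D where D: "\<And>p. prime p \<Longrightarrow> \<bar>ln (upper_factor k (real p))\<bar> \<le> D * real p powr (- 2)"
      using upper_factor_ln_abs[OF k(1)] by blast
    have l: "l n \<le> 6 * k\<^sup>2 * real n powr (- 2)" for n
    proof (cases "prime n")
      case True
      have "k\<^sup>2 * s / (1 - s / 2) * real n powr (- 2) \<le> 6 * k\<^sup>2 * real n powr (- 2)"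
        using mult_left_mono[OF c, of "k\<^sup>2"] by (intro mult_right_mono) (auto simp: mult.commute)
      then show ?thesis using upper_factor_ln(3)[OF k(1) True] True by (simp add: l_def s_def m_def)
    qed (simp add: l_def)
    have sl: "summable l"
      unfolding l_def[abs_def] by (rule prime_prod_limit(3)[OF upper_factor_ln(1)[OF k(1)] D])
    have "(\<Sum>n. l n) \<le> (\<Sum>n. 6 * k\<^sup>2 * real n powr (- 2))"
      by (intro suminf_le l sl summable_powr_m2)
    also have "\<dots> = 6 * k\<^sup>2 * C"
      unfolding C_def using summable_powr_m2[of 1] by (intro suminf_mult) simp
    finally have sum: "(\<Sum>n. l n) \<le> 6 * k\<^sup>2 * C" .
    have pp: "prime_prod (upper_factor k) = exp (\<Sum>n. l n)"
      unfolding l_def by (rule prime_prod_limit(2)[OF upper_factor_ln(1)[OF k(1)] D])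
    have "exp (k * (k * ln k - k)) = exp (k * ln k - k) powr k" by (simp add: powr_def)
    also have "\<dots> \<le> Gamma (k + 1) powr k" using Gamma_lower[OF k(2)] k by (intro powr_mono2) auto
    finally have G: "exp (k * (k * ln k - k)) \<le> Gamma (k + 1) powr k" .
    have "upper_const k = 1 / Gamma (k + 1) powr k * exp (\<Sum>n. l n)"
      unfolding upper_const_def pp[symmetric] by (simp only: upper_factor_def[abs_def])
    also have "\<dots> \<le> 1 / exp (k * (k * ln k - k)) * exp (6 * k\<^sup>2 * C)"
    proof (intro mult_mono divide_left_mono G)
      have "0 < exp (k * (k * ln k - k))" by simp
      then have "0 < Gamma (k + 1) powr k" using G by linarith
      then show "0 < Gamma (k + 1) powr k * exp (k * (k * ln k - k))" by simp
    qed (use sum in auto)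
    also have "\<dots> = exp (6 * k\<^sup>2 * C - k * (k * ln k - k))" by (simp add: exp_diff)
    also have "6 * k\<^sup>2 * C - k * (k * ln k - k) = (- 1 + e k) * k\<^sup>2 * ln k"
      using k(3) by (simp add: e_def field_simps power2_eq_square)
    finally show ?case .
  qed
qed

text \<open>\<open>Gamma (L + 1) powr (k / M)\<close> is at most
  \<open>(4 * L) powr (k\<^sup>2)\<close>, and \<open>L \<le> 2 * k\<^sup>2\<close> makes this
  \<open>exp (2 * k\<^sup>2 * ln k + O(k\<^sup>2))\<close>, the origin of the \<open>-2\<close>. In
  the product, primes up to about \<open>2 * k\<^sup>2\<close> cost
  \<open>O(k\<^sup>2 * ln (ln k))\<close> in the exponent through the sum of their reciprocals, and
  larger primes cost \<open>O(k\<^sup>2)\<close>.\<close>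

lemma lower_const_asymp:
  "\<exists>e::real \<Rightarrow> real. (e \<longlongrightarrow> 0) at_top \<and>
     (\<forall>\<^sub>F k in at_top. lower_const k \<ge> exp ((- 2 + e k) * k\<^sup>2 * ln k))"
proof (intro exI conjI)
  define e where "e = (\<lambda>k::real. - (ln 8 + 2 + 2 * exp 1 * ln (1 + ln (3 * k\<^sup>2))) / ln k)"
  show "(e \<longlongrightarrow> 0) at_top" unfolding e_def by real_asymp
  show "\<forall>\<^sub>F k in at_top. lower_const k \<ge> exp ((- 2 + e k) * k\<^sup>2 * ln k)"
    using eventually_ge_at_top[of 2]
  proof eventually_elim
    case (elim k)
    then have k: "k \<ge> 1" "k > 0" "ln k > 0" by auto
    define M where "M = (of_int \<lfloor>2 * k\<rfloor> :: real)"
    define L where "L = M * k"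
    \<comment> \<open>Since \<open>L \<le> 2 * k\<^sup>2 \<le> K\<close> and
      \<open>K \<ge> 2\<close>, the tail bound \<open>k\<^sup>2 * (2 + L) / K\<close> is at most
      \<open>2 * k\<^sup>2\<close>.\<close>
    define K where "K = nat \<lceil>2 * k\<^sup>2\<rceil>"
    have M: "M \<ge> 2" "M \<le> 2 * k" unfolding M_def using k by (auto simp: le_floor_iff)
    have L1: "L \<ge> 1" using mult_mono[of 1 M 1 k] M k by (simp add: L_def)
    have L2: "L \<le> 2 * k\<^sup>2" using mult_right_mono[OF M(2), of k] k by (simp add: L_def power2_eq_square mult.assoc)
    have kk: "k\<^sup>2 \<ge> 4" using power_mono[of 2 k 2] elim by simp
    have K: "2 * k\<^sup>2 \<le> real K" "real K \<le> 3 * k\<^sup>2"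
      unfolding K_def using kk by linarith+
    have K2: "K \<ge> 2" using K kk by linarith
    define l where "l n = (if prime n then ln (lower_factor k (real n)) else 0)" for n :: nat
    define S where "S = 2 * k\<^sup>2 * (exp 1 * ln (1 + ln (3 * k\<^sup>2))) + 2 * k\<^sup>2"
    note lf = lower_factor_ln[OF k(1), folded M_def, folded L_def]
    have part: "- S \<le> (\<Sum>n\<le>N. l n)" if N: "N \<ge> K" for N
    proof -
      have "(\<Sum>n\<in>{..K}. - l n) \<le> (\<Sum>p\<in>primes_upto K. 2 * k\<^sup>2 * (1 / real p))"
      proof -
        have "(\<Sum>n\<in>{..K}. - l n) = (\<Sum>n\<in>primes_upto K. - l n)"
          by (rule sum.mono_neutral_right) (auto simp: primes_upto_def l_def)
        also have "\<dots> \<le> (\<Sum>p\<in>primes_upto K. 2 * k\<^sup>2 * (1 / real p))"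
        proof (rule sum_mono)
          fix p assume "p \<in> primes_upto K"
          then have p: "prime p" by (rule primes_uptoD)
          show "- l p \<le> 2 * k\<^sup>2 * (1 / real p)" using lf(5)[OF p] p by (simp add: l_def)
        qed
        finally show ?thesis .
      qed
      also have "\<dots> = 2 * k\<^sup>2 * (\<Sum>p\<in>primes_upto K. 1 / real p)" by (rule sum_distrib_left[symmetric])
      also have "\<dots> \<le> 2 * k\<^sup>2 * (exp 1 * ln (1 + ln (3 * k\<^sup>2)))"
      proof (intro mult_left_mono order_trans[OF sum_prime_reciprocals_le[OF K2]])
        have "ln (real K) \<ge> 0" using K2 by simp
        moreover have "ln (real K) \<le> ln (3 * k\<^sup>2)" using K(2) K2 by (intro ln_mono) auto
        ultimately show "ln (1 + ln (real K)) \<le> ln (1 + ln (3 * k\<^sup>2))" by simp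
      qed auto
      finally have 1: "(\<Sum>n\<in>{..K}. - l n) \<le> 2 * k\<^sup>2 * (exp 1 * ln (1 + ln (3 * k\<^sup>2)))" .
      have "(\<Sum>n\<in>{K<..N}. - l n) \<le> (\<Sum>n\<in>{K<..N}. k\<^sup>2 * (2 + L) * real n powr (- 2))"
      proof (rule sum_mono)
        fix n
        have "0 \<le> k\<^sup>2 * (2 + L) * real n powr (- 2)" using L1 by simp
        then show "- l n \<le> k\<^sup>2 * (2 + L) * real n powr (- 2)"
          using lf(4)[of n] unfolding l_def by (cases "prime n") auto
      qed
      also have "\<dots> = k\<^sup>2 * (2 + L) * (\<Sum>n\<in>{K<..N}. real n powr (- 2))" by (rule sum_distrib_left[symmetric])
      also have "\<dots> \<le> k\<^sup>2 * (2 + L) * (1 / real K)"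
        using N K2 L1 by (intro mult_left_mono sum_inverse_squares_tail) auto
      also have "\<dots> = k\<^sup>2 * ((2 + L) / real K)" by simp
      also have "\<dots> \<le> k\<^sup>2 * 2"
        using L2 K K2 kk by (intro mult_left_mono) (auto simp: divide_le_eq)
      finally have 2: "(\<Sum>n\<in>{K<..N}. - l n) \<le> 2 * k\<^sup>2" by simp
      have "{..N} = {..K} \<union> {K<..N}" using N by auto
      then have "(\<Sum>n\<le>N. l n) = (\<Sum>n\<in>{..K}. l n) + (\<Sum>n\<in>{K<..N}. l n)"
        by (simp only:) (intro sum.union_disjoint; auto)
      then show ?thesis using 1 2 by (simp add: S_def sum_negf)
    qed
    have lim: "(\<lambda>N. \<Sum>n\<le>N. l n) \<longlonglongrightarrow> (\<Sum>n. l n)"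
      unfolding l_def[abs_def] by (rule summable_LIMSEQ'[OF prime_prod_limit(3)[OF lf(1) lf(3)]])
    have sum: "- S \<le> (\<Sum>n. l n)"
      by (rule tendsto_lowerbound[OF lim eventually_mono[OF eventually_ge_at_top[of K] part]]) auto
    have pp: "prime_prod (lower_factor k) = exp (\<Sum>n. l n)"
      unfolding l_def by (rule prime_prod_limit(2)[OF lf(1) lf(3)])
    have Gp: "Gamma (L + 1) > 0" using L1 by (intro Gamma_real_pos) auto
    have kM: "L * (k / M) = k\<^sup>2" using M by (simp add: L_def power2_eq_square)
    have "Gamma (L + 1) powr (k / M) \<le> ((4 * L) powr L) powr (k / M)"
      using Gamma_upper[OF L1] Gp k M by (intro powr_mono2) auto
    also have "\<dots> = (4 * L) powr (k\<^sup>2)" by (simp only: powr_powr kM)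
    also have "\<dots> \<le> (8 * k\<^sup>2) powr (k\<^sup>2)" using L1 L2 by (intro powr_mono2) auto
    also have "\<dots> = exp (k\<^sup>2 * (ln 8 + 2 * ln k))"
      using k by (simp add: powr_def ln_mult ln_realpow)
    finally have G: "Gamma (L + 1) powr (k / M) \<le> exp (k\<^sup>2 * (ln 8 + 2 * ln k))" .
    have "(- 2 + e k) * k\<^sup>2 * ln k = - S - k\<^sup>2 * (ln 8 + 2 * ln k)"
      using k(3) by (simp add: e_def S_def field_simps)
    then have "exp ((- 2 + e k) * k\<^sup>2 * ln k) = 1 / exp (k\<^sup>2 * (ln 8 + 2 * ln k)) * exp (- S)"
      by (simp add: exp_diff)
    also have "\<dots> \<le> 1 / Gamma (L + 1) powr (k / M) * exp (\<Sum>n. l n)"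
      using sum Gp G by (intro mult_mono divide_left_mono) auto
    also have "\<dots> = lower_const k"
      unfolding lower_const_def pp[symmetric] by (simp only: lower_factor_def[abs_def] M_def L_def)
    finally show ?case .
  qed
qed

theorem theorem1:
  shows "(\<forall>k::real. k \<ge> 1 \<longrightarrow>
            limsup (\<lambda>N. ereal (normalized_pseudomoment k N)) \<le> ereal (upper_const k) \<and>
            liminf (\<lambda>N. ereal (normalized_pseudomoment k N)) \<ge> ereal (lower_const k)) \<and>
         (\<exists>e::real \<Rightarrow> real. (e \<longlongrightarrow> 0) at_top \<and>
            (\<forall>\<^sub>F k in at_top. liminf (\<lambda>N. ereal (normalized_pseudomoment k N))
               \<ge> ereal (exp ((- 2 + e k) * k\<^sup>2 * ln k)))) \<and>
         (\<exists>e::real \<Rightarrow> real. (e \<longlongrightarrow> 0) at_top \<and>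
            (\<forall>\<^sub>F k in at_top. limsup (\<lambda>N. ereal (normalized_pseudomoment k N))
               \<le> ereal (exp ((- 1 + e k) * k\<^sup>2 * ln k))))"
proof (intro conjI allI impI)
  fix k :: real assume k: "k \<ge> 1"
  show "limsup (\<lambda>N. ereal (normalized_pseudomoment k N)) \<le> ereal (upper_const k)"
    by (rule limsup_upper[OF k])
  show "liminf (\<lambda>N. ereal (normalized_pseudomoment k N)) \<ge> ereal (lower_const k)"
    by (rule liminf_lower[OF k])
next
  obtain e :: "real \<Rightarrow> real" where e: "(e \<longlongrightarrow> 0) at_top"
    "\<forall>\<^sub>F k in at_top. lower_const k \<ge> exp ((- 2 + e k) * k\<^sup>2 * ln k)"
    using lower_const_asymp by blast
  have "\<forall>\<^sub>F k in at_top. liminf (\<lambda>N. ereal (normalized_pseudomoment k N)) \<ge> ereal (exp ((- 2 + e k) * k\<^sup>2 * ln k))"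
    using e(2) eventually_ge_at_top[of 1]
  proof eventually_elim
    case (elim k)
    then have "ereal (exp ((- 2 + e k) * k\<^sup>2 * ln k)) \<le> ereal (lower_const k)" by simp
    also have "\<dots> \<le> liminf (\<lambda>N. ereal (normalized_pseudomoment k N))" using elim by (intro liminf_lower)
    finally show ?case .
  qed
  with e(1) show "\<exists>e::real \<Rightarrow> real. (e \<longlongrightarrow> 0) at_top \<and>
            (\<forall>\<^sub>F k in at_top. liminf (\<lambda>N. ereal (normalized_pseudomoment k N))
               \<ge> ereal (exp ((- 2 + e k) * k\<^sup>2 * ln k)))" by blast
next
  obtain e :: "real \<Rightarrow> real" where e: "(e \<longlongrightarrow> 0) at_top"
    "\<forall>\<^sub>F k in at_top. upper_const k \<le> exp ((- 1 + e k) * k\<^sup>2 * ln k)"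
    using upper_const_asymp by blast
  have "\<forall>\<^sub>F k in at_top. limsup (\<lambda>N. ereal (normalized_pseudomoment k N)) \<le> ereal (exp ((- 1 + e k) * k\<^sup>2 * ln k))"
    using e(2) eventually_ge_at_top[of 1]
  proof eventually_elim
    case (elim k)
    then have "limsup (\<lambda>N. ereal (normalized_pseudomoment k N)) \<le> ereal (upper_const k)" by (intro limsup_upper)
    also have "\<dots> \<le> ereal (exp ((- 1 + e k) * k\<^sup>2 * ln k))" using elim by simp
    finally show ?case .
  qed
  with e(1) show "\<exists>e::real \<Rightarrow> real. (e \<longlongrightarrow> 0) at_top \<and>
            (\<forall>\<^sub>F k in at_top. limsup (\<lambda>N. ereal (normalized_pseudomoment k N))
               \<le> ereal (exp ((- 1 + e k) * k\<^sup>2 * ln k)))" by blast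
qed

end
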